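(* Let $\mathcal{C}>0$ and let $X$ be a $p_n$-ERW in direction $\ell\in\mathbb{S}^{1}$ on $\mathbb{Z}^2$ (that is, $d=2$) with $p_n=\mathcal{C}n^{-1/2}\wedge1$. For $n\ge1$ and $t\ge0$ let $$\hat B_t^n=\frac{X_{\lfloor nt\rfloor}}{n^{1/2}}+(nt-\lfloor nt\rfloor)\frac{X_{\lfloor nt\rfloor+1}-X_{\lfloor nt\rfloor}}{n^{1/2}}.$$ Then $\{\hat B^n_\cdot\}_{n\ge1}$ converges in distribution in $C_{\mathbb{R}^2}[0,\infty)$ to a $2$-dimensional Brownian motion.
   Context: Definition of the $p_n$-ERW in direction $\ell$ on $\mathbb{Z}^d$. Let $d\ge 2$, let $\ell\in\mathbb{S}^{d-1}$ (the unit sphere of $\mathbb{R}^d$), let $\|\cdot\|$ be the Euclidean norm, and let $\{p_n\}_{n\ge1}\subset(0,1]$. Let $\{\xi_i\}_{i\ge1}$ and $\{\gamma_i\}_{i\ge1}$ be sequences of $\mathbb{Z}^d$-valued random vectors on a probability space $(\Omega,\mathcal{F},\mathbb{P})$, adapted to a filtration $\{\mathcal{F}_n\}_{n\ge0}$ (with $\mathcal{F}_0$ containing all null sets), such that: (i) there is a constant $K>0$ with $\sup_{n}\|\xi_n\|\le K$ and $\sup_n\|\gamma_n\|\le K$ on every realization; (ii) there is a constant $\lambda>0$ such that for all $n\ge1$, $\mathbb{E}[\xi_n\mid\mathcal{F}_{n-1}]=0$ and $\mathbb{E}[\gamma_n\cdot\ell\mid\mathcal{F}_{n-1}]\ge\lambda$;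 (iii) $\{\xi_i\}$ is i.i.d. with zero mean vector and finite covariance matrix, and $\mathbb{P}[\xi_i\cdot\ell'=0]<1$ for all $\ell'\in\mathbb{S}^{d-1}$; (iv) $\{\gamma_i\}$ is i.i.d., and the sequences $\{\xi_i\}$ and $\{\gamma_i\}$ are independent of each other. Let $\{U_i\}_{i\ge1}$ be i.i.d. uniform on $[0,1]$, independent of $(\{\xi_i\},\{\gamma_i\})$. Set $X_0=0$, $E_0=\emptyset$, and for $n\ge1$ let $E_n=\{\exists k<n:\ X_k=X_n\}$. The process $X=\{X_n\}_{n\ge0}$ is defined by $$X_n=\sum_{i=1}^n\Big(\mathbf{1}_{E_{i-1}}\xi_i+\mathbf{1}_{E_{i-1}^c\cap\{U_i>p_i\}}\xi_i+\mathbf{1}_{E_{i-1}^c\cap\{U_i\le p_i\}}\gamma_i\Big),\quad n\ge1.$$ $C_{\mathbb{R}^d}[0,\infty)$ is the space of continuous functions $[0,\infty)\to\mathbb{R}^d$ with the metric $\rho(f,g)=\sum_{k\ge1}2^{-k}\sup_{0\le t\le k}(\|f(t)-g(t)\|\wedge1)$. "Brownian motion" means a centered Brownian motion started at $0$, with some (not necessarily identity) covariance matrix. $a\wedge b=\min(a,b)$. *)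

theory Defs
  imports "HOL-Probability.Probability"
begin

section \<open>The path space of continuous functions on the half-line\<close>

text \<open>A path is a function on \<open>[0,\<infinity>)\<close>, so its values at negative arguments are the fixed
  junk value prescribed by \<^const>\<open>extensional\<close>.\<close>

typedef (overloaded) 'b path =
  "{f :: real \<Rightarrow> 'b::real_normed_vector. f \<in> extensional {0..} \<and> continuous_on {0..} f}"
  morphisms path_at Abs_path
proof
  show "restrict (\<lambda>_. 0) {0..} \<in>
      {f :: real \<Rightarrow> 'b. f \<in> extensional {0..} \<and> continuous_on {0..} f}"
    by (auto intro!: continuous_on_eq[OF continuous_on_const[of _ 0]])
qed

setup_lifting type_definition_path

lemma continuous_on_path_at: "continuous_on {0..} (path_at f)"
  using path_at[of f] by auto

lemma path_eqI: "(\<And>t. t \<ge> 0 \<Longrightarrow> path_at f t = path_at g t) \<Longrightarrow> f = g"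
  using path_at[of f] path_at[of g]
  by (intro path_at_inject[THEN iffD1] extensionalityI[where A = "{0..}"]) auto

definition path_gap :: "'b::real_normed_vector path \<Rightarrow> 'b path \<Rightarrow> real \<Rightarrow> real" where
  "path_gap f g T = (SUP t\<in>{0..T}. min (norm (path_at f t - path_at g t)) 1)"

lemma path_gap_bdd:
  "bdd_above ((\<lambda>t. min (norm (path_at f t - path_at g t)) 1) ` {0..T})"
  by (rule bdd_aboveI2[where M = 1]) auto

lemma path_gap_upper:
  "0 \<le> t \<Longrightarrow> t \<le> T \<Longrightarrow> min (norm (path_at f t - path_at g t)) 1 \<le> path_gap f g T"
  unfolding path_gap_def by (rule cSUP_upper[OF _ path_gap_bdd]) auto

lemma path_gap_nonneg: "0 \<le> T \<Longrightarrow> 0 \<le> path_gap f g T"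
  using path_gap_upper[of 0 T f g] by (smt (verit) norm_ge_zero)

lemma path_gap_le_1: "0 \<le> T \<Longrightarrow> path_gap f g T \<le> 1"
  unfolding path_gap_def by (rule cSUP_least) auto

lemma path_gap_triangle: "0 \<le> T \<Longrightarrow> path_gap f g T \<le> path_gap f h T + path_gap g h T"
proof -
  assume T: "0 \<le> T"
  have "min (norm (path_at f t - path_at g t)) 1 \<le> path_gap f h T + path_gap g h T"
    if t: "t \<in> {0..T}" for t
  proof -
    have "norm (path_at f t - path_at g t) \<le>
        norm (path_at f t - path_at h t) + norm (path_at g t - path_at h t)"
      using norm_triangle_ineq4[of "path_at f t - path_at h t" "path_at g t - path_at h t"]
      by simp
    then have "min (norm (path_at f t - path_at g t)) 1 \<le>
        min (norm (path_at f t - path_at h t)) 1 + min (norm (path_at g t - path_at h t)) 1"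
      using norm_ge_zero[of "path_at f t - path_at h t"] norm_ge_zero[of "path_at g t - path_at h t"]
      by linarith
    then show ?thesis
      using path_gap_upper[of t T f h] path_gap_upper[of t T g h] t by auto
  qed
  with T show ?thesis
    unfolding path_gap_def[of f g T] by (intro cSUP_least) auto
qed

text \<open>The metric of uniform convergence on compacts,
  \<open>\<Sum>k\<ge>1. 2^(-k) * (sup over 0 \<le> t \<le> k of min (norm (f t - g t)) 1)\<close>, summed over \<open>j = k - 1\<close>.\<close>

instantiation path :: (real_normed_vector) metric_space
begin

definition dist_path :: "'a path \<Rightarrow> 'a path \<Rightarrow> real" where
  "dist_path f g = (\<Sum>j. (1/2) ^ Suc j * path_gap f g (real (Suc j)))"

definition uniformity_path :: "('a path \<times> 'a path) filter" where
  "uniformity_path = (INF e\<in>{0 <..}. principal {(x, y). dist x y < e})"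

definition open_path :: "'a path set \<Rightarrow> bool" where
  "open_path S = (\<forall>x\<in>S. \<forall>\<^sub>F (x', y) in uniformity. x' = x \<longrightarrow> y \<in> S)"

instance
proof
  have summ: "summable (\<lambda>j. (1/2) ^ Suc j * path_gap f g (real (Suc j)))" for f g :: "'a path"
  proof (rule summable_comparison_test')
    show "summable (\<lambda>j. (1/2::real) ^ Suc j)"
      by (subst summable_Suc_iff) (simp add: summable_geometric)
    show "norm ((1/2) ^ Suc j * path_gap f g (real (Suc j))) \<le> (1/2) ^ Suc j" for j
      using path_gap_nonneg[of "real (Suc j)" f g] path_gap_le_1[of "real (Suc j)" f g]
      by (simp add: abs_mult mult_left_le)
  qed
  fix f g h :: "'a path"
  have nonneg: "0 \<le> (1/2) ^ Suc j * path_gap f g (real (Suc j))" for j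
    by (intro mult_nonneg_nonneg path_gap_nonneg) auto
  show "(dist f g = 0) = (f = g)"
  proof
    assume "dist f g = 0"
    then have "(1/2) ^ Suc j * path_gap f g (real (Suc j)) = 0" for j
      using suminf_eq_zero_iff[OF summ[of f g] nonneg] unfolding dist_path_def by blast
    then have z: "path_gap f g (real (Suc j)) = 0" for j
      by (metis mult_eq_0_iff power_not_zero zero_neq_one divide_eq_0_iff zero_neq_numeral)
    show "f = g"
    proof (rule path_eqI)
      fix t :: real assume t: "t \<ge> 0"
      have "t \<le> real (Suc (nat \<lceil>t\<rceil>))" using t by linarith
      from path_gap_upper[OF t this, of f g] z
      have "min (norm (path_at f t - path_at g t)) 1 \<le> 0" by (simp only:)
      then show "path_at f t = path_at g t" by (auto simp: min_def split: if_splits)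
    qed
  next
    assume "f = g"
    then have "path_gap f g (real (Suc j)) = 0" for j by (simp add: path_gap_def)
    then show "dist f g = 0" by (simp add: dist_path_def)
  qed
  show "dist f g \<le> dist f h + dist g h"
    unfolding dist_path_def suminf_add[OF summ summ]
  proof (rule suminf_le[OF _ summ summable_add[OF summ summ]])
    fix j
    have "path_gap f g (real (Suc j)) \<le> path_gap f h (real (Suc j)) + path_gap g h (real (Suc j))"
      by (rule path_gap_triangle) simp
    then show "(1/2) ^ Suc j * path_gap f g (real (Suc j)) \<le>
        (1/2) ^ Suc j * path_gap f h (real (Suc j)) + (1/2) ^ Suc j * path_gap g h (real (Suc j))"
      unfolding distrib_left[symmetric] by (rule mult_left_mono) simp
  qed
qed (simp_all add: uniformity_path_def open_path_def)

end

lemma continuous_on_polygonal: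
  fixes x :: "nat \<Rightarrow> 'b::real_normed_vector"
  shows "continuous_on {0..} (\<lambda>s::real. x (nat \<lfloor>s\<rfloor>) + (s - \<lfloor>s\<rfloor>) *\<^sub>R (x (nat \<lfloor>s\<rfloor> + 1) - x (nat \<lfloor>s\<rfloor>)))"
    (is "continuous_on _ ?L")
proof -
  define G where "G N s = x 0 + (\<Sum>i<N. max 0 (min 1 (s - real i)) *\<^sub>R (x (Suc i) - x i))"
    for N and s :: real
  have GL: "G N s = ?L s" if s: "0 \<le> s" "s < real N" for N s
  proof -
    define k where "k = nat \<lfloor>s\<rfloor>"
    have k: "real k \<le> s" "s < real k + 1" "real_of_int \<lfloor>s\<rfloor> = real k"
      unfolding k_def using s by (auto simp: le_floor_iff)
    have kN: "k < N" using k s by linarith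
    have "(\<Sum>i<N. max 0 (min 1 (s - real i)) *\<^sub>R (x (Suc i) - x i)) =
        (\<Sum>i<Suc k. max 0 (min 1 (s - real i)) *\<^sub>R (x (Suc i) - x i))"
    proof (rule sum.mono_neutral_right)
      show "\<forall>i\<in>{..<N} - {..<Suc k}. max 0 (min 1 (s - real i)) *\<^sub>R (x (Suc i) - x i) = 0"
      proof
        fix i assume "i \<in> {..<N} - {..<Suc k}"
        then have "real k + 1 \<le> real i" by auto
        with k show "max 0 (min 1 (s - real i)) *\<^sub>R (x (Suc i) - x i) = 0" by (auto simp: max_def)
      qed
    qed (use kN in auto)
    also have "\<dots> = (\<Sum>i<k. x (Suc i) - x i) + (s - real k) *\<^sub>R (x (Suc k) - x k)"
    proof -
      have "(\<Sum>i<k. max 0 (min 1 (s - real i)) *\<^sub>R (x (Suc i) - x i)) = (\<Sum>i<k. x (Suc i) - x i)"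
      proof (rule sum.cong)
        fix i assume "i \<in> {..<k}"
        then have "real i + 1 \<le> real k" by auto
        with k have "max 0 (min 1 (s - real i)) = 1" by auto
        then show "max 0 (min 1 (s - real i)) *\<^sub>R (x (Suc i) - x i) = x (Suc i) - x i" by simp
      qed simp
      moreover have "max 0 (min 1 (s - real k)) = s - real k" using k by auto
      ultimately show ?thesis by simp
    qed
    finally show ?thesis
      unfolding G_def k(3) by (simp add: sum_lessThan_telescope k_def)
  qed
  have cont: "continuous_on {0..} (G N)" for N
    unfolding G_def by (intro continuous_intros)
  show ?thesis
    unfolding continuous_on_eq_continuous_within
  proof
    fix s :: real assume s: "s \<in> {0..}"
    define N where "N = Suc (nat \<lceil>s\<rceil>)"
    have sN: "s < real N" unfolding N_def using s by (simp, linarith)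
    have "continuous (at s within {0..}) (G N)"
      using cont s by (auto simp: continuous_on_eq_continuous_within)
    then show "continuous (at s within {0..}) ?L"
    proof (rule continuous_transform_within)
      show "0 < real N - s" using sN by simp
      fix s' assume "s' \<in> {0..}" "dist s' s < real N - s"
      then show "G N s' = ?L s'" by (intro GL) (auto simp: dist_real_def)
    qed (use s in auto)
  qed
qed

text \<open>The linear interpolation of a deterministic sequence \<open>x\<close> under diffusive scaling; it is
  applied to a random walk realization by realization.\<close>

lift_definition diffusive_path :: "(nat \<Rightarrow> 'b::real_normed_vector) \<Rightarrow> nat \<Rightarrow> 'b path" is
  "\<lambda>x n. \<lambda>t\<in>{0..}. x (nat \<lfloor>real n * t\<rfloor>) /\<^sub>R sqrt (real n)
     + (real n * t - \<lfloor>real n * t\<rfloor>) *\<^sub>R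
       ((x (nat \<lfloor>real n * t\<rfloor> + 1) - x (nat \<lfloor>real n * t\<rfloor>)) /\<^sub>R sqrt (real n))"
proof (intro conjI restrict_extensional)
  fix x :: "nat \<Rightarrow> 'b" and n :: nat
  let ?L = "\<lambda>s::real. x (nat \<lfloor>s\<rfloor>) + (s - \<lfloor>s\<rfloor>) *\<^sub>R (x (nat \<lfloor>s\<rfloor> + 1) - x (nat \<lfloor>s\<rfloor>))"
  have "continuous_on {0..} (\<lambda>t. ?L (real n * t))"
    by (rule continuous_on_compose2[OF continuous_on_polygonal]) (auto intro!: continuous_intros)
  then have "continuous_on {0..} (\<lambda>t. ?L (real n * t) /\<^sub>R sqrt (real n))"
    by (rule continuous_on_scaleR[OF continuous_on_const])
  then show "continuous_on {0..} (\<lambda>t\<in>{0..}. x (nat \<lfloor>real n * t\<rfloor>) /\<^sub>R sqrt (real n)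
     + (real n * t - \<lfloor>real n * t\<rfloor>) *\<^sub>R
       ((x (nat \<lfloor>real n * t\<rfloor> + 1) - x (nat \<lfloor>real n * t\<rfloor>)) /\<^sub>R sqrt (real n)))"
    by (rule continuous_on_eq) (simp add: scaleR_add_right mult.commute)
qed

section \<open>Convergence in distribution and Brownian motion\<close>

text \<open>Convergence in distribution of random elements of an arbitrary topological space; the
  limit may live on another probability space.  (The library's \<^const>\<open>weak_conv_m\<close> is restricted
  to laws on the real line.)\<close>

definition converges_in_distribution ::
    "'w measure \<Rightarrow> (nat \<Rightarrow> 'w \<Rightarrow> 's::topological_space) \<Rightarrow> 'v measure \<Rightarrow> ('v \<Rightarrow> 's) \<Rightarrow> bool" where
  "converges_in_distribution M Y P Z \<longleftrightarrow>
     (\<forall>n. Y n \<in> borel_measurable M) \<and> Z \<in> borel_measurable P \<and>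
     (\<forall>f :: 's \<Rightarrow> real. continuous_on UNIV f \<and> bounded (range f) \<longrightarrow>
        (\<lambda>n. \<integral>\<omega>. f (Y n \<omega>) \<partial>M) \<longlonglongrightarrow> (\<integral>\<omega>. f (Z \<omega>) \<partial>P))"

text \<open>Centered Brownian motion started at \<open>0\<close> with covariance matrix \<open>S\<close> per unit of time.  The
  matrix is required to be positive definite, so that the motion is genuinely of the dimension of
  the ambient space.  Joint normality of an increment is expressed through its one-dimensional
  projections.\<close>

definition brownian_motion ::
    "'w measure \<Rightarrow> real^'d^'d \<Rightarrow> ('w \<Rightarrow> (real^'d) path) \<Rightarrow> bool" where
  "brownian_motion P S B \<longleftrightarrow>
     prob_space P \<and> B \<in> borel_measurable P \<and>
     transpose S = S \<and> (\<forall>v. v \<noteq> 0 \<longrightarrow> 0 < v \<bullet> (S *v v)) \<and>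
     (AE \<omega> in P. path_at (B \<omega>) 0 = 0) \<and>
     (\<forall>(t :: nat \<Rightarrow> real) k. 0 \<le> t 0 \<and> mono_on {..k} t \<longrightarrow>
        prob_space.indep_vars P (\<lambda>_. borel)
          (\<lambda>i \<omega>. path_at (B \<omega>) (t (Suc i)) - path_at (B \<omega>) (t i)) {..<k}) \<and>
     (\<forall>s t v. 0 \<le> s \<and> s < t \<and> v \<noteq> 0 \<longrightarrow>
        distributed P lborel (\<lambda>\<omega>. v \<bullet> (path_at (B \<omega>) t - path_at (B \<omega>) s))
          (normal_density 0 (sqrt ((t - s) * (v \<bullet> (S *v v))))))"

section \<open>The excited random walk\<close>

definition (in prob_space) iid_from_1 :: "(nat \<Rightarrow> 'a \<Rightarrow> 'b::topological_space) \<Rightarrow> bool" where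
  "iid_from_1 Y \<longleftrightarrow> indep_vars (\<lambda>_. borel) Y {1..} \<and>
     (\<forall>i\<ge>1. distr M borel (Y i) = distr M borel (Y 1))"

text \<open>The library's \<^const>\<open>prob_space.indep_var\<close> without its restriction that both random variables take
  values in the same type.\<close>

definition (in prob_space) indep_rvs ::
    "'b measure \<Rightarrow> ('a \<Rightarrow> 'b) \<Rightarrow> 'c measure \<Rightarrow> ('a \<Rightarrow> 'c) \<Rightarrow> bool" where
  "indep_rvs N Y N' Y' \<longleftrightarrow> random_variable N Y \<and> random_variable N' Y' \<and>
     indep_set {Y -` A \<inter> space M | A. A \<in> sets N} {Y' -` A \<inter> space M | A. A \<in> sets N'}"

definition revisit :: "'a measure \<Rightarrow> (nat \<Rightarrow> 'a \<Rightarrow> 'b) \<Rightarrow> nat \<Rightarrow> 'a set" where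
  "revisit M X n = {\<omega> \<in> space M. \<exists>k<n. X k \<omega> = X n \<omega>}"

text \<open>The random variables \<open>\<xi> i\<close>, \<open>\<gamma> i\<close>, \<open>U i\<close> and the numbers \<open>p i\<close> only matter for \<open>i \<ge> 1\<close>.
  Lattice points are vectors in \<open>real^'d\<close> with integer coordinates.\<close>

locale excited_random_walk =
  prob_space M + filtration "space M" F
  for M :: "'a measure" and F :: "nat \<Rightarrow> 'a measure" +
  fixes \<xi> \<gamma> :: "nat \<Rightarrow> 'a \<Rightarrow> real^'d" and U :: "nat \<Rightarrow> 'a \<Rightarrow> real"
    and p :: "nat \<Rightarrow> real" and l :: "real^'d" and X :: "nat \<Rightarrow> 'a \<Rightarrow> real^'d"
  assumes dim_ge_2: "CARD('d) \<ge> 2"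
    and norm_l: "norm l = 1"
    and p_range: "\<And>n. n \<ge> 1 \<Longrightarrow> 0 < p n \<and> p n \<le> 1"
    and F_subalgebra: "\<And>n. subalgebra M (F n)"
    and F_null_sets: "null_sets M \<subseteq> sets (F 0)"
    and adapted: "\<And>n. n \<ge> 1 \<Longrightarrow> \<xi> n \<in> borel_measurable (F n) \<and> \<gamma> n \<in> borel_measurable (F n)"
    and lattice: "\<And>n \<omega> j. n \<ge> 1 \<Longrightarrow> \<omega> \<in> space M \<Longrightarrow> \<xi> n \<omega> $ j \<in> \<int> \<and> \<gamma> n \<omega> $ j \<in> \<int>"
    and bounded_steps: "\<exists>K>0. \<forall>n\<ge>1. \<forall>\<omega>\<in>space M. norm (\<xi> n \<omega>) \<le> K \<and> norm (\<gamma> n \<omega>) \<le> K"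
    and \<xi>_cond_exp:
      "\<And>n j. n \<ge> 1 \<Longrightarrow> AE \<omega> in M. real_cond_exp M (F (n - 1)) (\<lambda>\<omega>. \<xi> n \<omega> $ j) \<omega> = 0"
    and \<gamma>_drift:
      "\<exists>c>0. \<forall>n\<ge>1. AE \<omega> in M. real_cond_exp M (F (n - 1)) (\<lambda>\<omega>. \<gamma> n \<omega> \<bullet> l) \<omega> \<ge> c"
    and \<xi>_iid: "iid_from_1 \<xi>"
    and \<xi>_mean: "\<And>i. i \<ge> 1 \<Longrightarrow> integrable M (\<xi> i) \<and> expectation (\<xi> i) = 0"
    and \<xi>_covariance: "\<And>i j k. i \<ge> 1 \<Longrightarrow> integrable M (\<lambda>\<omega>. \<xi> i \<omega> $ j * \<xi> i \<omega> $ k)"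
    and \<xi>_nondegenerate:
      "\<And>i v. i \<ge> 1 \<Longrightarrow> norm v = 1 \<Longrightarrow> prob {\<omega> \<in> space M. \<xi> i \<omega> \<bullet> v = 0} < 1"
    and \<gamma>_iid: "iid_from_1 \<gamma>"
    and \<xi>_\<gamma>_indep:
      "indep_var (Pi\<^sub>M {1..} (\<lambda>_. borel)) (\<lambda>\<omega>. \<lambda>i\<in>{1..}. \<xi> i \<omega>)
                 (Pi\<^sub>M {1..} (\<lambda>_. borel)) (\<lambda>\<omega>. \<lambda>i\<in>{1..}. \<gamma> i \<omega>)"
    and U_iid: "iid_from_1 U"
    and U_uniform: "\<And>i. i \<ge> 1 \<Longrightarrow> distr M lborel (U i) = uniform_measure lborel {0..1}"
    and U_indep:
      "indep_rvs (Pi\<^sub>M {1..} (\<lambda>_. borel)) (\<lambda>\<omega>. \<lambda>i\<in>{1..}. U i \<omega>)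
         (Pi\<^sub>M {1..} (\<lambda>_. borel) \<Otimes>\<^sub>M Pi\<^sub>M {1..} (\<lambda>_. borel))
         (\<lambda>\<omega>. (\<lambda>i\<in>{1..}. \<xi> i \<omega>, \<lambda>i\<in>{1..}. \<gamma> i \<omega>))"
    and X_eq: "\<And>n \<omega>. \<omega> \<in> space M \<Longrightarrow>
      X n \<omega> = (\<Sum>i=1..n.
          indicator (revisit M X (i - 1)) \<omega> *\<^sub>R \<xi> i \<omega>
        + indicator ((space M - revisit M X (i - 1)) \<inter> {\<omega> \<in> space M. U i \<omega> > p i}) \<omega> *\<^sub>R \<xi> i \<omega>
        + indicator ((space M - revisit M X (i - 1)) \<inter> {\<omega> \<in> space M. U i \<omega> \<le> p i}) \<omega> *\<^sub>R \<gamma> i \<omega>)"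

end

theory Submission
  imports Defs
begin

text \<open>The excited walk \<open>X\<close> differs from the random walk \<open>S\<close> with steps \<open>\<xi>\<close> only at excited steps, by a
  bounded amount each time. A step \<open>i\<close> is excited if the current site is new and \<open>U i \<le> p i\<close>, and these
  two conditions are independent. If the probability \<open>fresh_prob i\<close> of being at a new site tends
  to \<open>0\<close>, the expected number of excited steps up to time \<open>n\<close> is at most the sum of
  \<open>fresh_prob (i - 1) * C / sqrt i\<close> over \<open>i \<le> n\<close>, which is of smaller order than \<open>sqrt n\<close>. So the
  rescaled paths of \<open>X\<close> and \<open>S\<close> have the same limit, which for \<open>S\<close> is Brownian motion by Donsker's
  theorem (\<open>donsker\<close>).

  That sites are rarely new comes from recurrence in the plane. During any fixed number \<open>L\<close> of steps
  excitations become unlikely, as \<open>p i\<close> tends to \<open>0\<close>. Without them the last \<open>L\<close> steps are steps of the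
  random walk, and the current site is new only if the reversed walk avoids its starting point for \<open>L\<close>
  steps (\<open>fresh_prob_le\<close>). The probability of this is small for large \<open>L\<close>
  (\<open>no_return_prob_tendsto\<close>): each of the order of \<open>R\<^sup>2\<close> lattice points in a ball of radius \<open>R\<close>
  is visited for the last time at most once, whereas by the central limit theorem the expected number
  of visits to the ball up to time \<open>J R\<^sup>2\<close> is at least of order \<open>R\<^sup>2 log J\<close>, so that only a small
  proportion of the visits can be last ones.

  Three tools lead to Donsker's theorem. The first is chaining: if increments over dyadic intervals of
  length \<open>2^(-m)\<close> have fourth moments of order \<open>4^(-m)\<close>, then the dyadic interpolations of a path are
  uniformly close to the path in mean (\<open>expectation_dist_dyadic_interp_Suc_le\<close>). This gives both the
  existence of Brownian motion, by Levy's midpoint construction (\<open>brownian_motion_exists\<close>), and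
  tightness of the rescaled walks. The second is that characteristic functions determine and control
  joint laws of finitely many random vectors, which follows from Gaussian smoothing
  (\<open>char_tendsto_imp_integral_tendsto\<close>). The third is that convergence in distribution may be tested
  on Lipschitz functions (\<open>converges_in_distribution_if_lipschitz\<close>).\<close>

section \<open>Linear interpolation\<close>

definition lerp :: "(nat \<Rightarrow> 'b::real_normed_vector) \<Rightarrow> real \<Rightarrow> 'b" where
  "lerp x s = x (nat \<lfloor>s\<rfloor>) + (s - \<lfloor>s\<rfloor>) *\<^sub>R (x (nat \<lfloor>s\<rfloor> + 1) - x (nat \<lfloor>s\<rfloor>))"

lemma path_at_diffusive_path:
  "0 \<le> t \<Longrightarrow> path_at (diffusive_path x n) t = lerp x (real n * t) /\<^sub>R sqrt (real n)"
  by (simp add: diffusive_path.rep_eq lerp_def scaleR_add_right mult.commute)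

lemma lerp_of_nat [simp]: "lerp x (real k) = x k"
  by (simp add: lerp_def)

lemma lerp_diff: "lerp (\<lambda>k. x k - y k) s = lerp x s - lerp y s"
  by (simp add: lerp_def algebra_simps)

lemma lerp_scaleR: "lerp (\<lambda>k. c *\<^sub>R x k) s = c *\<^sub>R lerp x s"
  by (simp add: lerp_def algebra_simps)

lemma lerp_cong: "x (nat \<lfloor>s\<rfloor>) = y (nat \<lfloor>s\<rfloor>) \<Longrightarrow> x (nat \<lfloor>s\<rfloor> + 1) = y (nat \<lfloor>s\<rfloor> + 1) \<Longrightarrow> lerp x s = lerp y s"
  by (simp add: lerp_def)

lemma lerp_in_convex:
  assumes "convex C" "0 \<le> s" "x (nat \<lfloor>s\<rfloor>) \<in> C" "x (nat \<lfloor>s\<rfloor> + 1) \<in> C"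
  shows "lerp x s \<in> C"
proof -
  have "lerp x s = (1 - (s - \<lfloor>s\<rfloor>)) *\<^sub>R x (nat \<lfloor>s\<rfloor>) + (s - \<lfloor>s\<rfloor>) *\<^sub>R x (nat \<lfloor>s\<rfloor> + 1)"
    by (simp add: lerp_def algebra_simps)
  moreover have "0 \<le> s - \<lfloor>s\<rfloor>" "s - \<lfloor>s\<rfloor> \<le> 1" by linarith+
  ultimately show ?thesis using assms by (auto intro!: convexD_alt[of C] simp: convexD_alt)
qed

lemma norm_lerp_le:
  assumes "0 \<le> s" "s \<le> real N" "\<And>k. k \<le> Suc N \<Longrightarrow> norm (x k) \<le> B"
  shows "norm (lerp x s) \<le> B"
proof -
  have "nat \<lfloor>s\<rfloor> \<le> N" using assms(1,2) by linarith
  then have "lerp x s \<in> cball 0 B"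
    using assms by (intro lerp_in_convex) auto
  then show ?thesis by simp
qed

text \<open>The weight \<open>max 0 (min 1 (s - i))\<close> is the fraction of the step from \<open>i\<close> to \<open>i + 1\<close> that
  has been made at time \<open>s\<close>; linear interpolation is thus a weighted sum of the steps.\<close>

lemma lerp_eq_weighted_steps:
  fixes x :: "nat \<Rightarrow> 'b::real_normed_vector"
  assumes s: "0 \<le> s" "s \<le> real N"
  shows "lerp x s = x 0 + (\<Sum>i<N. max 0 (min 1 (s - real i)) *\<^sub>R (x (Suc i) - x i))"
proof -
  define k where "k = nat \<lfloor>s\<rfloor>"
  have k: "real k \<le> s" "s < real k + 1" "real_of_int \<lfloor>s\<rfloor> = real k"
    unfolding k_def using s by (auto simp: le_floor_iff)
  have kN: "k \<le> N" using k s by linarith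
  have "(\<Sum>i<N. max 0 (min 1 (s - real i)) *\<^sub>R (x (Suc i) - x i)) =
      (\<Sum>i<Suc N. max 0 (min 1 (s - real i)) *\<^sub>R (x (Suc i) - x i))"
    using s by simp
  also have "\<dots> = (\<Sum>i<Suc k. max 0 (min 1 (s - real i)) *\<^sub>R (x (Suc i) - x i))"
  proof (rule sum.mono_neutral_right)
    show "\<forall>i\<in>{..<Suc N} - {..<Suc k}. max 0 (min 1 (s - real i)) *\<^sub>R (x (Suc i) - x i) = 0"
    proof
      fix i assume "i \<in> {..<Suc N} - {..<Suc k}"
      then have "real k + 1 \<le> real i" by auto
      with k show "max 0 (min 1 (s - real i)) *\<^sub>R (x (Suc i) - x i) = 0" by (auto simp: max_def)
    qed
  qed (use kN in auto)
  also have "\<dots> = (\<Sum>i<k. x (Suc i) - x i) + (s - real k) *\<^sub>R (x (Suc k) - x k)"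
  proof -
    have "(\<Sum>i<k. max 0 (min 1 (s - real i)) *\<^sub>R (x (Suc i) - x i)) = (\<Sum>i<k. x (Suc i) - x i)"
    proof (rule sum.cong)
      fix i assume "i \<in> {..<k}"
      then have "real i + 1 \<le> real k" by auto
      with k have "max 0 (min 1 (s - real i)) = 1" by auto
      then show "max 0 (min 1 (s - real i)) *\<^sub>R (x (Suc i) - x i) = x (Suc i) - x i" by simp
    qed simp
    moreover have "max 0 (min 1 (s - real k)) = s - real k" using k by auto
    ultimately show ?thesis by simp
  qed
  finally show ?thesis
    unfolding lerp_def k(3) by (simp add: sum_lessThan_telescope k_def)
qed

section \<open>The metric on path space\<close>

lemma summable_dist_path: "summable (\<lambda>j. (1/2) ^ Suc j * path_gap f g (real (Suc j)))"
proof (rule summable_comparison_test')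
  show "summable (\<lambda>j. (1/2::real) ^ Suc j)"
    by (subst summable_Suc_iff) (simp add: summable_geometric)
  show "norm ((1/2) ^ Suc j * path_gap f g (real (Suc j))) \<le> (1/2) ^ Suc j" for j
    using path_gap_nonneg[of "real (Suc j)" f g] path_gap_le_1[of "real (Suc j)" f g]
    by (simp add: abs_mult mult_left_le)
qed

lemma path_gap_least:
  "0 \<le> T \<Longrightarrow> (\<And>t. 0 \<le> t \<Longrightarrow> t \<le> T \<Longrightarrow> norm (path_at f t - path_at g t) \<le> e) \<Longrightarrow> path_gap f g T \<le> e"
  unfolding path_gap_def by (rule cSUP_least) (auto simp: min.coboundedI1)

lemma sums_half_power_Suc: "(\<lambda>j. (1/2::real) ^ Suc j) sums 1"
  using power_half_series by (simp add: power_Suc)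

text \<open>Uniform closeness on \<open>[0, T]\<close> controls the metric up to the weight \<open>2^(-T)\<close> of later times.\<close>

lemma dist_path_le:
  fixes f g :: "'b::real_normed_vector path"
  assumes "\<And>t. 0 \<le> t \<Longrightarrow> t \<le> real T \<Longrightarrow> norm (path_at f t - path_at g t) \<le> e"
  shows "dist f g \<le> e + (1/2) ^ T"
proof -
  have e: "0 \<le> e" using assms[of 0] by (smt (verit) norm_ge_zero of_nat_0_le_iff)
  have s1: "(\<lambda>j. (1/2::real) ^ Suc j) sums 1" by (rule sums_half_power_Suc)
  have *: "(\<lambda>j. if j < T then 0 else (1/2::real) ^ Suc j) sums (1/2) ^ T"
  proof -
    have "(\<lambda>j. (1/2::real) ^ T * (1/2) ^ Suc j) sums ((1/2) ^ T * 1)"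
      by (rule sums_mult[OF s1])
    then have "(\<lambda>j. if j + T < T then 0 else (1/2::real) ^ Suc (j + T)) sums (1/2) ^ T"
      by (simp add: power_add mult_ac)
    then show ?thesis
      by (subst (asm) sums_iff_shift) simp
  qed
  have "dist f g \<le> (\<Sum>j. (1/2) ^ Suc j * e + (if j < T then 0 else (1/2::real) ^ Suc j))"
    unfolding dist_path_def
  proof (rule suminf_le[OF _ summable_dist_path])
    show "summable (\<lambda>j. (1/2) ^ Suc j * e + (if j < T then 0 else (1/2::real) ^ Suc j))"
      by (intro summable_add summable_mult2 sums_summable[OF s1] sums_summable[OF *])
    show "(1/2) ^ Suc j * path_gap f g (real (Suc j)) \<le> (1/2) ^ Suc j * e + (if j < T then 0 else (1/2::real) ^ Suc j)"
      for j
    proof (cases "j < T")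
      case True
      then have "path_gap f g (real (Suc j)) \<le> e"
        by (intro path_gap_least assms) auto
      then show ?thesis using True by (simp add: mult_left_mono)
    next
      case False
      have "(1/2) ^ Suc j * path_gap f g (real (Suc j)) \<le> (1/2::real) ^ Suc j * 1"
        by (intro mult_left_mono path_gap_le_1) auto
      moreover have "0 \<le> (1/2) ^ Suc j * e" using e by simp
      ultimately show ?thesis using False by (simp only: if_False mult_1_right)
    qed
  qed
  also have "\<dots> = e + (1/2) ^ T"
    using sums_unique[OF sums_add[OF sums_mult2[OF s1, of e] *]] by simp
  finally show ?thesis .
qed

lemma path_at_close_if_dist:
  fixes f g :: "'b::real_normed_vector path"
  assumes "0 \<le> t" "t \<le> real (Suc j)"
  shows "min (norm (path_at f t - path_at g t)) 1 \<le> 2 ^ Suc j * dist f g"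
proof -
  have "sum (\<lambda>j. (1/2) ^ Suc j * path_gap f g (real (Suc j))) {j} \<le> dist f g"
    unfolding dist_path_def
    by (rule sum_le_suminf[OF summable_dist_path])
      (auto intro!: mult_nonneg_nonneg path_gap_nonneg simp del: power_Suc of_nat_Suc)
  then have "(1/2) ^ Suc j * path_gap f g (real (Suc j)) \<le> dist f g" by (simp only: sum.insert sum.empty finite.emptyI empty_iff add_0_right simp_thms)
  then have "path_gap f g (real (Suc j)) \<le> 2 ^ Suc j * dist f g"
    by (simp add: power_one_over field_simps del: power_Suc of_nat_Suc)
  then show ?thesis using path_gap_upper[OF assms, of f g] by linarith
qed

lemma tendsto_path_at:
  fixes F :: "'c \<Rightarrow> 'b::real_normed_vector path"
  assumes "(F \<longlongrightarrow> f) net" "0 \<le> t"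
  shows "((\<lambda>x. path_at (F x) t) \<longlongrightarrow> path_at f t) net"
proof (rule tendstoI)
  fix e :: real assume e: "0 < e"
  define j where "j = nat \<lceil>t\<rceil>"
  have t: "t \<le> real (Suc j)" using assms(2) unfolding j_def by linarith
  have "((\<lambda>x. 2 ^ Suc j * dist (F x) f) \<longlongrightarrow> 2 ^ Suc j * 0) net"
    by (intro tendsto_intros assms(1)[THEN tendsto_dist_iff[THEN iffD1]])
  then have "\<forall>\<^sub>F x in net. 2 ^ Suc j * dist (F x) f < min e 1"
    using e by (intro order_tendstoD) auto
  then show "\<forall>\<^sub>F x in net. dist (path_at (F x) t) (path_at f t) < e"
  proof eventually_elim
    case (elim x)
    then show ?case using path_at_close_if_dist[OF assms(2) t, of "F x" f] by (auto simp: dist_norm)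
  qed
qed

lemma continuous_on_path_at_eval: "0 \<le> t \<Longrightarrow> continuous_on UNIV (\<lambda>f :: 'b::real_normed_vector path. path_at f t)"
  unfolding continuous_on_def by (auto intro!: tendsto_path_at)

lemma measurable_path_at [measurable]:
  "0 \<le> t \<Longrightarrow> (\<lambda>f :: 'b::real_normed_vector path. path_at f t) \<in> borel_measurable borel"
  by (intro borel_measurable_continuous_onI continuous_on_path_at_eval)

text \<open>The countable supremum makes the distance of two random paths measurable.\<close>

lemma path_gap_eq_SUP_Rats:
  fixes f g :: "'b::real_normed_vector path"
  shows "path_gap f g (real T) = (SUP t\<in>{0..real T} \<inter> \<rat>. min (norm (path_at f t - path_at g t)) 1)"
    (is "_ = ?S")
proof (rule antisym)
  let ?h = "\<lambda>t. min (norm (path_at f t - path_at g t)) 1"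
  have bdd: "bdd_above (?h ` ({0..real T} \<inter> \<rat>))" by (rule bdd_aboveI2[where M = 1]) auto
  have ne: "{0..real T} \<inter> \<rat> \<noteq> {}" 
  proof -
    have "0 \<in> {0..real T} \<inter> \<rat>" by simp
    then show ?thesis by blast
  qed
  show "?S \<le> path_gap f g (real T)"
    using ne by (intro cSUP_least) (auto intro: path_gap_upper)
  show "path_gap f g (real T) \<le> ?S"
    unfolding path_gap_def
  proof (rule cSUP_least)
    fix t assume t: "t \<in> {0..real T}"
    show "?h t \<le> ?S"
    proof (rule ccontr)
      assume "\<not> ?thesis"
      then have less: "?S < ?h t" by (simp only: not_le)
      have "continuous_on {0..real T} ?h"
        by (intro continuous_intros continuous_on_subset[OF continuous_on_path_at]) auto
      then have "(?h \<longlongrightarrow> ?h t) (at t within {0..real T})"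
        using t by (auto simp: continuous_on_def)
      then have "\<forall>\<^sub>F s in at t within {0..real T}. ?S < ?h s"
        using less by (rule order_tendstoD)
      then obtain d where d: "d > 0" "\<And>s. s \<in> {0..real T} \<Longrightarrow> s \<noteq> t \<Longrightarrow> dist s t < d \<Longrightarrow> ?S < ?h s"
        unfolding eventually_at by auto
      have "\<exists>s\<in>{0..real T} \<inter> \<rat>. ?S < ?h s"
      proof (cases "t = real T")
        case True
        then show ?thesis using less by (intro bexI[of _ t]) auto
      next
        case False
        then obtain q where "q \<in> \<rat>" "t < q" "q < min (real T) (t + d)"
          using Rats_dense_in_real[of t "min (real T) (t + d)"] t d(1) by auto
        then show ?thesis using d(2)[of q] t by (intro bexI[of _ q]) (auto simp: dist_real_def)
      qed
      then show False using cSUP_upper[OF _ bdd] by fastforce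
    qed
  qed auto
qed

lemma borel_measurable_dist_path [measurable]:
  fixes F G :: "'a \<Rightarrow> 'b::{real_normed_vector, second_countable_topology} path"
  assumes [measurable]: "F \<in> borel_measurable M" "G \<in> borel_measurable M"
  shows "(\<lambda>\<omega>. dist (F \<omega>) (G \<omega>)) \<in> borel_measurable M"
proof -
  have at: "(\<lambda>\<omega>. path_at (F \<omega>) t) \<in> borel_measurable M" "(\<lambda>\<omega>. path_at (G \<omega>) t) \<in> borel_measurable M"
    if "0 \<le> t" for t
    using that by (auto intro: measurable_compose[OF _ measurable_path_at])
  have "(\<lambda>\<omega>. path_gap (F \<omega>) (G \<omega>) (real T)) \<in> borel_measurable M" for T
    unfolding path_gap_eq_SUP_Rats
  proof (rule borel_measurable_cSUP)
    show "countable ({0..real T} \<inter> \<rat>)" by (intro countable_Int2 countable_rat)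
    show "(\<lambda>\<omega>. min (norm (path_at (F \<omega>) t - path_at (G \<omega>) t)) 1) \<in> borel_measurable M"
      if "t \<in> {0..real T} \<inter> \<rat>" for t
      using at[of t] that by auto
  qed (auto intro!: bdd_aboveI2[where M = 1])
  then show ?thesis unfolding dist_path_def by (intro borel_measurable_suminf borel_measurable_times) (auto simp del: of_nat_Suc)
qed

text \<open>A Cauchy sequence converges uniformly on every bounded interval, so its pointwise limit is
  continuous.\<close>

lemma path_Cauchy_convergent:
  fixes F :: "nat \<Rightarrow> 'b::banach path"
  assumes "Cauchy F"
  shows "\<exists>f. F \<longlonglongrightarrow> f"
proof -
  have unif: "uniformly_convergent_on {0..real T} (\<lambda>n. path_at (F n))" for T
  proof (rule Cauchy_uniformly_convergent, unfold uniformly_Cauchy_on_def, intro allI impI)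
    fix e :: real assume e: "0 < e"
    then have "0 < min e 1 / 2 ^ Suc T" by simp
    then obtain N where N: "\<And>m n. m \<ge> N \<Longrightarrow> n \<ge> N \<Longrightarrow> dist (F m) (F n) < min e 1 / 2 ^ Suc T"
      using assms unfolding Cauchy_def by metis
    show "\<exists>M. \<forall>x\<in>{0..real T}. \<forall>m\<ge>M. \<forall>n\<ge>M. dist (path_at (F m) x) (path_at (F n) x) < e"
    proof (intro exI ballI allI impI)
      fix x m n assume *: "x \<in> {0..real T}" "m \<ge> N" "n \<ge> N"
      have "2 ^ Suc T * dist (F m) (F n) < min e 1"
        using N[OF *(2,3)] by (simp add: field_simps)
      then show "dist (path_at (F m) x) (path_at (F n) x) < e"
        using path_at_close_if_dist[of x T "F m" "F n"] * by (auto simp: dist_norm)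
    qed
  qed
  define g where "g t = lim (\<lambda>n. path_at (F n) t)" for t
  have ul: "uniform_limit {0..real T} (\<lambda>n. path_at (F n)) g sequentially" for T
    using unif[of T] unfolding uniformly_convergent_uniform_limit_iff g_def .
  have "continuous_on {0..} g"
    unfolding continuous_on_eq_continuous_within
  proof
    fix s :: real assume s: "s \<in> {0..}"
    define T where "T = Suc (nat \<lceil>s\<rceil>)"
    have sT: "s < real T" unfolding T_def using s by (simp, linarith)
    have "continuous_on {0..real T} g"
      by (rule uniform_limit_theorem[OF _ ul])
        (auto intro!: always_eventually continuous_on_subset[OF continuous_on_path_at])
    then have "continuous (at s within {0..real T}) g"
      using s sT by (auto simp: continuous_on_eq_continuous_within)
    moreover have "at s within {0..real T} = at s within {0..}"
      using sT by (intro at_within_nhd[of s "{..<real T}"]) auto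
    ultimately show "continuous (at s within {0..}) g" by simp
  qed
  then have "restrict g {0..} \<in> {f. f \<in> extensional {0..} \<and> continuous_on {0..} f}"
    by (auto intro: continuous_on_eq)
  then have f: "path_at (Abs_path (restrict g {0..})) = restrict g {0..}"
    by (rule Abs_path_inverse)
  have "F \<longlonglongrightarrow> Abs_path (restrict g {0..})"
  proof (rule metric_LIMSEQ_I)
    fix e :: real assume e: "0 < e"
    obtain T where T: "(1/2::real) ^ T < e / 2"
      using real_arch_pow_inv[of "e/2" "1/2"] e by auto
    have "\<forall>\<^sub>F n in sequentially. \<forall>x\<in>{0..real T}. dist (path_at (F n) x) (g x) < e / 2"
      using ul[of T] half_gt_zero[OF e] unfolding uniform_limit_iff by blast
    then obtain N where N: "\<And>n x. n \<ge> N \<Longrightarrow> x \<in> {0..real T} \<Longrightarrow> dist (path_at (F n) x) (g x) < e / 2"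
      unfolding eventually_sequentially by blast
    have "dist (F n) (Abs_path (restrict g {0..})) < e" if "n \<ge> N" for n
    proof -
      have "dist (F n) (Abs_path (restrict g {0..})) \<le> e / 2 + (1/2) ^ T"
        by (rule dist_path_le) (use N[OF that] in \<open>auto simp: f dist_norm intro!: less_imp_le\<close>)
      then show ?thesis using T by simp
    qed
    then show "\<exists>no. \<forall>n\<ge>no. dist (F n) (Abs_path (restrict g {0..})) < e" by blast
  qed
  then show ?thesis by blast
qed

lemma dist_diffusive_path_le:
  fixes x y :: "nat \<Rightarrow> 'b::real_normed_vector"
  assumes "\<And>k. k \<le> Suc (n * T) \<Longrightarrow> norm (x k - y k) \<le> B"
  shows "dist (diffusive_path x n) (diffusive_path y n) \<le> B / sqrt (real n) + (1/2) ^ T"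
proof (rule dist_path_le)
  fix t :: real assume t: "0 \<le> t" "t \<le> real T"
  have "real n * t \<le> real (n * T)" using t by (simp add: mult_left_mono)
  then have "norm (lerp (\<lambda>k. x k - y k) (real n * t)) \<le> B"
    using t by (intro norm_lerp_le[where N = "n * T"] assms) auto
  then have "norm (lerp (\<lambda>k. x k - y k) (real n * t)) / sqrt (real n) \<le> B / sqrt (real n)"
    by (intro divide_right_mono) auto
  moreover have "path_at (diffusive_path x n) t - path_at (diffusive_path y n) t
      = lerp (\<lambda>k. x k - y k) (real n * t) /\<^sub>R sqrt (real n)"
    using t by (simp add: path_at_diffusive_path lerp_diff scaleR_diff_right)
  ultimately show "norm (path_at (diffusive_path x n) t - path_at (diffusive_path y n) t) \<le> B / sqrt (real n)"
    by (simp add: divide_inverse mult.commute)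
qed

lemma continuous_on_diffusive_path:
  "continuous_on UNIV (\<lambda>x :: nat \<Rightarrow> 'b::real_normed_vector. diffusive_path x n)"
  unfolding continuous_on_def
proof
  fix x :: "nat \<Rightarrow> 'b"
  show "((\<lambda>x. diffusive_path x n) \<longlongrightarrow> diffusive_path x n) (at x within UNIV)"
  proof (rule tendstoI)
    fix e :: real assume e: "0 < e"
    obtain T where T: "(1/2::real) ^ T < e / 2"
      using real_arch_pow_inv[of "e/2" "1/2"] e by auto
    define d where "d = e / 2 * (if n = 0 then 1 else sqrt (real n))"
    have d: "0 < d" "d / sqrt (real n) \<le> e / 2" using e by (auto simp: d_def)
    have "\<forall>\<^sub>F y in at x. dist (y k) (x k) < d" for k
    proof -
      have "continuous_on UNIV (\<lambda>x::nat \<Rightarrow> 'b. x k)" by (rule continuous_on_product_coordinates)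
      then have "((\<lambda>y. y k) \<longlongrightarrow> x k) (at x)" by (simp add: continuous_on_def)
      then show ?thesis using d(1) by (rule tendstoD)
    qed
    then have "\<forall>\<^sub>F y in at x. \<forall>k\<in>{..Suc (n * T)}. dist (y k) (x k) < d"
      by (intro eventually_ball_finite) auto
    then show "\<forall>\<^sub>F y in at x. dist (diffusive_path y n) (diffusive_path x n) < e"
    proof eventually_elim
      case (elim y)
      have "dist (diffusive_path y n) (diffusive_path x n) \<le> d / sqrt (real n) + (1/2) ^ T"
        by (rule dist_diffusive_path_le) (use elim in \<open>auto simp: dist_norm intro!: less_imp_le\<close>)
      then show ?case using d T by linarith
    qed
  qed
qed

text \<open>The interpolation is continuous in the sequence for the product topology, whose Borel sets are
  generated by the coordinates.\<close>

lemma measurable_diffusive_path: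
  fixes x :: "'a \<Rightarrow> nat \<Rightarrow> 'b::{real_normed_vector, second_countable_topology}"
  assumes "\<And>k. (\<lambda>\<omega>. x \<omega> k) \<in> borel_measurable M"
  shows "(\<lambda>\<omega>. diffusive_path (x \<omega>) n) \<in> borel_measurable M"
proof -
  have "x \<in> borel_measurable M"
    using assms by (rule measurable_coordinatewise_then_product)
  then show ?thesis
    by (rule measurable_compose)
      (intro borel_measurable_continuous_onI continuous_on_diffusive_path)
qed

section \<open>Dyadic interpolation and chaining\<close>

text \<open>The polygonal path with value \<open>v k\<close> at time \<open>k / 2^m\<close>, stopped at time \<open>m + 1\<close> so that it
  depends on finitely many values only; the factor \<open>sqrt (2^m)\<close> undoes the diffusive scaling.\<close>

definition dyadic_interp :: "nat \<Rightarrow> (nat \<Rightarrow> 'b::real_normed_vector) \<Rightarrow> 'b path" where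
  "dyadic_interp m v = diffusive_path (\<lambda>k. sqrt (2 ^ m) *\<^sub>R v (min k (Suc m * 2 ^ m))) (2 ^ m)"

lemma path_at_dyadic_interp:
  "0 \<le> t \<Longrightarrow> path_at (dyadic_interp m v) t = lerp (\<lambda>k. v (min k (Suc m * 2 ^ m))) (2 ^ m * t)"
  by (simp add: dyadic_interp_def path_at_diffusive_path lerp_scaleR)

lemma floor_dyadic_bound:
  assumes "0 \<le> t" "t \<le> real m"
  shows "nat \<lfloor>2 ^ m * t\<rfloor> + 1 \<le> Suc m * 2 ^ m"
proof -
  have "2 ^ m * t \<le> 2 ^ m * real m" using assms by (intro mult_left_mono) auto
  then have "\<lfloor>2 ^ m * t\<rfloor> \<le> \<lfloor>real (m * 2 ^ m)\<rfloor>" by (intro floor_mono) (simp add: mult.commute)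
  then have "nat \<lfloor>2 ^ m * t\<rfloor> \<le> m * 2 ^ m" by linarith
  moreover have "(1::nat) \<le> 2 ^ m" by simp
  ultimately show ?thesis unfolding mult_Suc by linarith
qed

lemma path_at_dyadic_interp_uncapped:
  assumes "0 \<le> t" "t \<le> real m"
  shows "path_at (dyadic_interp m v) t = lerp v (2 ^ m * t)"
  unfolding path_at_dyadic_interp[OF assms(1)]
  by (rule lerp_cong) (use floor_dyadic_bound[OF assms] in auto)

lemma measurable_dyadic_interp:
  fixes v :: "'a \<Rightarrow> nat \<Rightarrow> 'b::{real_normed_vector, second_countable_topology}"
  assumes [measurable]: "\<And>k. (\<lambda>\<omega>. v \<omega> k) \<in> borel_measurable M"
  shows "(\<lambda>\<omega>. dyadic_interp m (v \<omega>)) \<in> borel_measurable M"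
  unfolding dyadic_interp_def by (rule measurable_diffusive_path) measurable

lemma dyadic_interp_tendsto:
  fixes w :: "'b::real_normed_vector path"
  shows "(\<lambda>m. dyadic_interp m (\<lambda>k. path_at w (real k / 2 ^ m))) \<longlonglongrightarrow> w"
proof (rule metric_LIMSEQ_I)
  fix e :: real assume e: "0 < e"
  obtain T where T: "(1/2::real) ^ T < e / 2"
    using real_arch_pow_inv[of "e/2" "1/2"] e by auto
  have "uniformly_continuous_on {0..real T + 1} (path_at w)"
    by (intro compact_uniformly_continuous continuous_on_subset[OF continuous_on_path_at]) auto
  then obtain d where d: "d > 0"
    "\<And>x x'. x \<in> {0..real T + 1} \<Longrightarrow> x' \<in> {0..real T + 1} \<Longrightarrow> dist x' x < d \<Longrightarrow> dist (path_at w x') (path_at w x) < e / 2"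
    using e unfolding uniformly_continuous_on_def by (metis half_gt_zero)
  obtain m0 where m0: "(1/2::real) ^ m0 < d"
    using real_arch_pow_inv[of d "1/2"] d by auto
  show "\<exists>no. \<forall>m\<ge>no. dist (dyadic_interp m (\<lambda>k. path_at w (real k / 2 ^ m))) w < e"
  proof (intro exI allI impI)
    fix m assume m: "m \<ge> max m0 T"
    have "(1/2::real) ^ m \<le> (1/2) ^ m0" using m by (intro power_decreasing) auto
    then have md: "1 / 2 ^ m < d" using m0 by (simp add: power_one_over)
    have "dist (dyadic_interp m (\<lambda>k. path_at w (real k / 2 ^ m))) w \<le> e / 2 + (1/2) ^ T"
    proof (rule dist_path_le)
      fix t :: real assume t: "0 \<le> t" "t \<le> real T"
      define k where "k = nat \<lfloor>2 ^ m * t\<rfloor>"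
      have k: "real k \<le> 2 ^ m * t" "2 ^ m * t < real k + 1"
        unfolding k_def using t by (auto simp: le_floor_iff)
      have near: "dist (path_at w (real j / 2 ^ m)) (path_at w t) < e / 2" if j: "j = k \<or> j = k + 1" for j
      proof (rule d(2))
        have a: "\<bar>real j - 2 ^ m * t\<bar> \<le> 1" using j k by auto
        have "real j / 2 ^ m - t = (real j - 2 ^ m * t) / 2 ^ m" by (simp add: field_simps)
        then have "\<bar>real j / 2 ^ m - t\<bar> = \<bar>real j - 2 ^ m * t\<bar> / 2 ^ m" by simp
        also have "\<dots> \<le> 1 / 2 ^ m" using a by (intro divide_right_mono) auto
        finally have b: "\<bar>real j / 2 ^ m - t\<bar> \<le> 1 / 2 ^ m" .
        then show "dist (real j / 2 ^ m) t < d" using md by (simp add: dist_real_def)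
        have "1 / 2 ^ m \<le> (1::real)" by (simp add: field_simps)
        then have "real j / 2 ^ m \<le> real T + 1" using b t by linarith
        then show "real j / 2 ^ m \<in> {0..real T + 1}" by simp
        show "t \<in> {0..real T + 1}" using t by auto
      qed
      have "lerp (\<lambda>k. path_at w (real k / 2 ^ m)) (2 ^ m * t) \<in> cball (path_at w t) (e / 2)"
        using near[of k] near[of "k + 1"] t
        by (intro lerp_in_convex) (auto simp: k_def[symmetric] dist_commute less_imp_le)
      then show "norm (path_at (dyadic_interp m (\<lambda>k. path_at w (real k / 2 ^ m))) t - path_at w t) \<le> e / 2"
        using t m by (simp add: path_at_dyadic_interp_uncapped dist_norm norm_minus_commute)
    qed
    then show "dist (dyadic_interp m (\<lambda>k. path_at w (real k / 2 ^ m))) w < e" using T by simp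
  qed
qed

text \<open>Passing to the next dyadic level moves only the midpoints, each by at most one increment of
  the finer level.\<close>

lemma dist_dyadic_interp_Suc_le:
  fixes v v' :: "nat \<Rightarrow> 'b::real_normed_vector"
  assumes refine: "\<And>k. v k = v' (2 * k)"
    and B: "\<And>k. k < Suc m * 2 ^ Suc m \<Longrightarrow> norm (v' (Suc k) - v' k) \<le> B"
  shows "dist (dyadic_interp (Suc m) v') (dyadic_interp m v) \<le> B + (1/2) ^ m"
proof (rule dist_path_le)
  fix t :: real assume t: "0 \<le> t" "t \<le> real m"
  define s where "s = 2 ^ m * t"
  define k where "k = nat \<lfloor>s\<rfloor>"
  define f where "f = s - real k"
  have s: "0 \<le> s" using t by (simp add: s_def)
  have k: "real k \<le> s" "s < real k + 1" "\<lfloor>s\<rfloor> = int k"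
    unfolding k_def using s by (auto simp: le_floor_iff)
  have kb: "k + 1 \<le> Suc m * 2 ^ m" using floor_dyadic_bound[OF t] by (simp add: k_def s_def)
  define a where "a = v' (Suc (2 * k)) - v' (2 * k)"
  define b where "b = v' (Suc (Suc (2 * k))) - v' (Suc (2 * k))"
  have ab: "norm a \<le> B" "norm b \<le> B" unfolding a_def b_def using kb by (intro B; simp)+
  have nab: "norm (a - b) \<le> 2 * B" using norm_triangle_ineq4[of a b] ab by simp
  have f: "0 \<le> f" "f < 1" using k by (auto simp: f_def)
  have c: "lerp v s = v' (2 * k) + f *\<^sub>R (a + b)"
    by (simp add: lerp_def k k_def[symmetric] f_def refine a_def b_def)
  have "norm (lerp v' (2 * s) - lerp v s) \<le> B"
  proof (cases "f < 1/2")
    case True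
    then have fl: "\<lfloor>2 * s\<rfloor> = int (2 * k)" using f by (intro floor_unique) (auto simp: f_def)
    have "nat \<lfloor>2 * s\<rfloor> = 2 * k" using fl by simp
    then have "lerp v' (2 * s) = v' (2 * k) + (2 * f) *\<^sub>R a"
      using fl by (simp add: lerp_def a_def f_def)
    then have "lerp v' (2 * s) - lerp v s = f *\<^sub>R (a - b)"
      unfolding c by (simp add: algebra_simps flip: scaleR_2)
    then have "norm (lerp v' (2 * s) - lerp v s) = f * norm (a - b)" using f by simp
    also have "\<dots> \<le> 1/2 * (2 * B)" using True f nab by (intro mult_mono) auto
    finally show ?thesis by simp
  next
    case False
    then have fl: "\<lfloor>2 * s\<rfloor> = int (Suc (2 * k))" using f by (intro floor_unique) (auto simp: f_def)
    have "nat \<lfloor>2 * s\<rfloor> = Suc (2 * k)" using fl by simp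
    then have "lerp v' (2 * s) = v' (Suc (2 * k)) + (2 * f - 1) *\<^sub>R b"
      using fl by (simp add: lerp_def b_def f_def algebra_simps)
    then have "lerp v' (2 * s) - lerp v s = (1 - f) *\<^sub>R (a - b)"
      unfolding c a_def by (simp add: algebra_simps flip: scaleR_2)
    then have "norm (lerp v' (2 * s) - lerp v s) = (1 - f) * norm (a - b)" using f by simp
    also have "\<dots> \<le> 1/2 * (2 * B)" using False f nab by (intro mult_mono) auto
    finally show ?thesis by simp
  qed
  then show "norm (path_at (dyadic_interp (Suc m) v') t - path_at (dyadic_interp m v) t) \<le> B"
    using t by (simp add: path_at_dyadic_interp_uncapped s_def mult.assoc)
qed

lemma le_add_fourth_power_div:
  fixes a r :: real
  assumes "0 \<le> a" "0 < r"
  shows "a \<le> r + a ^ 4 / r ^ 3"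
proof (cases "a \<le> r")
  case True then show ?thesis using assms by (simp add: add_increasing2)
next
  case False
  then have "r ^ 3 \<le> a ^ 3" using assms by (intro power_mono) auto
  then have "a * r ^ 3 \<le> a * a ^ 3" using assms by (intro mult_left_mono) auto
  then have "a \<le> a ^ 4 / r ^ 3" using assms by (simp add: field_simps eval_nat_numeral)
  then show ?thesis using assms by simp
qed

text \<open>Fourth moments bound the maximal increment of a level: a maximum exceeds \<open>r\<close> by at most
  the sum of all \<open>a ^ 4 / r ^ 3\<close>. With \<open>r = (9/10)^m\<close> the sum over the \<open>(m + 1) 2^(m+1)\<close>
  increments of level \<open>m + 1\<close>, each with fourth moment \<open>c / 4^(m+1)\<close>, is of smaller order.\<close>

lemma (in prob_space) expectation_dist_dyadic_interp_Suc_le: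
  fixes v v' :: "nat \<Rightarrow> 'a \<Rightarrow> 'b::{real_normed_vector, second_countable_topology}"
  assumes [measurable]: "\<And>k. v k \<in> borel_measurable M" "\<And>k. v' k \<in> borel_measurable M"
    and refine: "\<And>k \<omega>. v k \<omega> = v' (2 * k) \<omega>"
    and int: "\<And>k. integrable M (\<lambda>\<omega>. norm (v' (Suc k) \<omega> - v' k \<omega>) ^ 4)"
    and mom: "\<And>k. expectation (\<lambda>\<omega>. norm (v' (Suc k) \<omega> - v' k \<omega>) ^ 4) \<le> c / 4 ^ Suc m"
  shows "integrable M (\<lambda>\<omega>. dist (dyadic_interp (Suc m) (\<lambda>k. v' k \<omega>)) (dyadic_interp m (\<lambda>k. v k \<omega>)))"
    and "expectation (\<lambda>\<omega>. dist (dyadic_interp (Suc m) (\<lambda>k. v' k \<omega>)) (dyadic_interp m (\<lambda>k. v k \<omega>)))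
          \<le> (2 + 3 * c) * (9/10) ^ m"
proof -
  define r :: real where "r = (9/10) ^ m"
  define N where "N = Suc m * 2 ^ Suc m"
  define A where "A k \<omega> = norm (v' (Suc k) \<omega> - v' k \<omega>) ^ 4" for k \<omega>
  define D where "D \<omega> = dist (dyadic_interp (Suc m) (\<lambda>k. v' k \<omega>)) (dyadic_interp m (\<lambda>k. v k \<omega>))" for \<omega>
  have r: "0 < r" by (simp add: r_def)
  have intA: "integrable M (A k)" for k unfolding A_def by (rule int)
  have c: "0 \<le> c"
  proof -
    have "0 \<le> expectation (A 0)" by (rule integral_nonneg_AE) (simp add: A_def)
    also have "\<dots> \<le> c / 4 ^ Suc m" unfolding A_def by (rule mom)
    finally have "0 \<le> c / 4 ^ Suc m" .
    moreover have "(0::real) < 4 ^ Suc m" by simp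
    ultimately show ?thesis by (meson divide_neg_pos not_le)
  qed
  have momA: "expectation (A k) \<le> c / 4 ^ Suc m" for k unfolding A_def by (rule mom)
  have D_le: "D \<omega> \<le> r + (\<Sum>k<N. A k \<omega> / r ^ 3) + (1/2) ^ m" for \<omega>
    unfolding D_def
  proof (rule dist_dyadic_interp_Suc_le)
    fix k assume "k < Suc m * 2 ^ Suc m"
    then have k: "k < N" by (simp add: N_def)
    have "norm (v' (Suc k) \<omega> - v' k \<omega>) \<le> r + A k \<omega> / r ^ 3"
      unfolding A_def by (rule le_add_fourth_power_div) (use r in auto)
    also have "A k \<omega> / r ^ 3 \<le> (\<Sum>k<N. A k \<omega> / r ^ 3)"
      by (rule member_le_sum) (use k r in \<open>auto simp: A_def\<close>)
    finally show "norm (v' (Suc k) \<omega> - v' k \<omega>) \<le> r + (\<Sum>k<N. A k \<omega> / r ^ 3)" by simp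
  qed (simp add: refine)
  have intB: "integrable M (\<lambda>\<omega>. r + (\<Sum>k<N. A k \<omega> / r ^ 3) + (1/2) ^ m)"
    by (intro Bochner_Integration.integrable_add Bochner_Integration.integrable_sum
        integrable_const integrable_divide_zero intA)
  have meas: "D \<in> borel_measurable M"
    unfolding D_def by (intro borel_measurable_dist_path measurable_dyadic_interp) measurable
  show intD: "integrable M D"
    by (rule Bochner_Integration.integrable_bound[OF intB meas])
      (use D_le in \<open>auto simp: D_def intro: order_trans[OF _ abs_ge_self]\<close>)
  have "expectation D \<le> expectation (\<lambda>\<omega>. r + (\<Sum>k<N. A k \<omega> / r ^ 3) + (1/2) ^ m)"
    by (rule integral_mono[OF intD intB D_le])
  also have "\<dots> = r + (\<Sum>k<N. expectation (A k) / r ^ 3) + (1/2) ^ m"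
    using intA by (simp add: prob_space)
  also have "(\<Sum>k<N. expectation (A k) / r ^ 3) \<le> (\<Sum>k<N. c / 4 ^ Suc m / r ^ 3)"
    using r by (intro sum_mono divide_right_mono momA) auto
  also have "\<dots> = c / 2 * (real (Suc m) * ((1/2) ^ m / r ^ 3))"
    using r power_mult_distrib[of "2::real" 2 m] by (simp add: N_def field_simps)
  also have "\<dots> \<le> c / 2 * (5 * (9/10) ^ m)"
  proof (rule mult_left_mono)
    have "1 + real m * (1/5) \<le> (1 + 1/5) ^ m" by (rule Bernoulli_inequality) simp
    then have "real (Suc m) \<le> 5 * (6/5) ^ m" by simp
    moreover have "(1/2) ^ m / r ^ 3 = (500/729) ^ m"
    proof -
      have "r ^ 3 = ((9/10) ^ 3) ^ m" unfolding r_def by (simp only: power_mult[symmetric] mult.commute)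
      then have "(1/2) ^ m / r ^ 3 = ((1/2) / (9/10) ^ 3) ^ m" by (simp only: power_divide)
      then show ?thesis by (simp add: power_divide)
    qed
    ultimately have "real (Suc m) * ((1/2) ^ m / r ^ 3) \<le> 5 * (6/5) ^ m * (500/729) ^ m"
      by (simp add: mult_right_mono)
    also have "\<dots> = 5 * (600/729) ^ m" by (simp add: mult.assoc flip: power_mult_distrib)
    also have "\<dots> \<le> 5 * (9/10) ^ m" by (intro mult_left_mono power_mono) auto
    finally show "real (Suc m) * ((1/2) ^ m / r ^ 3) \<le> 5 * (9/10) ^ m" .
  qed (use c in simp)
  also have "(1/2) ^ m \<le> (9/10::real) ^ m" by (intro power_mono) auto
  also have "r + c / 2 * (5 * (9/10) ^ m) + (9/10) ^ m \<le> (2 + 3 * c) * (9/10) ^ m"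
    using c by (simp add: r_def algebra_simps)
  finally show "expectation D \<le> (2 + 3 * c) * (9/10) ^ m" by simp
qed

section \<open>Characteristic functions of finitely many random variables\<close>

text \<open>The density at \<open>y\<close> of a Gaussian vector with mean \<open>u\<close> and independent components of standard
  deviation \<open>d\<close>.\<close>

definition gauss_kernel :: "'i set \<Rightarrow> real \<Rightarrow> ('i \<Rightarrow> real) \<Rightarrow> ('i \<Rightarrow> real) \<Rightarrow> real" where
  "gauss_kernel I d u y = (\<Prod>j\<in>I. normal_density (u j) d (y j))"

lemma measurable_gauss_kernel:
  fixes I :: "'i set"
  assumes "sets M = sets (PiM I (\<lambda>_. borel))" "sets N = sets (PiM I (\<lambda>_. borel))"
  shows "(\<lambda>(u, y). gauss_kernel I d u y) \<in> borel_measurable (M \<Otimes>\<^sub>M N)"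
proof -
  note assms[measurable_cong]
  have 1: "(\<lambda>p. fst p j) \<in> borel_measurable (M \<Otimes>\<^sub>M N)" "(\<lambda>p. snd p j) \<in> borel_measurable (M \<Otimes>\<^sub>M N)"
    if "j \<in> I" for j
    using that by measurable
  show ?thesis
    unfolding gauss_kernel_def normal_density_def case_prod_unfold
    using 1 by (intro borel_measurable_prod) auto
qed

lemma gauss_kernel_nonneg: "0 \<le> gauss_kernel I d u y"
  by (simp add: gauss_kernel_def prod_nonneg)

context
  fixes I :: "'i set" and d :: real
  assumes fin: "finite I" and d: "0 < d"
begin

interpretation L: product_sigma_finite "\<lambda>_::'i. lborel :: real measure" by standard

interpretation G: product_prob_space "\<lambda>_::'i. std_normal_distribution" I
proof -
  interpret std: prob_space std_normal_distribution by (rule prob_space_normal_density) simp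
  show "product_prob_space (\<lambda>_::'i. std_normal_distribution)" by standard
qed

lemma sets_Gauss [measurable_cong]:
  "sets (PiM I (\<lambda>_. std_normal_distribution)) = sets (PiM I (\<lambda>_. borel))"
  "sets (PiM I (\<lambda>_. lborel :: real measure)) = sets (PiM I (\<lambda>_. borel))"
  by (auto intro!: sets_PiM_cong)

lemma gauss_kernel_integral:
  "integrable (PiM I (\<lambda>_. lborel)) (gauss_kernel I d u)"
  "(\<integral>y. gauss_kernel I d u y \<partial>PiM I (\<lambda>_. lborel)) = 1"
proof -
  have int: "integrable lborel (normal_density (u j) d)" for j using d by simp
  show "integrable (PiM I (\<lambda>_. lborel)) (gauss_kernel I d u)"
    unfolding gauss_kernel_def by (rule L.product_integrable_prod[OF fin int])
  show "(\<integral>y. gauss_kernel I d u y \<partial>PiM I (\<lambda>_. lborel)) = 1"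
    unfolding gauss_kernel_def by (subst L.product_integral_prod[OF fin int]) (use d in auto)
qed

lemma gauss_kernel_abs_moment:
  assumes k: "k \<in> I"
  shows "integrable (PiM I (\<lambda>_. lborel)) (\<lambda>y. \<bar>y k - u k\<bar> * gauss_kernel I d u y)"
    and "(\<integral>y. \<bar>y k - u k\<bar> * gauss_kernel I d u y \<partial>PiM I (\<lambda>_. lborel)) \<le> d"
proof -
  define f where "f j y = (if j = k then \<bar>y - u k\<bar> else 1) * normal_density (u j) d y" for j and y :: real
  have eq: "\<bar>y k - u k\<bar> * gauss_kernel I d u y = (\<Prod>j\<in>I. f j (y j))" for y
    unfolding gauss_kernel_def f_def prod.distrib using k fin by (simp add: prod.delta cong: if_cong)
  have int: "integrable lborel (f j)" for j
    using integrable_normal_moment_abs[of d "u k" 1] d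
    by (cases "j = k") (auto simp: f_def[abs_def] mult.commute)
  have "integral\<^sup>L lborel (f k) = (\<integral>x. normal_density (u k) d x * \<bar>x - u k\<bar> ^ (2 * 0 + 1) \<partial>lborel)"
    by (simp add: f_def[abs_def] mult.commute)
  also have "\<dots> = d * sqrt (2 / pi)"
    unfolding integral_normal_moment_abs_odd[OF d] by simp
  also have "\<dots> \<le> d * 1" using d pi_gt3 by (intro mult_left_mono) auto
  finally have k_le: "integral\<^sup>L lborel (f k) \<le> d" by simp
  have other: "integral\<^sup>L lborel (f j) = 1" if "j \<noteq> k" for j
    using that d by (simp add: f_def[abs_def])
  show "integrable (PiM I (\<lambda>_. lborel)) (\<lambda>y. \<bar>y k - u k\<bar> * gauss_kernel I d u y)"
    unfolding eq by (intro L.product_integrable_prod fin int)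
  have "(\<integral>y. \<bar>y k - u k\<bar> * gauss_kernel I d u y \<partial>PiM I (\<lambda>_. lborel)) = (\<Prod>j\<in>I. integral\<^sup>L lborel (f j))"
    unfolding eq by (intro L.product_integral_prod fin int)
  also have "\<dots> = (\<Prod>j\<in>I. if j = k then integral\<^sup>L lborel (f k) else 1)"
    using other by (intro prod.cong) auto
  also have "\<dots> \<le> d" using k fin k_le by (simp add: prod.delta)
  finally show "(\<integral>y. \<bar>y k - u k\<bar> * gauss_kernel I d u y \<partial>PiM I (\<lambda>_. lborel)) \<le> d" .
qed

text \<open>The Gaussian is its own Fourier transform, so the smoothing kernel is a mixture of
  characters.\<close>

lemma normal_density_eq_char:
  "complex_of_real (normal_density u d y) =
    complex_of_real (1 / (sqrt (2 * pi) * d)) * (CLINT s|std_normal_distribution. iexp (s * ((u - y) / d)))"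
proof -
  have "(CLINT s|std_normal_distribution. iexp (s * ((u - y) / d))) = char std_normal_distribution ((u - y) / d)"
    unfolding char_def by (simp add: mult.commute)
  also have "\<dots> = complex_of_real (exp (- ((u - y) / d)\<^sup>2 / 2))"
    by (simp only: char_std_normal_distribution)
  finally show ?thesis
    unfolding normal_density_def of_real_mult[symmetric]
    using d by (simp add: real_sqrt_mult power2_commute[of u y] power_divide)
qed

lemma gauss_kernel_eq_char:
  "complex_of_real (gauss_kernel I d u y) = complex_of_real ((1 / (sqrt (2 * pi) * d)) ^ card I) *
    (CLINT s|PiM I (\<lambda>_. std_normal_distribution). iexp (\<Sum>j\<in>I. s j * ((u j - y j) / d)))"
proof -
  have std: "prob_space std_normal_distribution" by (rule prob_space_normal_density) simp
  have "(CLINT s|PiM I (\<lambda>_. std_normal_distribution). iexp (\<Sum>j\<in>I. s j * ((u j - y j) / d)))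
    = (CLINT s|PiM I (\<lambda>_. std_normal_distribution). (\<Prod>j\<in>I. iexp (s j * ((u j - y j) / d))))"
    by (simp add: exp_sum[OF fin, symmetric] sum_distrib_left)
  also have "\<dots> = (\<Prod>j\<in>I. CLINT s|std_normal_distribution. iexp (s * ((u j - y j) / d)))"
    by (rule G.product_integral_prod[OF fin]) (rule prob_space.integrable_iexp[OF std]; simp)
  finally show ?thesis
    by (simp only: gauss_kernel_def of_real_prod normal_density_eq_char prod.distrib prod_constant of_real_power)
qed

text \<open>The density of a law smoothed by a Gaussian is an integral of its characteristic function
  against a Gaussian weight, by Fubini.\<close>

lemma smoothed_density_eq:
  assumes "prob_space Q" and sQ: "sets Q = sets (PiM I (\<lambda>_. borel))"
  shows "complex_of_real (\<integral>u. gauss_kernel I d u y \<partial>Q) =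
    complex_of_real ((1 / (sqrt (2 * pi) * d)) ^ card I) *
    (CLINT s|PiM I (\<lambda>_. std_normal_distribution).
       iexp (- (\<Sum>j\<in>I. s j * y j / d)) * (CLINT u|Q. iexp (\<Sum>j\<in>I. (s j / d) * u j)))"
proof -
  interpret Q: prob_space Q by fact
  interpret PP: pair_prob_space Q "PiM I (\<lambda>_. std_normal_distribution)" ..
  note sQ[measurable_cong]
  let ?c = "complex_of_real ((1 / (sqrt (2 * pi) * d)) ^ card I)"
  have m: "(\<lambda>p. fst p j) \<in> borel_measurable (Q \<Otimes>\<^sub>M PiM I (\<lambda>_. std_normal_distribution))"
    "(\<lambda>p. snd p j) \<in> borel_measurable (Q \<Otimes>\<^sub>M PiM I (\<lambda>_. std_normal_distribution))"
    if "j \<in> I" for j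
    using that by measurable
  have m': "(\<lambda>p. \<Sum>j\<in>I. snd p j * ((fst p j - y j) / d)) \<in> borel_measurable (Q \<Otimes>\<^sub>M PiM I (\<lambda>_. std_normal_distribution))"
    using m by (intro borel_measurable_sum) auto
  have int: "integrable (Q \<Otimes>\<^sub>M PiM I (\<lambda>_. std_normal_distribution))
      (\<lambda>(u, s). iexp (\<Sum>j\<in>I. s j * ((u j - y j) / d)))"
    unfolding case_prod_unfold using m' by (intro PP.integrable_iexp) auto
  have "complex_of_real (\<integral>u. gauss_kernel I d u y \<partial>Q) = (CLINT u|Q. complex_of_real (gauss_kernel I d u y))"
    by (rule integral_complex_of_real[symmetric])
  also have "\<dots> = ?c * (CLINT u|Q. CLINT s|PiM I (\<lambda>_. std_normal_distribution). iexp (\<Sum>j\<in>I. s j * ((u j - y j) / d)))"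
    unfolding gauss_kernel_eq_char by (rule integral_mult_right_zero)
  also have "(CLINT u|Q. CLINT s|PiM I (\<lambda>_. std_normal_distribution). iexp (\<Sum>j\<in>I. s j * ((u j - y j) / d)))
      = (CLINT s|PiM I (\<lambda>_. std_normal_distribution). CLINT u|Q. iexp (\<Sum>j\<in>I. s j * ((u j - y j) / d)))"
    by (rule PP.Fubini_integral[OF int, symmetric])
  also have "(\<lambda>s. CLINT u|Q. iexp (\<Sum>j\<in>I. s j * ((u j - y j) / d)))
      = (\<lambda>s. iexp (- (\<Sum>j\<in>I. s j * y j / d)) * (CLINT u|Q. iexp (\<Sum>j\<in>I. (s j / d) * u j)))"
  proof
    fix s
    have "(\<Sum>j\<in>I. s j * ((u j - y j) / d)) = - (\<Sum>j\<in>I. s j * y j / d) + (\<Sum>j\<in>I. (s j / d) * u j)" for u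
      by (simp add: sum_negf[symmetric] sum.distrib[symmetric] diff_divide_distrib algebra_simps)
    then have "iexp (\<Sum>j\<in>I. s j * ((u j - y j) / d)) =
        iexp (- (\<Sum>j\<in>I. s j * y j / d)) * iexp (\<Sum>j\<in>I. (s j / d) * u j)" for u
      by (simp only: of_real_add distrib_left exp_add)
    then show "(CLINT u|Q. iexp (\<Sum>j\<in>I. s j * ((u j - y j) / d))) =
        iexp (- (\<Sum>j\<in>I. s j * y j / d)) * (CLINT u|Q. iexp (\<Sum>j\<in>I. (s j / d) * u j))"
      by (simp only: integral_mult_right_zero)
  qed
  finally show ?thesis .
qed

lemma smoothed_density_tendsto:
  assumes Q: "\<And>n. prob_space (Q n)" "\<And>n. sets (Q n) = sets (PiM I (\<lambda>_. borel))"
    and R: "prob_space R" "sets R = sets (PiM I (\<lambda>_. borel))"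
    and char: "\<And>\<theta>. (\<lambda>n. CLINT u|Q n. iexp (\<Sum>j\<in>I. \<theta> j * u j)) \<longlonglongrightarrow> (CLINT u|R. iexp (\<Sum>j\<in>I. \<theta> j * u j))"
  shows "(\<lambda>n. \<integral>u. gauss_kernel I d u y \<partial>Q n) \<longlonglongrightarrow> (\<integral>u. gauss_kernel I d u y \<partial>R)"
proof -
  let ?N = "PiM I (\<lambda>_. std_normal_distribution)"
  have m1: "(\<lambda>s. iexp (- (\<Sum>j\<in>I. s j * y j / d))) \<in> borel_measurable ?N" by measurable
  have m2: "(\<lambda>s. CLINT u|Q'. iexp (\<Sum>j\<in>I. (s j / d) * u j)) \<in> borel_measurable ?N"
    if "prob_space Q'" and s: "sets Q' = sets (PiM I (\<lambda>_. borel))" for Q'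
  proof -
    interpret Q': prob_space Q' by fact
    note s[measurable_cong]
    have m: "(\<lambda>p. fst p j) \<in> borel_measurable (?N \<Otimes>\<^sub>M Q')" "(\<lambda>p. snd p j) \<in> borel_measurable (?N \<Otimes>\<^sub>M Q')"
      if "j \<in> I" for j
      using that by measurable
    have "(\<lambda>p. \<Sum>j\<in>I. (fst p j / d) * snd p j) \<in> borel_measurable (?N \<Otimes>\<^sub>M Q')"
      using m by (intro borel_measurable_sum) auto
    then have "(\<lambda>(s, u). iexp (\<Sum>j\<in>I. (s j / d) * u j)) \<in> borel_measurable (?N \<Otimes>\<^sub>M Q')"
      unfolding case_prod_unfold by measurable
    then show ?thesis by (rule Q'.borel_measurable_lebesgue_integral)
  qed
  have nrm: "norm (CLINT u|Q'. iexp (\<Sum>j\<in>I. (s j / d) * u j)) \<le> 1" if "prob_space Q'" for Q' and s :: "'i \<Rightarrow> real"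
  proof -
    interpret Q': prob_space Q' by fact
    have "norm (CLINT u|Q'. iexp (\<Sum>j\<in>I. (s j / d) * u j)) \<le> (\<integral>u. norm (iexp (\<Sum>j\<in>I. (s j / d) * u j)) \<partial>Q')"
      by (rule integral_norm_bound)
    then show ?thesis by (simp only: norm_exp_i_times) (simp add: Q'.prob_space)
  qed
  have "(\<lambda>n. complex_of_real (\<integral>u. gauss_kernel I d u y \<partial>Q n)) \<longlonglongrightarrow> complex_of_real (\<integral>u. gauss_kernel I d u y \<partial>R)"
    unfolding smoothed_density_eq[OF Q] smoothed_density_eq[OF R]
  proof (intro tendsto_mult_left integral_dominated_convergence[where w = "\<lambda>_. 1"])
    show "AE s in ?N. (\<lambda>n. iexp (- (\<Sum>j\<in>I. s j * y j / d)) * (CLINT u|Q n. iexp (\<Sum>j\<in>I. (s j / d) * u j)))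
        \<longlonglongrightarrow> iexp (- (\<Sum>j\<in>I. s j * y j / d)) * (CLINT u|R. iexp (\<Sum>j\<in>I. (s j / d) * u j))"
      using char by (intro always_eventually allI tendsto_mult_left)
    show "AE s in ?N. norm (iexp (- (\<Sum>j\<in>I. s j * y j / d)) * (CLINT u|Q n. iexp (\<Sum>j\<in>I. (s j / d) * u j))) \<le> 1" for n
      by (intro always_eventually allI) (simp only: norm_mult norm_exp_i_times mult_1_left nrm[OF Q(1)])
    show "(\<lambda>s. iexp (- (\<Sum>j\<in>I. s j * y j / d)) * (CLINT u|Q n. iexp (\<Sum>j\<in>I. (s j / d) * u j))) \<in> borel_measurable ?N" for n
      by (rule borel_measurable_times[OF m1 m2[OF Q]])
    show "(\<lambda>s. iexp (- (\<Sum>j\<in>I. s j * y j / d)) * (CLINT u|R. iexp (\<Sum>j\<in>I. (s j / d) * u j))) \<in> borel_measurable ?N"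
      by (rule borel_measurable_times[OF m1 m2[OF R]])
  qed simp
  then show ?thesis by (simp only: tendsto_of_real_iff)
qed

lemma smoothed_density_integral:
  assumes "prob_space Q" and sQ: "sets Q = sets (PiM I (\<lambda>_. borel))"
    and g: "g \<in> borel_measurable (PiM I (\<lambda>_. borel))" "\<And>y. \<bar>g y\<bar> \<le> B"
  shows "(\<lambda>y. \<integral>u. gauss_kernel I d u y \<partial>Q) \<in> borel_measurable (PiM I (\<lambda>_. lborel))"
    and "integrable (PiM I (\<lambda>_. lborel)) (\<lambda>y. \<integral>u. gauss_kernel I d u y \<partial>Q)"
    and "(\<integral>y. (\<integral>u. gauss_kernel I d u y \<partial>Q) \<partial>PiM I (\<lambda>_. lborel)) = 1"
    and "integrable (PiM I (\<lambda>_. lborel)) (\<lambda>y. g y * (\<integral>u. gauss_kernel I d u y \<partial>Q))"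
    and "(\<integral>y. g y * (\<integral>u. gauss_kernel I d u y \<partial>Q) \<partial>PiM I (\<lambda>_. lborel)) =
      (\<integral>u. (\<integral>y. g y * gauss_kernel I d u y \<partial>PiM I (\<lambda>_. lborel)) \<partial>Q)"
    and "integrable Q (\<lambda>u. \<integral>y. g y * gauss_kernel I d u y \<partial>PiM I (\<lambda>_. lborel))"
proof -
  let ?L = "PiM I (\<lambda>_. lborel :: real measure)"
  interpret Q: prob_space Q by fact
  interpret LI: sigma_finite_measure ?L by (rule L.sigma_finite[OF fin])
  interpret PP: pair_sigma_finite Q ?L ..
  note sQ[measurable_cong]
  have m: "(\<lambda>(u, y). gauss_kernel I d u y) \<in> borel_measurable (Q \<Otimes>\<^sub>M ?L)"
    by (rule measurable_gauss_kernel) (auto simp: sQ intro!: sets_PiM_cong)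
  have gL: "g \<in> borel_measurable ?L" using g(1) by measurable
  have int_bdd: "integrable (Q \<Otimes>\<^sub>M ?L) (\<lambda>(u, y). h y * gauss_kernel I d u y)"
    if h: "h \<in> borel_measurable ?L" "\<And>y. \<bar>h y\<bar> \<le> B'" for h :: "('i \<Rightarrow> real) \<Rightarrow> real" and B'
  proof -
    have one: "integrable (Q \<Otimes>\<^sub>M ?L) (\<lambda>(u, y). gauss_kernel I d u y)"
      using m
    proof (rule PP.Fubini_integrable)
      show "integrable Q (\<lambda>u. \<integral>y. norm (case (u, y) of (u, y) \<Rightarrow> gauss_kernel I d u y) \<partial>?L)"
        by (simp add: gauss_kernel_nonneg gauss_kernel_integral)
    qed (simp add: gauss_kernel_integral)
    have "(\<lambda>p. h (snd p)) \<in> borel_measurable (Q \<Otimes>\<^sub>M ?L)" using h(1) by measurable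
    then have "integrable (Q \<Otimes>\<^sub>M ?L) (\<lambda>p. h (snd p) * (case p of (u, y) \<Rightarrow> gauss_kernel I d u y))"
    proof (rule Bochner_Integration.integrable_bound[OF integrable_mult_right[OF one, of B'] borel_measurable_times[OF _ m], rule_format])
      show "AE p in Q \<Otimes>\<^sub>M ?L. norm (h (snd p) * (case p of (u, y) \<Rightarrow> gauss_kernel I d u y))
          \<le> norm (B' * (case p of (u, y) \<Rightarrow> gauss_kernel I d u y))"
        by (intro always_eventually allI)
          (simp add: abs_mult case_prod_unfold mult_right_mono order_trans[OF h(2) abs_ge_self])
    qed
    then show ?thesis by (simp add: case_prod_unfold)
  qed
  note i1 = int_bdd[of "\<lambda>_. 1" 1, simplified] and ig = int_bdd[OF gL g(2)]
  show "(\<lambda>y. \<integral>u. gauss_kernel I d u y \<partial>Q) \<in> borel_measurable ?L"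
    "integrable ?L (\<lambda>y. \<integral>u. gauss_kernel I d u y \<partial>Q)"
    using PP.integrable_snd[OF i1] by auto
  have "(\<integral>y. (\<integral>u. gauss_kernel I d u y \<partial>Q) \<partial>?L) = (\<integral>u. (\<integral>y. gauss_kernel I d u y \<partial>?L) \<partial>Q)"
    by (rule PP.Fubini_integral[OF i1])
  then show "(\<integral>y. (\<integral>u. gauss_kernel I d u y \<partial>Q) \<partial>?L) = 1"
    by (simp add: gauss_kernel_integral Q.prob_space)
  show "integrable ?L (\<lambda>y. g y * (\<integral>u. gauss_kernel I d u y \<partial>Q))"
    using PP.integrable_snd[OF ig] by simp
  show "integrable Q (\<lambda>u. \<integral>y. g y * gauss_kernel I d u y \<partial>?L)"
    by (rule PP.integrable_fst[OF ig])
  show "(\<integral>y. g y * (\<integral>u. gauss_kernel I d u y \<partial>Q) \<partial>?L) = (\<integral>u. (\<integral>y. g y * gauss_kernel I d u y \<partial>?L) \<partial>Q)"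
    using PP.Fubini_integral[OF ig] by simp
qed

text \<open>The Gaussian moves each coordinate by at most \<open>d\<close> on average.\<close>

lemma smoothing_close:
  assumes g: "g \<in> borel_measurable (PiM I (\<lambda>_. borel))" "\<And>y. \<bar>g y\<bar> \<le> B"
    and lip: "\<And>x y. \<bar>g x - g y\<bar> \<le> C * (\<Sum>j\<in>I. \<bar>x j - y j\<bar>)"
  shows "\<bar>(\<integral>y. g y * gauss_kernel I d u y \<partial>PiM I (\<lambda>_. lborel)) - g u\<bar> \<le> \<bar>C\<bar> * card I * d"
proof -
  let ?L = "PiM I (\<lambda>_. lborel :: real measure)"
  have gL[measurable]: "g \<in> borel_measurable ?L" using g(1) by measurable
  have int: "integrable ?L (\<lambda>y. g y * gauss_kernel I d u y)"
  proof (rule Bochner_Integration.integrable_bound)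
    show "integrable ?L (\<lambda>y. B * gauss_kernel I d u y)"
      by (intro integrable_mult_right gauss_kernel_integral)
    show "(\<lambda>y. g y * gauss_kernel I d u y) \<in> borel_measurable ?L"
      using gauss_kernel_integral(1)[of u] by measurable
    show "AE y in ?L. norm (g y * gauss_kernel I d u y) \<le> norm (B * gauss_kernel I d u y)"
      by (intro always_eventually allI) (simp add: abs_mult mult_right_mono order_trans[OF g(2) abs_ge_self])
  qed
  have "(\<integral>y. g y * gauss_kernel I d u y \<partial>?L) - g u = (\<integral>y. g y * gauss_kernel I d u y - g u * gauss_kernel I d u y \<partial>?L)"
    using int gauss_kernel_integral by (subst Bochner_Integration.integral_diff) auto
  also have "\<bar>\<dots>\<bar> \<le> (\<integral>y. \<bar>g y * gauss_kernel I d u y - g u * gauss_kernel I d u y\<bar> \<partial>?L)"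
    by (rule integral_abs_bound)
  also have "\<dots> \<le> (\<integral>y. \<bar>C\<bar> * (\<Sum>j\<in>I. \<bar>y j - u j\<bar> * gauss_kernel I d u y) \<partial>?L)"
  proof (rule integral_mono)
    show "integrable ?L (\<lambda>y. \<bar>g y * gauss_kernel I d u y - g u * gauss_kernel I d u y\<bar>)"
      using int gauss_kernel_integral(1)[of u] by auto
    show "integrable ?L (\<lambda>y. \<bar>C\<bar> * (\<Sum>j\<in>I. \<bar>y j - u j\<bar> * gauss_kernel I d u y))"
      by (intro integrable_mult_right Bochner_Integration.integrable_sum gauss_kernel_abs_moment)
    show "\<bar>g y * gauss_kernel I d u y - g u * gauss_kernel I d u y\<bar> \<le> \<bar>C\<bar> * (\<Sum>j\<in>I. \<bar>y j - u j\<bar> * gauss_kernel I d u y)" for y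
    proof -
      have "\<bar>g y * gauss_kernel I d u y - g u * gauss_kernel I d u y\<bar> = \<bar>g y - g u\<bar> * gauss_kernel I d u y"
        by (simp add: left_diff_distrib[symmetric] abs_mult gauss_kernel_nonneg)
      also have "\<dots> \<le> (\<bar>C\<bar> * (\<Sum>j\<in>I. \<bar>y j - u j\<bar>)) * gauss_kernel I d u y"
        using lip[of y u] by (intro mult_right_mono gauss_kernel_nonneg order_trans[OF lip] mult_right_mono) (auto intro: sum_nonneg)
      finally show ?thesis by (simp add: sum_distrib_right mult.assoc)
    qed
  qed
  also have "\<dots> = \<bar>C\<bar> * (\<Sum>j\<in>I. \<integral>y. \<bar>y j - u j\<bar> * gauss_kernel I d u y \<partial>?L)"
    by (simp add: gauss_kernel_abs_moment)
  also have "\<dots> \<le> \<bar>C\<bar> * (\<Sum>j\<in>I. d)"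
    by (intro mult_left_mono sum_mono gauss_kernel_abs_moment) auto
  finally show ?thesis by (simp add: mult.assoc)
qed

end

text \<open>Smoothing by a small Gaussian changes the integral of a Lipschitz function little. The smoothed
  laws have densities that converge pointwise, because they are integrals of the characteristic
  functions, and hence converge in \<open>L\<^sup>1\<close> by Scheffe's lemma.\<close>

lemma char_tendsto_imp_integral_tendsto:
  fixes Q :: "nat \<Rightarrow> ('i \<Rightarrow> real) measure"
  assumes fin: "finite I"
    and Q: "\<And>n. prob_space (Q n)" "\<And>n. sets (Q n) = sets (PiM I (\<lambda>_. borel))"
    and R: "prob_space R" "sets R = sets (PiM I (\<lambda>_. borel))"
    and char: "\<And>\<theta>. (\<lambda>n. CLINT u|Q n. iexp (\<Sum>j\<in>I. \<theta> j * u j)) \<longlonglongrightarrow> (CLINT u|R. iexp (\<Sum>j\<in>I. \<theta> j * u j))"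
    and g: "g \<in> borel_measurable (PiM I (\<lambda>_. borel))" "\<And>y. \<bar>g y\<bar> \<le> B"
    and lip: "\<And>x y. \<bar>g x - g y\<bar> \<le> C * (\<Sum>j\<in>I. \<bar>x j - y j\<bar>)"
  shows "(\<lambda>n. \<integral>u. g u \<partial>Q n) \<longlonglongrightarrow> (\<integral>u. g u \<partial>R)"
proof (rule metric_LIMSEQ_I)
  fix e :: real assume e: "0 < e"
  let ?L = "PiM I (\<lambda>_. lborel :: real measure)"
  define d where "d = e / (4 * (\<bar>C\<bar> * card I + 1))"
  have pos: "0 < \<bar>C\<bar> * real (card I) + 1" by (smt (verit) mult_nonneg_nonneg abs_ge_zero of_nat_0_le_iff)
  have d: "0 < d" using e pos by (simp add: d_def)
  have "\<bar>C\<bar> * card I * d \<le> (\<bar>C\<bar> * card I + 1) * d" using d by (simp add: algebra_simps)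
  also have "\<dots> = e / 4" unfolding d_def using pos by (simp add: field_simps)
  finally have small: "\<bar>C\<bar> * card I * d \<le> e / 4" .
  define q where "q Q' y = (\<integral>u. gauss_kernel I d u y \<partial>Q')" for Q' y
  note sdi = smoothed_density_integral[OF fin d _ _ g, folded q_def]
  have q_nonneg: "0 \<le> q Q' y" for Q' y unfolding q_def by (simp add: gauss_kernel_nonneg)
  have close: "\<bar>(\<integral>u. g u \<partial>Q') - (\<integral>y. g y * q Q' y \<partial>?L)\<bar> \<le> e / 4"
    if "prob_space Q'" "sets Q' = sets (PiM I (\<lambda>_. borel))" for Q'
  proof -
    interpret Q': prob_space Q' by fact
    have gm: "g \<in> borel_measurable Q'" using g(1) that(2) measurable_cong_sets by blast
    have gi: "integrable Q' g" using g(2) gm by (intro Q'.integrable_const_bound[of _ B]) auto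
    let ?s = "\<lambda>u. \<integral>y. g y * gauss_kernel I d u y \<partial>?L"
    have "\<bar>(\<integral>u. g u \<partial>Q') - (\<integral>y. g y * q Q' y \<partial>?L)\<bar> = \<bar>\<integral>u. g u - ?s u \<partial>Q'\<bar>"
      using gi sdi(5,6)[OF that] by simp
    also have "\<dots> \<le> (\<integral>u. \<bar>g u - ?s u\<bar> \<partial>Q')" by (rule integral_abs_bound)
    also have "\<dots> \<le> (\<integral>u. e / 4 \<partial>Q')"
    proof (rule integral_mono)
      show "integrable Q' (\<lambda>u. \<bar>g u - ?s u\<bar>)" using gi sdi(6)[OF that] by auto
      show "\<bar>g u - ?s u\<bar> \<le> e / 4" for u
        using smoothing_close[OF fin d g lip, of u] small by (simp add: abs_minus_commute)
    qed simp
    finally show ?thesis by (simp add: Q'.prob_space)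
  qed
  have B: "0 \<le> B" using g(2)[of undefined] by linarith
  have L1: "(\<lambda>n. \<integral>\<^sup>+ y. norm (q (Q n) y - q R y) \<partial>?L) \<longlonglongrightarrow> 0"
  proof (rule Scheffe_lemma2)
    have "(\<integral>\<^sup>+ y. norm (q Q' y) \<partial>?L) = 1" if "prob_space Q'" "sets Q' = sets (PiM I (\<lambda>_. borel))" for Q'
      using sdi(2,3)[OF that] q_nonneg by (simp add: nn_integral_eq_integral)
    then show "(\<integral>\<^sup>+ y. norm (q (Q n) y) \<partial>?L) \<le> (\<integral>\<^sup>+ y. norm (q R y) \<partial>?L)" for n
      using Q R by simp
    show "AE y in ?L. (\<lambda>n. q (Q n) y) \<longlonglongrightarrow> q R y"
      unfolding q_def by (intro always_eventually allI smoothed_density_tendsto[OF fin d Q R char])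
  qed (use sdi(1,2) Q R in auto)
  have "(\<lambda>n. \<integral>y. norm (q (Q n) y - q R y) \<partial>?L) \<longlonglongrightarrow> 0"
  proof -
    have "ennreal (\<integral>y. norm (q (Q n) y - q R y) \<partial>?L) = (\<integral>\<^sup>+ y. norm (q (Q n) y - q R y) \<partial>?L)" for n
      using sdi(2) Q R by (intro nn_integral_eq_integral[symmetric]) auto
    then have "(\<lambda>n. ennreal (\<integral>y. norm (q (Q n) y - q R y) \<partial>?L)) \<longlonglongrightarrow> ennreal 0" using L1 by simp
    then show ?thesis by (subst (asm) tendsto_ennreal_iff) auto
  qed
  then have "(\<lambda>n. B * (\<integral>y. norm (q (Q n) y - q R y) \<partial>?L)) \<longlonglongrightarrow> B * 0" by (rule tendsto_mult_left)
  then have "\<forall>\<^sub>F n in sequentially. B * (\<integral>y. norm (q (Q n) y - q R y) \<partial>?L) < e / 4"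
    using e by (intro order_tendstoD(2)) auto
  then obtain N where N: "\<And>n. n \<ge> N \<Longrightarrow> B * (\<integral>y. norm (q (Q n) y - q R y) \<partial>?L) < e / 4"
    unfolding eventually_sequentially by blast
  have "dist (\<integral>u. g u \<partial>Q n) (\<integral>u. g u \<partial>R) < e" if n: "n \<ge> N" for n
  proof -
    have "\<bar>(\<integral>y. g y * q (Q n) y \<partial>?L) - (\<integral>y. g y * q R y \<partial>?L)\<bar> = \<bar>\<integral>y. g y * (q (Q n) y - q R y) \<partial>?L\<bar>"
      using sdi(4)[OF Q] sdi(4)[OF R] by (simp add: right_diff_distrib)
    also have "\<dots> \<le> (\<integral>y. \<bar>g y * (q (Q n) y - q R y)\<bar> \<partial>?L)" by (rule integral_abs_bound)
    also have "\<dots> \<le> (\<integral>y. B * norm (q (Q n) y - q R y) \<partial>?L)"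
    proof (rule integral_mono)
      show "integrable ?L (\<lambda>y. \<bar>g y * (q (Q n) y - q R y)\<bar>)"
        using sdi(4)[OF Q] sdi(4)[OF R] by (auto simp: right_diff_distrib)
      show "integrable ?L (\<lambda>y. B * norm (q (Q n) y - q R y))"
        using sdi(2)[OF Q] sdi(2)[OF R] by auto
      show "\<bar>g y * (q (Q n) y - q R y)\<bar> \<le> B * norm (q (Q n) y - q R y)" for y
        using g(2) by (auto simp: abs_mult intro: mult_right_mono)
    qed
    also have "\<dots> < e / 4" using N[OF n] by simp
    finally show ?thesis
      using close[OF Q, of n] close[OF R] e unfolding dist_real_def by linarith
  qed
  then show "\<exists>no. \<forall>n\<ge>no. dist (\<integral>u. g u \<partial>Q n) (\<integral>u. g u \<partial>R) < e" by blast
qed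

lemma measurable_vec_nth [measurable (raw)]:
  fixes f :: "'a \<Rightarrow> real^'d"
  assumes "f \<in> borel_measurable M"
  shows "(\<lambda>x. f x $ i) \<in> borel_measurable M"
  by (rule measurable_compose[OF assms]) (intro borel_measurable_continuous_onI continuous_intros)

lemma measurable_vec_lambda:
  fixes f :: "'a \<Rightarrow> 'd::finite \<Rightarrow> real"
  assumes "\<And>i. (\<lambda>x. f x i) \<in> borel_measurable M"
  shows "(\<lambda>x. (\<chi> i. f x i) :: real^'d) \<in> borel_measurable M"
  by (rule borel_measurable_euclidean_space[THEN iffD2]) (auto simp: Basis_vec_def inner_axis assms)

text \<open>The preceding criterion for random vectors, obtained by listing all coordinates.\<close>

lemma vector_char_tendsto_imp_expectation_tendsto:
  fixes Y :: "nat \<Rightarrow> 'a \<Rightarrow> 'j \<Rightarrow> real^'d" and Z :: "'b \<Rightarrow> 'j \<Rightarrow> real^'d"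
  assumes fin: "finite J" and M: "prob_space M" and P: "prob_space P"
    and Y [measurable]: "\<And>n j. (\<lambda>\<omega>. Y n \<omega> j) \<in> borel_measurable M"
    and Z [measurable]: "\<And>j. (\<lambda>\<omega>. Z \<omega> j) \<in> borel_measurable P"
    and char: "\<And>\<theta>. (\<lambda>n. CLINT \<omega>|M. iexp (\<Sum>j\<in>J. \<theta> j \<bullet> Y n \<omega> j)) \<longlonglongrightarrow> (CLINT \<omega>|P. iexp (\<Sum>j\<in>J. \<theta> j \<bullet> Z \<omega> j))"
    and g: "g \<in> borel_measurable (PiM J (\<lambda>_. borel))" "\<And>y. \<bar>g y\<bar> \<le> B"
    and lip: "\<And>x y. \<bar>g x - g y\<bar> \<le> C * (\<Sum>j\<in>J. norm (x j - y j))"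
  shows "(\<lambda>n. \<integral>\<omega>. g (Y n \<omega>) \<partial>M) \<longlonglongrightarrow> (\<integral>\<omega>. g (Z \<omega>) \<partial>P)"
proof -
  define I :: "('j \<times> 'd) set" where "I = J \<times> UNIV"
  have finI: "finite I" using fin by (simp add: I_def)
  define co :: "('j \<Rightarrow> real^'d) \<Rightarrow> 'j \<times> 'd \<Rightarrow> real" where "co x = (\<lambda>p\<in>I. x (fst p) $ snd p)" for x
  define oc :: "('j \<times> 'd \<Rightarrow> real) \<Rightarrow> 'j \<Rightarrow> real^'d" where "oc u = (\<lambda>j\<in>J. \<chi> i. u (j, i))" for u
  have oc_meas: "oc \<in> measurable (PiM I (\<lambda>_. borel)) (PiM J (\<lambda>_. borel))"
    unfolding oc_def
    by (intro measurable_restrict measurable_vec_lambda measurable_component_singleton) (auto simp: I_def)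
  have co_meas: "(\<lambda>\<omega>. co (f \<omega>)) \<in> measurable N (PiM I (\<lambda>_. borel))"
    if [measurable]: "\<And>j. (\<lambda>\<omega>. f \<omega> j) \<in> borel_measurable N" for f :: "'z \<Rightarrow> 'j \<Rightarrow> real^'d" and N
    unfolding co_def by (intro measurable_restrict) measurable
  have gm: "(\<lambda>u. g (oc u)) \<in> borel_measurable (PiM I (\<lambda>_. borel))"
    using oc_meas g(1) by (rule measurable_compose)
  have g_oc_co: "g (oc (co x)) = g x" for x
  proof -
    have "norm (oc (co x) j - x j) = 0" if "j \<in> J" for j
      using that by (simp add: oc_def co_def I_def)
    then have "(\<Sum>j\<in>J. norm (oc (co x) j - x j)) = 0" by (intro sum.neutral) simp
    then show ?thesis using lip[of "oc (co x)" x] by simp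
  qed
  have C: "C * (\<Sum>j\<in>J. norm (x j - y j)) \<le> \<bar>C\<bar> * (\<Sum>j\<in>J. norm (x j - y j))" for x y :: "'j \<Rightarrow> real^'d"
    by (intro mult_right_mono) (auto intro: sum_nonneg)
  have lip': "\<bar>g (oc u) - g (oc v)\<bar> \<le> \<bar>C\<bar> * (\<Sum>p\<in>I. \<bar>u p - v p\<bar>)" for u v
  proof -
    have "\<bar>g (oc u) - g (oc v)\<bar> \<le> \<bar>C\<bar> * (\<Sum>j\<in>J. norm (oc u j - oc v j))"
      by (rule order_trans[OF lip C])
    also have "(\<Sum>j\<in>J. norm (oc u j - oc v j)) \<le> (\<Sum>j\<in>J. \<Sum>i\<in>UNIV. \<bar>u (j, i) - v (j, i)\<bar>)"
    proof (rule sum_mono)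
      fix j assume "j \<in> J"
      then show "norm (oc u j - oc v j) \<le> (\<Sum>i\<in>UNIV. \<bar>u (j, i) - v (j, i)\<bar>)"
        using norm_le_l1_cart[of "oc u j - oc v j"] by (simp add: oc_def)
    qed
    also have "\<dots> = (\<Sum>p\<in>I. \<bar>u p - v p\<bar>)"
      unfolding I_def sum.cartesian_product by (simp add: case_prod_unfold)
    finally show ?thesis by (simp add: mult_left_mono)
  qed
  have char_co: "(CLINT u|distr N (PiM I (\<lambda>_. borel)) (\<lambda>\<omega>. co (f \<omega>)). iexp (\<Sum>p\<in>I. \<theta> p * u p))
      = (CLINT \<omega>|N. iexp (\<Sum>j\<in>J. (\<chi> i. \<theta> (j, i)) \<bullet> f \<omega> j))"
    if f: "\<And>j. (\<lambda>\<omega>. f \<omega> j) \<in> borel_measurable N" for f :: "'z \<Rightarrow> 'j \<Rightarrow> real^'d" and N \<theta>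
  proof -
    have m: "(\<lambda>u. iexp (\<Sum>p\<in>I. \<theta> p * u p)) \<in> borel_measurable (PiM I (\<lambda>_. borel))"
      by measurable
    have "(\<Sum>p\<in>I. \<theta> p * co x p) = (\<Sum>j\<in>J. (\<chi> i. \<theta> (j, i)) \<bullet> x j)" for x
      by (simp add: I_def co_def inner_vec_def sum.cartesian_product case_prod_unfold)
    then show ?thesis using m co_meas[OF f] by (simp only: integral_distr)
  qed
  have "(\<lambda>n. \<integral>u. g (oc u) \<partial>distr M (PiM I (\<lambda>_. borel)) (\<lambda>\<omega>. co (Y n \<omega>)))
      \<longlonglongrightarrow> (\<integral>u. g (oc u) \<partial>distr P (PiM I (\<lambda>_. borel)) (\<lambda>\<omega>. co (Z \<omega>)))"
  proof (rule char_tendsto_imp_integral_tendsto[OF finI _ _ _ _ _ gm g(2) lip'])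
    show "(\<lambda>n. CLINT u|distr M (PiM I (\<lambda>_. borel)) (\<lambda>\<omega>. co (Y n \<omega>)). iexp (\<Sum>j\<in>I. \<theta> j * u j))
        \<longlonglongrightarrow> (CLINT u|distr P (PiM I (\<lambda>_. borel)) (\<lambda>\<omega>. co (Z \<omega>)). iexp (\<Sum>j\<in>I. \<theta> j * u j))" for \<theta>
      unfolding char_co[OF Y] char_co[OF Z] by (rule char)
  qed (auto intro!: prob_space.prob_space_distr M P co_meas)
  then show ?thesis
    using co_meas[OF Y] co_meas[OF Z] gm by (simp add: integral_distr g_oc_co)
qed

lemma tendsto_closed_set_bump:
  fixes F :: "'b::metric_space set"
  assumes "closed F" "F \<noteq> {}"
  shows "(\<lambda>k. max 0 (1 - real k * infdist x F)) \<longlonglongrightarrow> indicator F x"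
proof (cases "x \<in> F")
  case True
  then show ?thesis using assms by simp
next
  case False
  then have pos: "0 < infdist x F"
    using assms by (simp add: infdist_pos_not_in_closed)
  obtain k0 where k0: "1 < real k0 * infdist x F"
    using reals_Archimedean3[OF pos] by blast
  have "max 0 (1 - real k * infdist x F) = 0" if "k \<ge> k0" for k
  proof -
    have "real k0 * infdist x F \<le> real k * infdist x F" using that pos by (intro mult_right_mono) auto
    then show ?thesis using k0 by simp
  qed
  then have "\<forall>\<^sub>F k in sequentially. max 0 (1 - real k * infdist x F) = 0"
    unfolding eventually_sequentially by blast
  then have "(\<lambda>k. max 0 (1 - real k * infdist x F)) \<longlonglongrightarrow> 0" by (rule tendsto_eventually)
  then show ?thesis using False by simp
qed

text \<open>A vector of random variables and the vector of independent copies have the same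
  characteristic function, hence agree on products of Lipschitz functions, and these approximate
  indicators of products of closed sets.\<close>

lemma (in prob_space) indep_vars_if_char_factorizes:
  fixes X :: "'j \<Rightarrow> 'a \<Rightarrow> real^'d"
  assumes fin: "finite J" and X [measurable]: "\<And>j. X j \<in> borel_measurable M"
    and char: "\<And>\<theta>. (CLINT \<omega>|M. iexp (\<Sum>j\<in>J. \<theta> j \<bullet> X j \<omega>)) = (\<Prod>j\<in>J. CLINT \<omega>|M. iexp (\<theta> j \<bullet> X j \<omega>))"
  shows "indep_vars (\<lambda>_. borel) X J"
proof (cases "J = {}")
  case True
  then show ?thesis by (simp add: indep_vars_def indep_sets_def)
next
  case False
  define D where "D j = distr M borel (X j)" for j
  interpret PD: product_prob_space D J
    by (rule product_prob_spaceI) (simp add: D_def prob_space_distr)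
  have sets_PD [measurable_cong]: "sets (PiM J D) = sets (PiM J (\<lambda>_. borel))"
    by (intro sets_PiM_cong) (auto simp: D_def)
  define R where "R x j = (if j \<in> J then x j else 0 :: real^'d)" for x j
  have R_meas: "(\<lambda>x. R x j) \<in> borel_measurable (PiM J D)" for j
    unfolding R_def by (cases "j \<in> J") auto
  have prodD: "(\<integral>x. (\<Prod>j\<in>J. f j (x j)) \<partial>PiM J D) = (\<Prod>j\<in>J. \<integral>\<omega>. f j (X j \<omega>) \<partial>M)"
    if f: "\<And>j. f j \<in> borel_measurable borel" "\<And>j x. norm (f j x) \<le> 1"
    for f :: "'j \<Rightarrow> real^'d \<Rightarrow> 'z::{real_normed_field,banach,second_countable_topology}"
  proof -
    have "integrable (D j) (f j)" for j
    proof -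
      have "prob_space (D j)" unfolding D_def by (rule prob_space_distr) simp
      then show ?thesis
        using f by (intro finite_measure.integrable_const_bound[OF prob_space.finite_measure, of _ _ 1]) (auto simp: D_def)
    qed
    then have "(\<integral>x. (\<Prod>j\<in>J. f j (x j)) \<partial>PiM J D) = (\<Prod>j\<in>J. integral\<^sup>L (D j) (f j))"
      by (intro PD.product_integral_prod fin)
    also have "\<dots> = (\<Prod>j\<in>J. \<integral>\<omega>. f j (X j \<omega>) \<partial>M)"
      using f(1) by (simp add: D_def integral_distr)
    finally show ?thesis .
  qed
  have same: "expectation (\<lambda>\<omega>. g (\<lambda>j. X j \<omega>)) = (\<integral>x. g (R x) \<partial>PiM J D)"
    if g: "g \<in> borel_measurable (PiM J (\<lambda>_. borel))" "\<And>y. \<bar>g y\<bar> \<le> B"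
      "\<And>x y. \<bar>g x - g y\<bar> \<le> C * (\<Sum>j\<in>J. norm (x j - y j))" for g B C
  proof -
    have charD: "(CLINT x|PiM J D. iexp (\<Sum>j\<in>J. \<theta> j \<bullet> R x j)) = (CLINT \<omega>|M. iexp (\<Sum>j\<in>J. \<theta> j \<bullet> X j \<omega>))" for \<theta>
    proof -
      have "iexp (\<Sum>j\<in>J. \<theta> j \<bullet> R x j) = (\<Prod>j\<in>J. iexp (\<theta> j \<bullet> x j))" for x
        unfolding R_def of_real_sum sum_distrib_left exp_sum[OF fin] by (intro prod.cong) auto
      then have "(CLINT x|PiM J D. iexp (\<Sum>j\<in>J. \<theta> j \<bullet> R x j)) = (CLINT x|PiM J D. (\<Prod>j\<in>J. iexp (\<theta> j \<bullet> x j)))"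
        by (simp only:)
      also have "\<dots> = (\<Prod>j\<in>J. CLINT \<omega>|M. iexp (\<theta> j \<bullet> X j \<omega>))"
      proof (rule prodD)
        show "norm (iexp (\<theta> j \<bullet> x)) \<le> 1" for j x by (simp only: norm_exp_i_times)
      qed measurable
      finally show ?thesis by (simp only: char)
    qed
    have "(\<lambda>n::nat. expectation (\<lambda>\<omega>. g (\<lambda>j. X j \<omega>))) \<longlonglongrightarrow> (\<integral>x. g (R x) \<partial>PiM J D)"
      by (rule vector_char_tendsto_imp_expectation_tendsto[OF fin prob_space_axioms PD.prob_space_axioms _ R_meas _ g])
        (simp_all only: charD X tendsto_const)
    then show ?thesis by (simp add: LIMSEQ_const_iff)
  qed
  have "prob (\<Inter>j\<in>J. X j -` F j \<inter> space M) = (\<Prod>j\<in>J. prob (X j -` F j \<inter> space M))"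
    if F: "\<And>j. j \<in> J \<Longrightarrow> closed (F j)" for F
  proof (cases "\<exists>j\<in>J. F j = {}")
    case True
    then obtain j where j: "j \<in> J" "F j = {}" by blast
    then have "(\<Inter>j\<in>J. X j -` F j \<inter> space M) = {}" by auto
    moreover have "(\<Prod>j\<in>J. prob (X j -` F j \<inter> space M)) = 0" using j fin by (intro prod_zero bexI[of _ j]) auto
    ultimately show ?thesis by simp
  next
    case ne: False
    define h where "h k j x = max 0 (1 - real k * infdist x (F j))" for k j x
    have h01: "0 \<le> h k j x" "h k j x \<le> 1" for k j x
      by (auto simp: h_def infdist_nonneg)
    have h_meas [measurable]: "h k j \<in> borel_measurable borel" for k j
      unfolding h_def by (intro borel_measurable_continuous_onI continuous_intros)
    have h_lip: "\<bar>h k j x - h k j y\<bar> \<le> real k * norm (x - y)" for k j x y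
    proof -
      have "\<bar>h k j x - h k j y\<bar> \<le> \<bar>real k * infdist x (F j) - real k * infdist y (F j)\<bar>"
        unfolding h_def by linarith
      also have "\<dots> = real k * \<bar>infdist x (F j) - infdist y (F j)\<bar>"
        by (simp add: right_diff_distrib[symmetric] abs_mult)
      also have "\<dots> \<le> real k * dist x y"
        using infdist_triangle_abs[of x "F j" y] by (intro mult_left_mono) auto
      finally show ?thesis by (simp add: dist_norm)
    qed
    have lim: "(\<lambda>k. h k j x) \<longlonglongrightarrow> indicator (F j) x" if "j \<in> J" for j x
      unfolding h_def using F that ne by (intro tendsto_closed_set_bump) auto
    have eq: "expectation (\<lambda>\<omega>. \<Prod>j\<in>J. h k j (X j \<omega>)) = (\<Prod>j\<in>J. expectation (\<lambda>\<omega>. h k j (X j \<omega>)))" for k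
    proof -
      let ?g = "\<lambda>x. \<Prod>j\<in>J. h k j (x j)"
      have "expectation (\<lambda>\<omega>. ?g (\<lambda>j. X j \<omega>)) = (\<integral>x. ?g (R x) \<partial>PiM J D)"
      proof (rule same)
        show "?g \<in> borel_measurable (PiM J (\<lambda>_. borel))" by measurable
        show "\<bar>?g y\<bar> \<le> 1" for y
          using h01 by (simp add: prod_le_1 prod_nonneg)
        show "\<bar>?g x - ?g y\<bar> \<le> real k * (\<Sum>j\<in>J. norm (x j - y j))" for x y
        proof -
          have "norm (?g x - ?g y) \<le> (\<Sum>j\<in>J. norm (h k j (x j) - h k j (y j)))"
            by (rule norm_prod_diff) (use h01 in auto)
          also have "\<dots> \<le> (\<Sum>j\<in>J. real k * norm (x j - y j))"
            using h_lip by (intro sum_mono) simp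
          finally show ?thesis by (simp add: sum_distrib_left)
        qed
      qed
      also have "\<dots> = (\<integral>x. (\<Prod>j\<in>J. h k j (x j)) \<partial>PiM J D)"
        by (intro Bochner_Integration.integral_cong prod.cong refl) (simp add: R_def)
      also have "\<dots> = (\<Prod>j\<in>J. expectation (\<lambda>\<omega>. h k j (X j \<omega>)))"
        by (rule prodD) (use h01 in auto)
      finally show ?thesis .
    qed
    have "(\<lambda>k. expectation (\<lambda>\<omega>. \<Prod>j\<in>J. h k j (X j \<omega>))) \<longlonglongrightarrow> expectation (\<lambda>\<omega>. \<Prod>j\<in>J. indicator (F j) (X j \<omega>))"
    proof (rule integral_dominated_convergence[where w = "\<lambda>_. 1"])
      show "AE \<omega> in M. (\<lambda>k. \<Prod>j\<in>J. h k j (X j \<omega>)) \<longlonglongrightarrow> (\<Prod>j\<in>J. indicator (F j) (X j \<omega>))"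
        using lim by (intro always_eventually allI tendsto_prod) auto
      show "AE \<omega> in M. norm (\<Prod>j\<in>J. h k j (X j \<omega>)) \<le> 1" for k
        using h01 by (simp add: prod_le_1 prod_nonneg)
      show "(\<lambda>\<omega>. \<Prod>j\<in>J. indicator (F j) (X j \<omega>) :: real) \<in> borel_measurable M"
      proof (rule borel_measurable_prod)
        fix j assume "j \<in> J"
        then have [measurable]: "F j \<in> sets borel" using F by auto
        show "(\<lambda>\<omega>. indicator (F j) (X j \<omega>) :: real) \<in> borel_measurable M" by measurable
      qed
    qed auto
    moreover have "(\<lambda>k. \<Prod>j\<in>J. expectation (\<lambda>\<omega>. h k j (X j \<omega>))) \<longlonglongrightarrow> (\<Prod>j\<in>J. prob (X j -` F j \<inter> space M))"
    proof (rule tendsto_prod)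
      fix j assume j: "j \<in> J"
      then have [measurable]: "F j \<in> sets borel" using F by auto
      have "(\<lambda>k. expectation (\<lambda>\<omega>. h k j (X j \<omega>))) \<longlonglongrightarrow> expectation (\<lambda>\<omega>. indicator (F j) (X j \<omega>))"
        by (rule integral_dominated_convergence[where w = "\<lambda>_. 1"]) (use lim[OF j] h01 in auto)
      also have "expectation (\<lambda>\<omega>. indicator (F j) (X j \<omega>)) = expectation (indicator (X j -` F j \<inter> space M))"
        by (intro Bochner_Integration.integral_cong) (auto split: split_indicator)
      also have "\<dots> = prob (X j -` F j \<inter> space M)" by simp
      finally show "(\<lambda>k. expectation (\<lambda>\<omega>. h k j (X j \<omega>))) \<longlonglongrightarrow> prob (X j -` F j \<inter> space M)" .
    qed
    ultimately have "expectation (\<lambda>\<omega>. \<Prod>j\<in>J. indicator (F j) (X j \<omega>) :: real) = (\<Prod>j\<in>J. prob (X j -` F j \<inter> space M))"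
      unfolding eq by (rule LIMSEQ_unique)
    moreover have "expectation (\<lambda>\<omega>. \<Prod>j\<in>J. indicator (F j) (X j \<omega>) :: real) = expectation (indicator (\<Inter>j\<in>J. X j -` F j \<inter> space M))"
    proof (rule Bochner_Integration.integral_cong)
      fix \<omega> assume "\<omega> \<in> space M"
      then show "(\<Prod>j\<in>J. indicator (F j) (X j \<omega>) :: real) = indicator (\<Inter>j\<in>J. X j -` F j \<inter> space M) \<omega>"
        using fin False by (auto simp: indicator_def prod.If_cases intro: prod_zero)
    qed simp
    moreover have "(\<Inter>j\<in>J. X j -` F j \<inter> space M) \<in> events"
    proof (rule sets.finite_INT[OF fin False])
      fix j assume "j \<in> J"
      then have [measurable]: "F j \<in> sets borel" using F by auto
      show "X j -` F j \<inter> space M \<in> events" by measurable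
    qed
    ultimately show ?thesis by simp
  qed
  note factor = this
  show ?thesis
  proof (rule indep_vars_finite[where E = "\<lambda>_. Collect closed", OF False fin, THEN iffD2])
    show "\<forall>A\<in>J \<rightarrow> Collect closed. prob (\<Inter>j\<in>J. X j -` A j \<inter> space M) = (\<Prod>j\<in>J. prob (X j -` A j \<inter> space M))"
      using factor by (auto simp: Pi_iff)
    show "sets borel = sigma_sets (space borel) (Collect closed)" by (subst borel_eq_closed) simp
  qed (auto simp: Int_stable_def closed_Int)
qed

section \<open>Normal random variables and their characteristic functions\<close>

text \<open>Levy's uniqueness theorem for the standardized variable.\<close>

lemma (in prob_space) normal_distributed_iff_char:
  assumes X [measurable]: "X \<in> borel_measurable M" and s: "0 < \<sigma>"
  shows "distributed M lborel X (normal_density 0 \<sigma>) \<longleftrightarrow>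
    (\<forall>t. (CLINT \<omega>|M. iexp (t * X \<omega>)) = complex_of_real (exp (- (\<sigma> * t)\<^sup>2 / 2)))"
proof -
  let ?D = "distr M borel (\<lambda>\<omega>. X \<omega> / \<sigma>)"
  have rD: "real_distribution ?D" by (rule real_distribution_distr) simp
  have char_D: "char ?D t = (CLINT \<omega>|M. iexp ((t / \<sigma>) * X \<omega>))" for t
    unfolding char_def by (subst integral_distr) auto
  have "distributed M lborel X (normal_density 0 \<sigma>) \<longleftrightarrow> distributed M lborel (\<lambda>\<omega>. X \<omega> / \<sigma>) std_normal_density"
    using normal_standard_normal_convert[OF s, of X 0] by simp
  also have "\<dots> \<longleftrightarrow> ?D = std_normal_distribution"
    by (auto simp: distributed_def cong: distr_cong)
  also have "\<dots> \<longleftrightarrow> char ?D = char std_normal_distribution"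
    using Levy_uniqueness[OF rD real_dist_normal_dist] by auto
  also have "\<dots> \<longleftrightarrow> (\<forall>t. (CLINT \<omega>|M. iexp ((t / \<sigma>) * X \<omega>)) = complex_of_real (exp (- t\<^sup>2 / 2)))"
    by (simp only: char_std_normal_distribution fun_eq_iff char_D)
  also have "\<dots> \<longleftrightarrow> (\<forall>t. (CLINT \<omega>|M. iexp (t * X \<omega>)) = complex_of_real (exp (- (\<sigma> * t)\<^sup>2 / 2)))"
  proof safe
    fix t assume "\<forall>t. (CLINT \<omega>|M. iexp ((t / \<sigma>) * X \<omega>)) = complex_of_real (exp (- t\<^sup>2 / 2))"
    from this[rule_format, of "\<sigma> * t"] s
    show "(CLINT \<omega>|M. iexp (t * X \<omega>)) = complex_of_real (exp (- (\<sigma> * t)\<^sup>2 / 2))" by simp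
  next
    fix t assume "\<forall>t. (CLINT \<omega>|M. iexp (t * X \<omega>)) = complex_of_real (exp (- (\<sigma> * t)\<^sup>2 / 2))"
    from this[rule_format, of "t / \<sigma>"] s
    show "(CLINT \<omega>|M. iexp ((t / \<sigma>) * X \<omega>)) = complex_of_real (exp (- t\<^sup>2 / 2))" by simp
  qed
  finally show ?thesis .
qed

lemma (in prob_space) normal_fourth_moment:
  assumes X: "distributed M lborel X (normal_density 0 \<sigma>)" and s: "0 < \<sigma>"
  shows "integrable M (\<lambda>\<omega>. X \<omega> ^ 4)" "expectation (\<lambda>\<omega>. X \<omega> ^ 4) = 3 * \<sigma> ^ 4"
proof -
  have hb: "has_bochner_integral lborel (\<lambda>x. normal_density 0 \<sigma> x * x ^ 4) (3 * \<sigma> ^ 4)"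
    using normal_moment_even[OF s, of 0 2] s by (simp add: fact_numeral field_simps power2_eq_square eval_nat_numeral)
  show "integrable M (\<lambda>\<omega>. X \<omega> ^ 4)"
    using distributed_integrable[OF X, of "\<lambda>x. x ^ 4"] hb by (auto simp: has_bochner_integral_iff)
  show "expectation (\<lambda>\<omega>. X \<omega> ^ 4) = 3 * \<sigma> ^ 4"
    using distributed_integral[OF X, of "\<lambda>x. x ^ 4"] hb by (auto simp: has_bochner_integral_iff)
qed

lemma norm_power4_le_sum:
  fixes x :: "real^'d"
  shows "norm x ^ 4 \<le> real CARD('d) ^ 4 * (\<Sum>i\<in>UNIV. (x $ i) ^ 4)"
proof -
  obtain i where i: "\<And>j. \<bar>x $ j\<bar> \<le> \<bar>x $ i\<bar>"
  proof -
    have "finite (range (\<lambda>j. \<bar>x $ j\<bar>))" "range (\<lambda>j. \<bar>x $ j\<bar>) \<noteq> {}" by auto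
    from Max_in[OF this] obtain i where "Max (range (\<lambda>j. \<bar>x $ j\<bar>)) = \<bar>x $ i\<bar>" by (elim rangeE)
    then show ?thesis using that[of i] by (metis Max_ge finite rangeI finite_imageI)
  qed
  have "norm x \<le> (\<Sum>j\<in>UNIV. \<bar>x $ j\<bar>)" by (rule norm_le_l1_cart)
  also have "\<dots> \<le> (\<Sum>j\<in>(UNIV::'d set). \<bar>x $ i\<bar>)" by (intro sum_mono i)
  finally have "norm x \<le> real CARD('d) * \<bar>x $ i\<bar>" by simp
  then have "norm x ^ 4 \<le> (real CARD('d) * \<bar>x $ i\<bar>) ^ 4" by (intro power_mono) auto
  also have "\<dots> = real CARD('d) ^ 4 * (x $ i) ^ 4" by (simp add: power_mult_distrib power_even_abs)
  also have "(x $ i) ^ 4 \<le> (\<Sum>i\<in>UNIV. (x $ i) ^ 4)" by (intro member_le_sum) auto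
  finally show ?thesis by (simp add: mult_left_mono)
qed

lemma (in prob_space) norm_fourth_moment_le:
  fixes D :: "'a \<Rightarrow> real^'d"
  assumes D [measurable]: "D \<in> borel_measurable M"
    and int: "\<And>i. integrable M (\<lambda>\<omega>. (D \<omega> $ i) ^ 4)" and le: "\<And>i. expectation (\<lambda>\<omega>. (D \<omega> $ i) ^ 4) \<le> b i"
  shows "integrable M (\<lambda>\<omega>. norm (D \<omega>) ^ 4)"
    and "expectation (\<lambda>\<omega>. norm (D \<omega>) ^ 4) \<le> real CARD('d) ^ 4 * (\<Sum>i\<in>UNIV. b i)"
proof -
  let ?S = "\<lambda>\<omega>. real CARD('d) ^ 4 * (\<Sum>i\<in>UNIV. (D \<omega> $ i) ^ 4)"
  have intS: "integrable M ?S"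
    by (intro integrable_mult_right Bochner_Integration.integrable_sum int)
  show int4: "integrable M (\<lambda>\<omega>. norm (D \<omega>) ^ 4)"
  proof (rule Bochner_Integration.integrable_bound[OF intS])
    show "AE \<omega> in M. norm (norm (D \<omega>) ^ 4) \<le> norm (?S \<omega>)"
    proof (intro always_eventually allI)
      fix \<omega>
      have "norm (norm (D \<omega>) ^ 4) = norm (D \<omega>) ^ 4" by simp
      also have "\<dots> \<le> ?S \<omega>" by (rule norm_power4_le_sum)
      also have "\<dots> \<le> norm (?S \<omega>)" unfolding real_norm_def by (rule abs_ge_self)
      finally show "norm (norm (D \<omega>) ^ 4) \<le> norm (?S \<omega>)" .
    qed
  qed measurable
  have "expectation (\<lambda>\<omega>. norm (D \<omega>) ^ 4) \<le> expectation ?S"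
    by (intro integral_mono int4 intS norm_power4_le_sum)
  also have "\<dots> = real CARD('d) ^ 4 * (\<Sum>i\<in>UNIV. expectation (\<lambda>\<omega>. (D \<omega> $ i) ^ 4))"
    using int by simp
  also have "\<dots> \<le> real CARD('d) ^ 4 * (\<Sum>i\<in>UNIV. b i)"
    by (intro mult_left_mono sum_mono le) auto
  finally show "expectation (\<lambda>\<omega>. norm (D \<omega>) ^ 4) \<le> real CARD('d) ^ 4 * (\<Sum>i\<in>UNIV. b i)" .
qed

section \<open>The Levy construction of Brownian motion\<close>

lemma quadratic_form_parallelogram:
  fixes S :: "real^'d^'d"
  shows "(x + y) \<bullet> (S *v (x + y)) + (x - y) \<bullet> (S *v (x - y)) = 2 * (x \<bullet> (S *v x)) + 2 * (y \<bullet> (S *v y))"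
  by (simp add: matrix_vector_right_distrib matrix_vector_mult_diff_distrib inner_add_left inner_add_right
      inner_diff_left inner_diff_right)

lemma quadratic_form_scaleR:
  fixes S :: "real^'d^'d"
  shows "(c *\<^sub>R x) \<bullet> (S *v (c *\<^sub>R x)) = c\<^sup>2 * (x \<bullet> (S *v x))"
  by (simp add: matrix_vector_mult_scaleR power2_eq_square)

text \<open>Values at the dyadic points \<open>k / 2^m\<close>: midpoints are displaced by independent Gaussians
  whose variance is a quarter of the length \<open>2^(-m)\<close> of the interval that is halved.\<close>

fun levy_value :: "(nat \<times> nat \<Rightarrow> 'v::real_vector) \<Rightarrow> nat \<Rightarrow> nat \<Rightarrow> 'v" where
  "levy_value G 0 k = (\<Sum>i<k. G (0, i))"
| "levy_value G (Suc m) k =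
    (if even k then levy_value G m (k div 2)
     else (1/2) *\<^sub>R (levy_value G m (k div 2) + levy_value G m (Suc (k div 2)))
       + sqrt ((1/2) ^ (m + 2)) *\<^sub>R G (Suc m, k div 2))"

lemma levy_value_at_0: "levy_value G m 0 = 0"
  by (induction m) auto

lemma levy_value_refine: "levy_value G (m + j) (2 ^ j * k) = levy_value G m k"
proof (induction j)
  case (Suc j)
  have "levy_value G (m + Suc j) (2 ^ Suc j * k) = levy_value G (m + j) (2 ^ j * k)"
    by (simp add: mult.assoc)
  then show ?case using Suc by simp
qed simp

text \<open>The increments of a level are linear forms in the Gaussians, and halving an interval
  preserves the quadratic form by the parallelogram law; so the increments are independent with
  covariance matrix \<open>2^(-m) S\<close>.\<close>

lemma levy_increments_linear_form:
  fixes S :: "real^'d^'d"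
  defines "q \<equiv> \<lambda>x. x \<bullet> (S *v x)"
  shows "\<exists>J a. finite J \<and> J \<subseteq> {..m} \<times> UNIV \<and>
    (\<forall>G. (\<Sum>k<N. \<theta> k \<bullet> (levy_value G m (Suc k) - levy_value G m k)) = (\<Sum>j\<in>J. a j \<bullet> G j)) \<and>
    (\<Sum>j\<in>J. q (a j)) = (1/2) ^ m * (\<Sum>k<N. q (\<theta> k))"
proof (induction m arbitrary: N \<theta>)
  case 0
  show ?case
    by (rule exI[of _ "(\<lambda>k. (0, k)) ` {..<N}"], rule exI[of _ "\<lambda>j. \<theta> (snd j)"])
      (auto simp: sum.reindex inj_on_def)
next
  case (Suc m)
  define \<theta>' where "\<theta>' k = (if k < N then \<theta> k else 0)" for k
  define c where "c = sqrt ((1/2::real) ^ (m + 2))"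
  have c2: "c\<^sup>2 = (1/2) ^ m * (1/4)" by (simp add: c_def)
  define b where "b k = (1/2) *\<^sub>R (\<theta>' (2 * k) + \<theta>' (2 * k + 1))" for k
  define e where "e k = c *\<^sub>R (\<theta>' (2 * k) - \<theta>' (2 * k + 1))" for k
  have pairs: "(\<Sum>k<2 * n. f k) = (\<Sum>k<n. f (2 * k) + f (2 * k + 1))" for n and f :: "nat \<Rightarrow> real"
    by (induction n) (auto simp: algebra_simps)
  have extend: "(\<Sum>k<N. f k (\<theta> k)) = (\<Sum>k<2 * N. f k (\<theta>' k))" if "\<And>k. f k 0 = 0" for f :: "nat \<Rightarrow> real^'d \<Rightarrow> real"
    by (rule sum.mono_neutral_cong_left) (auto simp: \<theta>'_def that)
  obtain J a where J: "finite J" "J \<subseteq> {..m} \<times> UNIV"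
    "\<And>G. (\<Sum>k<N. b k \<bullet> (levy_value G m (Suc k) - levy_value G m k)) = (\<Sum>j\<in>J. a j \<bullet> G j)"
    "(\<Sum>j\<in>J. q (a j)) = (1/2) ^ m * (\<Sum>k<N. q (b k))"
    using Suc[of b N] by blast
  define J' where "J' = J \<union> (\<lambda>k. (Suc m, k)) ` {..<N}"
  define a' where "a' j = (if fst j = Suc m then e (snd j) else a j)" for j
  have disj: "J \<inter> (\<lambda>k. (Suc m, k)) ` {..<N} = {}" using J(2) by auto
  have split: "(\<Sum>j\<in>J'. f j (a' j)) = (\<Sum>j\<in>J. f j (a j)) + (\<Sum>k<N. f (Suc m, k) (e k))" for f :: "_ \<Rightarrow> _ \<Rightarrow> real"
  proof -
    have "(\<Sum>j\<in>J. f j (a' j)) = (\<Sum>j\<in>J. f j (a j))"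
      using J(2) by (intro sum.cong) (auto simp: a'_def)
    moreover have "(\<Sum>j\<in>(\<lambda>k. (Suc m, k)) ` {..<N}. f j (a' j)) = (\<Sum>k<N. f (Suc m, k) (e k))"
      by (subst sum.reindex) (auto simp: inj_on_def a'_def)
    ultimately show ?thesis
      unfolding J'_def by (subst sum.union_disjoint[OF J(1) _ disj]) auto
  qed
  have "(\<Sum>k<N. \<theta> k \<bullet> (levy_value G (Suc m) (Suc k) - levy_value G (Suc m) k)) = (\<Sum>j\<in>J'. a' j \<bullet> G j)" for G
  proof -
    have "(\<Sum>k<N. \<theta> k \<bullet> (levy_value G (Suc m) (Suc k) - levy_value G (Suc m) k)) =
        (\<Sum>k<2 * N. \<theta>' k \<bullet> (levy_value G (Suc m) (Suc k) - levy_value G (Suc m) k))"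
      by (rule extend) simp
    also have "\<dots> = (\<Sum>k<N. b k \<bullet> (levy_value G m (Suc k) - levy_value G m k) + e k \<bullet> G (Suc m, k))"
      unfolding pairs
    proof (rule sum.cong[OF refl])
      fix k
      define u where "u = levy_value G m k"
      define v where "v = levy_value G m (Suc k)"
      have "levy_value G (Suc m) (2 * k + 1) = (1/2) *\<^sub>R (u + v) + c *\<^sub>R G (Suc m, k)"
        "levy_value G (Suc m) (2 * k) = u" "levy_value G (Suc m) (Suc (2 * k + 1)) = v"
        by (simp_all add: u_def v_def c_def)
      then show "\<theta>' (2 * k) \<bullet> (levy_value G (Suc m) (Suc (2 * k)) - levy_value G (Suc m) (2 * k)) +
          \<theta>' (2 * k + 1) \<bullet> (levy_value G (Suc m) (Suc (2 * k + 1)) - levy_value G (Suc m) (2 * k + 1)) =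
          b k \<bullet> (levy_value G m (Suc k) - levy_value G m k) + e k \<bullet> G (Suc m, k)"
        unfolding u_def[symmetric] v_def[symmetric] b_def e_def
        by (simp add: inner_add_left inner_add_right inner_diff_left inner_diff_right algebra_simps
            del: levy_value.simps)
    qed
    also have "\<dots> = (\<Sum>j\<in>J'. a' j \<bullet> G j)"
      by (simp only: split[of "\<lambda>j x. x \<bullet> G j"] sum.distrib J(3))
    finally show ?thesis .
  qed
  moreover have "(\<Sum>j\<in>J'. q (a' j)) = (1/2) ^ Suc m * (\<Sum>k<N. q (\<theta> k))"
  proof -
    have "(\<Sum>j\<in>J'. q (a' j)) = (\<Sum>k<N. (1/2) ^ m * q (b k) + q (e k))"
      by (simp only: split[of "\<lambda>_. q"] J(4) sum.distrib sum_distrib_left)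
    also have "\<dots> = (\<Sum>k<N. (1/2) ^ Suc m * (q (\<theta>' (2 * k)) + q (\<theta>' (2 * k + 1))))"
    proof (rule sum.cong[OF refl])
      fix k
      have qb: "q (b k) = 1/4 * q (\<theta>' (2 * k) + \<theta>' (2 * k + 1))"
        unfolding q_def b_def quadratic_form_scaleR by (simp add: power2_eq_square)
      have qe: "q (e k) = c\<^sup>2 * q (\<theta>' (2 * k) - \<theta>' (2 * k + 1))"
        unfolding q_def e_def quadratic_form_scaleR ..
      have "(1/2) ^ m * q (b k) + q (e k) = (1/2) ^ m * (1/4) *
          (q (\<theta>' (2 * k) + \<theta>' (2 * k + 1)) + q (\<theta>' (2 * k) - \<theta>' (2 * k + 1)))"
        unfolding qb qe c2 by (simp add: algebra_simps)
      also have "\<dots> = (1/2) ^ m * (1/4) * (2 * q (\<theta>' (2 * k)) + 2 * q (\<theta>' (2 * k + 1)))"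
        unfolding q_def quadratic_form_parallelogram ..
      finally show "(1/2) ^ m * q (b k) + q (e k) = (1/2) ^ Suc m * (q (\<theta>' (2 * k)) + q (\<theta>' (2 * k + 1)))"
        by (simp add: algebra_simps)
    qed
    also have "\<dots> = (1/2) ^ Suc m * (\<Sum>k<2 * N. q (\<theta>' k))"
      by (simp only: pairs sum_distrib_left)
    also have "(\<Sum>k<2 * N. q (\<theta>' k)) = (\<Sum>k<N. q (\<theta> k))"
      by (rule extend[symmetric]) (simp add: q_def)
    finally show ?thesis .
  qed
  moreover have "finite J'" "J' \<subseteq> {..Suc m} \<times> UNIV" using J(1,2) by (auto simp: J'_def)
  ultimately show ?case by blast
qed

text \<open>An increment over a union of grid intervals is a sum of increments over single intervals, which
  reduces the joint law of increments between any grid points to that of neighbouring ones.\<close>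

lemma grid_increments_refine:
  fixes q :: "'v::real_inner \<Rightarrow> real"
  assumes "mono_on {..K} \<kappa>"
  shows "\<exists>\<theta>'. (\<forall>D. (\<Sum>i<K. \<theta> i \<bullet> (D (\<kappa> (Suc i)) - D (\<kappa> i))) = (\<Sum>j<\<kappa> K. \<theta>' j \<bullet> (D (Suc j) - D j))) \<and>
    (\<Sum>j<\<kappa> K. q (\<theta>' j)) = real (\<kappa> 0) * q 0 + (\<Sum>i<K. real (\<kappa> (Suc i) - \<kappa> i) * q (\<theta> i))"
  using assms
proof (induction K)
  case 0
  show ?case by (rule exI[of _ "\<lambda>_. 0"]) auto
next
  case (Suc K)
  have le: "\<kappa> K \<le> \<kappa> (Suc K)" using Suc.prems by (auto simp: mono_on_def)
  have "mono_on {..K} \<kappa>" using Suc.prems by (auto simp: mono_on_def)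
  then obtain \<theta>' where *: "\<And>D. (\<Sum>i<K. \<theta> i \<bullet> (D (\<kappa> (Suc i)) - D (\<kappa> i))) = (\<Sum>j<\<kappa> K. \<theta>' j \<bullet> (D (Suc j) - D j))"
    "(\<Sum>j<\<kappa> K. q (\<theta>' j)) = real (\<kappa> 0) * q 0 + (\<Sum>i<K. real (\<kappa> (Suc i) - \<kappa> i) * q (\<theta> i))"
    using Suc.IH by blast
  define \<eta> where "\<eta> j = (if j < \<kappa> K then \<theta>' j else \<theta> K)" for j
  have split: "(\<Sum>j<\<kappa> (Suc K). f j (\<eta> j)) = (\<Sum>j<\<kappa> K. f j (\<theta>' j)) + (\<Sum>j=\<kappa> K..<\<kappa> (Suc K). f j (\<theta> K))"
    for f :: "nat \<Rightarrow> 'v \<Rightarrow> real"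
  proof -
    have "(\<Sum>j<\<kappa> (Suc K). f j (\<eta> j)) = (\<Sum>j<\<kappa> K. f j (\<eta> j)) + (\<Sum>j=\<kappa> K..<\<kappa> (Suc K). f j (\<eta> j))"
      using le by (metis sum.atLeastLessThan_concat lessThan_atLeast0 zero_le)
    then show ?thesis by (simp add: \<eta>_def)
  qed
  have "(\<Sum>j=\<kappa> K..<\<kappa> (Suc K). \<theta> K \<bullet> (D (Suc j) - D j)) = \<theta> K \<bullet> (D (\<kappa> (Suc K)) - D (\<kappa> K))" for D
    unfolding inner_sum_right[symmetric] by (simp only: sum_Suc_diff'[OF le])
  then have "(\<Sum>i<Suc K. \<theta> i \<bullet> (D (\<kappa> (Suc i)) - D (\<kappa> i))) = (\<Sum>j<\<kappa> (Suc K). \<eta> j \<bullet> (D (Suc j) - D j))" for D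
    by (simp only: split[of "\<lambda>j x. x \<bullet> (D (Suc j) - D j)"] * sum.lessThan_Suc)
  moreover have "(\<Sum>j<\<kappa> (Suc K). q (\<eta> j)) = real (\<kappa> 0) * q 0 + (\<Sum>i<Suc K. real (\<kappa> (Suc i) - \<kappa> i) * q (\<theta> i))"
    by (simp add: split[of "\<lambda>_. q"] *)
  ultimately show ?case by blast
qed

lemma summable_dist_imp_Cauchy:
  fixes F :: "nat \<Rightarrow> 'b::metric_space"
  assumes "summable (\<lambda>m. dist (F (Suc m)) (F m))"
  shows "Cauchy F"
proof -
  have le: "dist (F n) (F (n + k)) \<le> (\<Sum>i=n..<n + k. dist (F (Suc i)) (F i))" for n k
  proof (induction k)
    case (Suc k)
    have "dist (F n) (F (n + Suc k)) \<le> dist (F n) (F (n + k)) + dist (F (Suc (n + k))) (F (n + k))"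
      using dist_triangle[of "F n" "F (n + Suc k)" "F (n + k)"] by (simp add: dist_commute)
    then show ?case using Suc by simp
  qed simp
  show ?thesis
  proof (rule CauchyI')
    fix e :: real assume "0 < e"
    then obtain N where N: "\<And>m n. m \<ge> N \<Longrightarrow> norm (\<Sum>i=m..<n. dist (F (Suc i)) (F i)) < e"
      using assms unfolding summable_Cauchy by blast
    have "dist (F m) (F n) < e" if "m \<ge> N" "n > m" for m n
    proof -
      have "dist (F m) (F n) \<le> (\<Sum>i=m..<n. dist (F (Suc i)) (F i))"
        using le[of m "n - m"] that by simp
      also have "\<dots> < e" using N[OF that(1), of n] by simp
      finally show ?thesis .
    qed
    then show "\<exists>M. \<forall>m\<ge>M. \<forall>n>m. dist (F m) (F n) < e" by blast
  qed
qed

lemma measurable_path_at_all [measurable (raw)]: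
  fixes B :: "'a \<Rightarrow> 'b::real_normed_vector path"
  assumes "B \<in> borel_measurable M"
  shows "(\<lambda>\<omega>. path_at (B \<omega>) t) \<in> borel_measurable M"
proof (cases "0 \<le> t")
  case True
  show ?thesis by (rule measurable_compose[OF assms measurable_path_at[OF True]])
next
  case False
  then have "path_at f t = undefined" for f :: "'b path"
    using path_at[of f] by (auto simp: extensional_def)
  then show ?thesis by simp
qed

text \<open>The normality of the increments and their independence can both be read off from their joint
  characteristic function.\<close>

lemma brownian_motionI_char:
  fixes S :: "real^'d^'d" and B :: "'a \<Rightarrow> (real^'d) path"
  assumes P: "prob_space P" and B [measurable]: "B \<in> borel_measurable P"
    and S: "transpose S = S" "\<And>v. v \<noteq> 0 \<Longrightarrow> 0 < v \<bullet> (S *v v)"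
    and B0: "AE \<omega> in P. path_at (B \<omega>) 0 = 0"
    and char: "\<And>t K \<theta>. 0 \<le> t 0 \<Longrightarrow> mono_on {..K} t \<Longrightarrow>
      (CLINT \<omega>|P. iexp (\<Sum>i<K. \<theta> i \<bullet> (path_at (B \<omega>) (t (Suc i)) - path_at (B \<omega>) (t i)))) =
      complex_of_real (exp (- (\<Sum>i<K. (t (Suc i) - t i) * (\<theta> i \<bullet> (S *v \<theta> i))) / 2))"
  shows "brownian_motion P S B"
proof -
  interpret P: prob_space P by fact
  have single: "(CLINT \<omega>|P. iexp (\<theta> \<bullet> (path_at (B \<omega>) t - path_at (B \<omega>) s))) =
      complex_of_real (exp (- ((t - s) * (\<theta> \<bullet> (S *v \<theta>))) / 2))" if "0 \<le> s" "s \<le> t" for s t \<theta>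
    using char[of "\<lambda>i. if i = 0 then s else t" 1 "\<lambda>_. \<theta>"] that by (simp add: mono_on_def)
  have "P.indep_vars (\<lambda>_. borel) (\<lambda>i \<omega>. path_at (B \<omega>) (t (Suc i)) - path_at (B \<omega>) (t i)) {..<K}"
    if t: "0 \<le> t 0" "mono_on {..K} t" for t :: "nat \<Rightarrow> real" and K
  proof (rule P.indep_vars_if_char_factorizes)
    fix \<theta> :: "nat \<Rightarrow> real^'d"
    have "(CLINT \<omega>|P. iexp (\<Sum>i<K. \<theta> i \<bullet> (path_at (B \<omega>) (t (Suc i)) - path_at (B \<omega>) (t i)))) =
        complex_of_real (exp (\<Sum>i<K. - ((t (Suc i) - t i) * (\<theta> i \<bullet> (S *v \<theta> i))) / 2))"
      unfolding char[OF t] by (simp add: sum_divide_distrib sum_negf)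
    also have "\<dots> = (\<Prod>i<K. complex_of_real (exp (- ((t (Suc i) - t i) * (\<theta> i \<bullet> (S *v \<theta> i))) / 2)))"
      by (simp add: exp_sum)
    also have "\<dots> = (\<Prod>i<K. CLINT \<omega>|P. iexp (\<theta> i \<bullet> (path_at (B \<omega>) (t (Suc i)) - path_at (B \<omega>) (t i))))"
    proof (rule prod.cong[OF refl])
      fix i assume i: "i \<in> {..<K}"
      have "t 0 \<le> t i" "t i \<le> t (Suc i)" using t(2) i by (auto simp: mono_on_def)
      then show "complex_of_real (exp (- ((t (Suc i) - t i) * (\<theta> i \<bullet> (S *v \<theta> i))) / 2)) =
          (CLINT \<omega>|P. iexp (\<theta> i \<bullet> (path_at (B \<omega>) (t (Suc i)) - path_at (B \<omega>) (t i))))"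
        using single[of "t i" "t (Suc i)" "\<theta> i"] t(1) by simp
    qed
    finally show "(CLINT \<omega>|P. iexp (\<Sum>i<K. \<theta> i \<bullet> (path_at (B \<omega>) (t (Suc i)) - path_at (B \<omega>) (t i)))) =
        (\<Prod>i<K. CLINT \<omega>|P. iexp (\<theta> i \<bullet> (path_at (B \<omega>) (t (Suc i)) - path_at (B \<omega>) (t i))))" .
  qed auto
  moreover have "distributed P lborel (\<lambda>\<omega>. v \<bullet> (path_at (B \<omega>) t - path_at (B \<omega>) s))
      (normal_density 0 (sqrt ((t - s) * (v \<bullet> (S *v v)))))" if st: "0 \<le> s" "s < t" and v: "v \<noteq> 0" for s t v
  proof -
    have pos: "0 < (t - s) * (v \<bullet> (S *v v))" using st S(2)[OF v] by simp
    show ?thesis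
    proof (subst P.normal_distributed_iff_char)
      show "\<forall>u. (CLINT \<omega>|P. iexp (u * (v \<bullet> (path_at (B \<omega>) t - path_at (B \<omega>) s)))) =
          complex_of_real (exp (- (sqrt ((t - s) * (v \<bullet> (S *v v))) * u)\<^sup>2 / 2))"
      proof
        fix u
        have "(CLINT \<omega>|P. iexp (u * (v \<bullet> (path_at (B \<omega>) t - path_at (B \<omega>) s)))) =
            (CLINT \<omega>|P. iexp ((u *\<^sub>R v) \<bullet> (path_at (B \<omega>) t - path_at (B \<omega>) s)))" by simp
        also have "\<dots> = complex_of_real (exp (- ((t - s) * ((u *\<^sub>R v) \<bullet> (S *v (u *\<^sub>R v)))) / 2))"
          by (rule single) (use st in auto)
        also have "- ((t - s) * ((u *\<^sub>R v) \<bullet> (S *v (u *\<^sub>R v)))) / 2 = - (sqrt ((t - s) * (v \<bullet> (S *v v))) * u)\<^sup>2 / 2"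
          unfolding quadratic_form_scaleR using pos by (simp add: power_mult_distrib)
        finally show "(CLINT \<omega>|P. iexp (u * (v \<bullet> (path_at (B \<omega>) t - path_at (B \<omega>) s)))) =
          complex_of_real (exp (- (sqrt ((t - s) * (v \<bullet> (S *v v))) * u)\<^sup>2 / 2))" .
      qed
    qed (use pos in auto)
  qed
  ultimately show ?thesis
    unfolding brownian_motion_def using P B S B0 by blast
qed

text \<open>The increments of level \<open>m\<close> are Gaussian with variance of order \<open>2^(-m)\<close>, so their fourth moments
  are of order \<open>4^(-m)\<close>, and chaining makes the dyadic interpolations almost surely a Cauchy sequence.
  The joint characteristic function of the increments is known at dyadic times and extends to all
  times by continuity of the limiting path.\<close>

theorem brownian_motion_exists:
  fixes S :: "real^'d^'d" and \<nu> :: "(real^'d) measure"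
  assumes S: "transpose S = S" "\<And>v. v \<noteq> 0 \<Longrightarrow> 0 < v \<bullet> (S *v v)"
    and \<nu>: "prob_space \<nu>" "sets \<nu> = sets borel"
    and \<nu>_char: "\<And>\<theta>. (CLINT x|\<nu>. iexp (\<theta> \<bullet> x)) = complex_of_real (exp (- (\<theta> \<bullet> (S *v \<theta>)) / 2))"
  shows "\<exists>P :: (real^'d) path measure. \<exists>B. brownian_motion P S B"
proof -
  define q where "q x = x \<bullet> (S *v x)" for x
  define \<Omega> where "\<Omega> = PiM (UNIV :: (nat \<times> nat) set) (\<lambda>_. \<nu>)"
  interpret \<Omega>: product_prob_space "\<lambda>_ :: nat \<times> nat. \<nu>" UNIV
    by (rule product_prob_spaceI) (rule \<nu>)
  have P\<Omega>: "prob_space \<Omega>" unfolding \<Omega>_def by (rule \<Omega>.P.prob_space_axioms)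
  interpret P: prob_space \<Omega> by (rule P\<Omega>)
  note \<nu>(2)[measurable_cong]
  have G_meas: "(\<lambda>G. G j) \<in> borel_measurable \<Omega>" for j
    unfolding \<Omega>_def by measurable
  have V_meas [measurable]: "(\<lambda>G. levy_value G m k) \<in> borel_measurable \<Omega>" for m k
  proof (induction m arbitrary: k)
    case 0
    show ?case unfolding levy_value.simps by (intro borel_measurable_sum G_meas)
  next
    case (Suc m)
    show ?case
    proof (cases "even k")
      case True
      then show ?thesis unfolding levy_value.simps by (simp only: if_True Suc)
    next
      case False
      show ?thesis
        unfolding levy_value.simps if_not_P[OF False]
        by (intro borel_measurable_add borel_measurable_scaleR borel_measurable_const Suc G_meas)
    qed
  qed
  have char_linear: "(CLINT G|\<Omega>. iexp (\<Sum>j\<in>J. a j \<bullet> G j)) = complex_of_real (exp (- (\<Sum>j\<in>J. q (a j)) / 2))"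
    if J: "finite J" for J a
  proof -
    have m: "(\<lambda>x. iexp (a j \<bullet> x)) \<in> borel_measurable \<nu>" for j by measurable
    have int: "integrable \<nu> (\<lambda>x. iexp (a j \<bullet> x))" for j
      by (rule prob_space.integrable_iexp[OF \<nu>(1)]) auto
    have "(CLINT G|\<Omega>. iexp (\<Sum>j\<in>J. a j \<bullet> G j)) = (CLINT G|\<Omega>. (\<Prod>j\<in>J. iexp (a j \<bullet> restrict G J j)))"
      by (simp add: exp_sum[OF J] sum_distrib_left)
    also have "\<dots> = (CLINT G|distr \<Omega> (PiM J (\<lambda>_. \<nu>)) (\<lambda>G. restrict G J). (\<Prod>j\<in>J. iexp (a j \<bullet> G j)))"
      unfolding \<Omega>_def
    proof (rule integral_distr[symmetric])
      show "(\<lambda>G. restrict G J) \<in> measurable (PiM UNIV (\<lambda>_. \<nu>)) (PiM J (\<lambda>_. \<nu>))"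
        by (rule measurable_restrict_subset) simp
      show "(\<lambda>G. \<Prod>j\<in>J. iexp (a j \<bullet> G j)) \<in> borel_measurable (PiM J (\<lambda>_. \<nu>))"
      proof (rule borel_measurable_prod)
        fix j assume "j \<in> J"
        then have "(\<lambda>G. G j) \<in> measurable (PiM J (\<lambda>_. \<nu>)) \<nu>" by (rule measurable_component_singleton)
        then show "(\<lambda>G. iexp (a j \<bullet> G j)) \<in> borel_measurable (PiM J (\<lambda>_. \<nu>))" by (rule measurable_compose[OF _ m])
      qed
    qed
    also have "distr \<Omega> (PiM J (\<lambda>_. \<nu>)) (\<lambda>G. restrict G J) = PiM J (\<lambda>_. \<nu>)"
      unfolding \<Omega>_def by (rule \<Omega>.distr_PiM_restrict_finite[OF J]) simp
    also have "(CLINT G|PiM J (\<lambda>_. \<nu>). (\<Prod>j\<in>J. iexp (a j \<bullet> G j))) = (\<Prod>j\<in>J. CLINT x|\<nu>. iexp (a j \<bullet> x))"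
      by (rule \<Omega>.product_integral_prod[OF J int])
    also have "\<dots> = complex_of_real (exp (- (\<Sum>j\<in>J. q (a j)) / 2))"
      unfolding \<nu>_char q_def[symmetric]
      by (simp add: exp_sum[OF J] sum_divide_distrib flip: of_real_prod sum_negf)
    finally show ?thesis .
  qed
  have char_level: "(CLINT G|\<Omega>. iexp (\<Sum>k<N. \<theta> k \<bullet> (levy_value G m (Suc k) - levy_value G m k))) =
      complex_of_real (exp (- ((1/2) ^ m * (\<Sum>k<N. q (\<theta> k))) / 2))" for N m \<theta>
  proof -
    obtain J a where J: "finite J"
      "\<And>G. (\<Sum>k<N. \<theta> k \<bullet> (levy_value G m (Suc k) - levy_value G m k)) = (\<Sum>j\<in>J. a j \<bullet> G j)"
      "(\<Sum>j\<in>J. q (a j)) = (1/2) ^ m * (\<Sum>k<N. q (\<theta> k))"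
      using levy_increments_linear_form[where S = S and N = N and \<theta> = \<theta> and m = m] unfolding q_def by blast
    show ?thesis unfolding J(2) char_linear[OF J(1)] J(3) ..
  qed
  define c where "c = real CARD('d) ^ 4 * (\<Sum>i\<in>UNIV. 3 * q (axis i 1) ^ 2)"
  have mom: "integrable \<Omega> (\<lambda>G. norm (levy_value G m (Suc k) - levy_value G m k) ^ 4)"
    "P.expectation (\<lambda>G. norm (levy_value G m (Suc k) - levy_value G m k) ^ 4) \<le> c / 4 ^ m" for m k
  proof -
    let ?D = "\<lambda>G :: nat \<times> nat \<Rightarrow> real^'d. levy_value G m (Suc k) - levy_value G m k"
    have coord: "integrable \<Omega> (\<lambda>G. (?D G $ i) ^ 4) \<and> P.expectation (\<lambda>G. (?D G $ i) ^ 4) = 3 * q (axis i 1) ^ 2 / 4 ^ m" for i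
    proof -
      define \<sigma> where "\<sigma> = sqrt ((1/2) ^ m * q (axis i 1))"
      have qpos: "0 < q (axis i 1)" unfolding q_def by (rule S(2)) (simp add: axis_eq_0_iff)
      have \<sigma>: "0 < \<sigma>" using qpos by (simp add: \<sigma>_def)
      have "distributed \<Omega> lborel (\<lambda>G. ?D G $ i) (normal_density 0 \<sigma>)"
      proof (subst P.normal_distributed_iff_char[OF _ \<sigma>])
        show "\<forall>t. (CLINT G|\<Omega>. iexp (t * ?D G $ i)) = complex_of_real (exp (- (\<sigma> * t)\<^sup>2 / 2))"
        proof
          fix t
          define \<theta> where "\<theta> j = (if j = k then t *\<^sub>R axis i 1 else 0 :: real^'d)" for j
          have 1: "(\<Sum>j<Suc k. \<theta> j \<bullet> (levy_value G m (Suc j) - levy_value G m j)) = t * ?D G $ i" for G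
            by (simp add: \<theta>_def inner_axis')
          have "q (\<theta> k) = t\<^sup>2 * q (axis i 1)"
            unfolding \<theta>_def q_def by (simp only: quadratic_form_scaleR if_True simp_thms)
          then have 2: "(\<Sum>j<Suc k. q (\<theta> j)) = t\<^sup>2 * q (axis i 1)"
            by (simp add: \<theta>_def q_def)
          have "(CLINT G|\<Omega>. iexp (t * ?D G $ i)) = complex_of_real (exp (- ((1/2) ^ m * (t\<^sup>2 * q (axis i 1))) / 2))"
            using char_level[of \<theta> m "Suc k"] unfolding 1 2 .
          also have "(1/2) ^ m * (t\<^sup>2 * q (axis i 1)) = (\<sigma> * t)\<^sup>2"
            using qpos by (simp add: \<sigma>_def power_mult_distrib)
          finally show "(CLINT G|\<Omega>. iexp (t * ?D G $ i)) = complex_of_real (exp (- (\<sigma> * t)\<^sup>2 / 2))" .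
        qed
      qed auto
      from P.normal_fourth_moment[OF this \<sigma>]
      have "integrable \<Omega> (\<lambda>G. (?D G $ i) ^ 4)" "P.expectation (\<lambda>G. (?D G $ i) ^ 4) = 3 * \<sigma> ^ 4" by auto
      moreover have "\<sigma> ^ 4 = ((1/2) ^ m * q (axis i 1))\<^sup>2"
      proof -
        have "\<sigma> ^ 4 = (\<sigma>\<^sup>2)\<^sup>2" by simp
        also have "\<sigma>\<^sup>2 = (1/2) ^ m * q (axis i 1)" unfolding \<sigma>_def using qpos by simp
        finally show ?thesis .
      qed
      moreover have "((1/2::real) ^ m)\<^sup>2 = 1 / 4 ^ m"
        by (simp add: power_divide power_mult[symmetric] mult.commute[of m]) (simp add: power_mult)
      ultimately show ?thesis by (simp add: power_mult_distrib)
    qed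
    have D_meas: "?D \<in> borel_measurable \<Omega>" by measurable
    have le: "P.expectation (\<lambda>G. (?D G $ i) ^ 4) \<le> 3 * q (axis i 1) ^ 2 / 4 ^ m" for i
      using coord[of i] by simp
    show "integrable \<Omega> (\<lambda>G. norm (?D G) ^ 4)"
      by (rule P.norm_fourth_moment_le(1)[OF D_meas _ le]) (use coord in blast)
    have "P.expectation (\<lambda>G. norm (?D G) ^ 4) \<le> real CARD('d) ^ 4 * (\<Sum>i\<in>UNIV. 3 * q (axis i 1) ^ 2 / 4 ^ m)"
      by (rule P.norm_fourth_moment_le(2)[OF D_meas _ le]) (use coord in blast)
    also have "\<dots> = c / 4 ^ m" by (simp add: c_def) (simp add: sum_divide_distrib[symmetric])
    finally show "P.expectation (\<lambda>G. norm (?D G) ^ 4) \<le> c / 4 ^ m" .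
  qed
  define I where "I m G = dyadic_interp m (levy_value G m)" for m and G :: "nat \<times> nat \<Rightarrow> real^'d"
  have I_meas [measurable]: "I m \<in> borel_measurable \<Omega>" for m
    unfolding I_def[abs_def] by (rule measurable_dyadic_interp) measurable
  define d where "d m G = dist (I (Suc m) G) (I m G)" for m G
  have d_meas [measurable]: "d m \<in> borel_measurable \<Omega>" for m
    unfolding d_def[abs_def] by measurable
  have d_int: "integrable \<Omega> (d m)" and d_le: "P.expectation (d m) \<le> (2 + 3 * c) * (9/10) ^ m" for m
    unfolding d_def I_def
    by (rule P.expectation_dist_dyadic_interp_Suc_le[OF V_meas V_meas]; (rule mom | simp))+
  have c_nonneg: "0 \<le> c" unfolding c_def by (intro mult_nonneg_nonneg sum_nonneg) auto
  \<comment> \<open>The bounds on the expected distances are summable, so the distances are almost surely summable.\<close>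
  have "AE G in \<Omega>. (\<Sum>m. ennreal (d m G)) \<noteq> \<infinity>"
  proof (rule nn_integral_PInf_AE)
    have "(\<integral>\<^sup>+ G. (\<Sum>m. ennreal (d m G)) \<partial>\<Omega>) = (\<Sum>m. \<integral>\<^sup>+ G. ennreal (d m G) \<partial>\<Omega>)"
      by (rule nn_integral_suminf) measurable
    also have "\<dots> = (\<Sum>m. ennreal (P.expectation (d m)))"
      by (intro suminf_cong nn_integral_eq_integral d_int) (simp add: d_def)
    also have "\<dots> \<le> (\<Sum>m. ennreal ((2 + 3 * c) * (9/10) ^ m))"
      by (intro suminf_le ennreal_leI d_le) auto
    also have "\<dots> = ennreal (\<Sum>m. (2 + 3 * c) * (9/10) ^ m)"
      using c_nonneg by (intro suminf_ennreal2 summable_mult summable_geometric) auto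
    also have "\<dots> < \<infinity>" by simp
    finally show "(\<integral>\<^sup>+ G. (\<Sum>m. ennreal (d m G)) \<partial>\<Omega>) \<noteq> \<infinity>" by simp
  qed measurable
  define good where "good G \<longleftrightarrow> (\<Sum>m. ennreal (d m G)) \<noteq> \<infinity>" for G
  have AE_good: "AE G in \<Omega>. good G" unfolding good_def by fact
  have good_meas [measurable]: "Measurable.pred \<Omega> good" unfolding good_def[abs_def] by measurable
  have conv: "\<exists>f. (\<lambda>m. I m G) \<longlonglongrightarrow> f" if "good G" for G
  proof (rule path_Cauchy_convergent, rule summable_dist_imp_Cauchy)
    show "summable (\<lambda>m. dist (I (Suc m) G) (I m G))"
      using that unfolding good_def d_def by (intro summable_suminf_not_top) (auto simp: top_ennreal_def)
  qed
  \<comment> \<open>The constant path \<open>z\<close> is the value on the null set where the interpolations may diverge.\<close>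
  define z where "z = dyadic_interp 0 (\<lambda>_. 0 :: real^'d)"
  define B where "B G = (if good G then lim (\<lambda>m. I m G) else z)" for G
  have B_lim: "(\<lambda>m. I m G) \<longlonglongrightarrow> B G" if "good G" for G
    using conv[OF that] that by (auto simp: B_def dest: limI)
  have B_meas [measurable]: "B \<in> borel_measurable \<Omega>"
  proof (rule borel_measurable_LIMSEQ_metric)
    show "(\<lambda>G. if good G then I m G else z) \<in> borel_measurable \<Omega>" for m by measurable
    show "(\<lambda>m. if good G then I m G else z) \<longlonglongrightarrow> B G" for G
      using B_lim[of G] by (cases "good G") (auto simp: B_def)
  qed
  have B_dyadic: "path_at (B G) (real k / 2 ^ m) = levy_value G m k" if "good G" for G k m
  proof (rule LIMSEQ_unique)
    show "(\<lambda>n. path_at (I n G) (real k / 2 ^ m)) \<longlonglongrightarrow> path_at (B G) (real k / 2 ^ m)"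
      by (rule tendsto_path_at[OF B_lim[OF that]]) simp
    have "path_at (I n G) (real k / 2 ^ m) = levy_value G m k" if n: "n \<ge> m + k" for n
    proof -
      obtain j where j: "n = m + j" using n by (metis add.assoc le_iff_add)
      have "real k / 2 ^ m \<le> real k" by (simp add: divide_le_eq mult_le_cancel_left1)
      then have "real k / 2 ^ m \<le> real n" using n by linarith
      then have "path_at (I n G) (real k / 2 ^ m) = lerp (levy_value G n) (2 ^ n * (real k / 2 ^ m))"
        unfolding I_def by (intro path_at_dyadic_interp_uncapped) auto
      also have "2 ^ n * (real k / 2 ^ m) = real (2 ^ j * k)" by (simp add: j power_add)
      also have "lerp (levy_value G n) \<dots> = levy_value G m k"
        unfolding lerp_of_nat unfolding j by (rule levy_value_refine)
      finally show ?thesis .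
    qed
    then have "\<forall>\<^sub>F n in sequentially. path_at (I n G) (real k / 2 ^ m) = levy_value G m k"
      unfolding eventually_sequentially by blast
    then show "(\<lambda>n. path_at (I n G) (real k / 2 ^ m)) \<longlonglongrightarrow> levy_value G m k" by (rule tendsto_eventually)
  qed
  have B0: "AE G in \<Omega>. path_at (B G) 0 = 0"
    using AE_good by eventually_elim (use B_dyadic[of _ 0 0] in \<open>simp add: levy_value_at_0\<close>)
  have char_B: "(CLINT G|\<Omega>. iexp (\<Sum>i<K. \<theta> i \<bullet> (path_at (B G) (t (Suc i)) - path_at (B G) (t i)))) =
        complex_of_real (exp (- (\<Sum>i<K. (t (Suc i) - t i) * (\<theta> i \<bullet> (S *v \<theta> i))) / 2))"
    if t: "0 \<le> t 0" "mono_on {..K} t" for t :: "nat \<Rightarrow> real" and K and \<theta> :: "nat \<Rightarrow> real^'d"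
  proof -
    have t_nonneg: "0 \<le> t i" if "i \<le> K" for i
    proof -
      have "t 0 \<le> t i" using t(2) that by (auto simp: mono_on_def)
      then show ?thesis using t(1) by simp
    qed
    define \<kappa> where "\<kappa> m i = nat \<lfloor>2 ^ m * t i\<rfloor>" for m i
    have \<kappa>_mono: "mono_on {..K} (\<kappa> m)" for m
      unfolding \<kappa>_def using t(2) by (auto simp: mono_on_def intro!: nat_mono floor_mono)
    have \<kappa>_lim: "(\<lambda>m. real (\<kappa> m i) / 2 ^ m) \<longlonglongrightarrow> t i" if "i \<le> K" for i
    proof (rule tendsto_sandwich)
      have b: "2 ^ m * t i - 1 \<le> real (\<kappa> m i)" "real (\<kappa> m i) \<le> 2 ^ m * t i" for m
        using t_nonneg[OF that] unfolding \<kappa>_def by (auto simp: le_floor_iff)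
      show "\<forall>\<^sub>F m in sequentially. real (\<kappa> m i) / 2 ^ m \<le> t i"
        using b(2) by (intro always_eventually allI) (simp add: divide_le_eq mult.commute)
      show "\<forall>\<^sub>F m in sequentially. t i - (1/2) ^ m \<le> real (\<kappa> m i) / 2 ^ m"
      proof (intro always_eventually allI)
        fix m
        have "t i - (1/2) ^ m = (2 ^ m * t i - 1) / 2 ^ m" by (simp add: power_one_over diff_divide_distrib)
        also have "\<dots> \<le> real (\<kappa> m i) / 2 ^ m" by (intro divide_right_mono b(1)) simp
        finally show "t i - (1/2) ^ m \<le> real (\<kappa> m i) / 2 ^ m" .
      qed
      show "(\<lambda>m. t i - (1/2) ^ m) \<longlonglongrightarrow> t i"
        using tendsto_diff[OF tendsto_const[of "t i"] LIMSEQ_power_zero[of "1/2::real"]] by simp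
    qed simp
    let ?X = "\<lambda>m G. \<Sum>i<K. \<theta> i \<bullet> (path_at (B G) (real (\<kappa> m (Suc i)) / 2 ^ m) - path_at (B G) (real (\<kappa> m i) / 2 ^ m))"
    have char_m: "(CLINT G|\<Omega>. iexp (?X m G)) =
        complex_of_real (exp (- (\<Sum>i<K. (real (\<kappa> m (Suc i)) / 2 ^ m - real (\<kappa> m i) / 2 ^ m) * q (\<theta> i)) / 2))" for m
    proof -
      obtain \<theta>' where \<theta>': "\<And>D. (\<Sum>i<K. \<theta> i \<bullet> (D (\<kappa> m (Suc i)) - D (\<kappa> m i))) = (\<Sum>j<\<kappa> m K. \<theta>' j \<bullet> (D (Suc j) - D j))"
        "(\<Sum>j<\<kappa> m K. q (\<theta>' j)) = real (\<kappa> m 0) * q 0 + (\<Sum>i<K. real (\<kappa> m (Suc i) - \<kappa> m i) * q (\<theta> i))"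
        using grid_increments_refine[OF \<kappa>_mono[of m], of \<theta> q] by blast
      have "(CLINT G|\<Omega>. iexp (?X m G)) = (CLINT G|\<Omega>. iexp (\<Sum>j<\<kappa> m K. \<theta>' j \<bullet> (levy_value G m (Suc j) - levy_value G m j)))"
      proof (rule integral_cong_AE)
        show "AE G in \<Omega>. iexp (?X m G) = iexp (\<Sum>j<\<kappa> m K. \<theta>' j \<bullet> (levy_value G m (Suc j) - levy_value G m j))"
          using AE_good
        proof eventually_elim
          case (elim G)
          show ?case unfolding B_dyadic[OF elim] \<theta>'(1)[of "levy_value G m"] ..
        qed
      qed measurable
      also have "\<dots> = complex_of_real (exp (- ((1/2) ^ m * (\<Sum>j<\<kappa> m K. q (\<theta>' j))) / 2))" by (rule char_level)
      also have "(1/2) ^ m * (\<Sum>j<\<kappa> m K. q (\<theta>' j)) =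
          (\<Sum>i<K. (real (\<kappa> m (Suc i)) / 2 ^ m - real (\<kappa> m i) / 2 ^ m) * q (\<theta> i))"
      proof -
        have "\<kappa> m i \<le> \<kappa> m (Suc i)" if "i < K" for i using \<kappa>_mono[of m] that by (auto simp: mono_on_def)
        then show ?thesis
          unfolding \<theta>'(2) sum_distrib_left distrib_left
          by (auto simp: q_def power_one_over field_simps of_nat_diff intro!: sum.cong)
      qed
      finally show ?thesis .
    qed
    have lim1: "(\<lambda>m. CLINT G|\<Omega>. iexp (?X m G)) \<longlonglongrightarrow>
        (CLINT G|\<Omega>. iexp (\<Sum>i<K. \<theta> i \<bullet> (path_at (B G) (t (Suc i)) - path_at (B G) (t i))))"
    proof (rule integral_dominated_convergence[where w = "\<lambda>_. 1"])
      have pl: "(\<lambda>m. path_at f (real (\<kappa> m i) / 2 ^ m)) \<longlonglongrightarrow> path_at f (t i)" if "i \<le> K" for f :: "(real^'d) path" and i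
        by (rule continuous_on_tendsto_compose[OF continuous_on_path_at \<kappa>_lim[OF that]])
          (use t_nonneg[OF that] in auto)
      show "AE G in \<Omega>. (\<lambda>m. iexp (?X m G)) \<longlonglongrightarrow> iexp (\<Sum>i<K. \<theta> i \<bullet> (path_at (B G) (t (Suc i)) - path_at (B G) (t i)))"
        by (intro always_eventually allI tendsto_intros pl) auto
      show "AE G in \<Omega>. norm (iexp (?X m G)) \<le> 1" for m by (simp only: norm_exp_i_times) simp
    qed (auto intro: P.integrable_const)
    have lim2: "(\<lambda>m. CLINT G|\<Omega>. iexp (?X m G)) \<longlonglongrightarrow>
        complex_of_real (exp (- (\<Sum>i<K. (t (Suc i) - t i) * q (\<theta> i)) / 2))"
      unfolding char_m by (intro tendsto_intros \<kappa>_lim) auto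
    show "(CLINT G|\<Omega>. iexp (\<Sum>i<K. \<theta> i \<bullet> (path_at (B G) (t (Suc i)) - path_at (B G) (t i)))) =
        complex_of_real (exp (- (\<Sum>i<K. (t (Suc i) - t i) * (\<theta> i \<bullet> (S *v \<theta> i))) / 2))"
      using LIMSEQ_unique[OF lim1 lim2] unfolding q_def .
  qed
  have "brownian_motion (distr \<Omega> borel B) S (\<lambda>f. f)"
  proof (rule brownian_motionI_char[OF P.prob_space_distr[OF B_meas] _ S])
    show "AE f in distr \<Omega> borel B. path_at f 0 = 0"
      using B0 by (subst AE_distr_iff[OF B_meas]) auto
    show "(CLINT f|distr \<Omega> borel B. iexp (\<Sum>i<K. \<theta> i \<bullet> (path_at f (t (Suc i)) - path_at f (t i)))) =
        complex_of_real (exp (- (\<Sum>i<K. (t (Suc i) - t i) * (\<theta> i \<bullet> (S *v \<theta> i))) / 2))"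
      if t: "0 \<le> t 0" "mono_on {..K} t" for t K \<theta>
    proof (subst integral_distr[OF B_meas])
      show "(\<lambda>f. iexp (\<Sum>i<K. \<theta> i \<bullet> (path_at f (t (Suc i)) - path_at f (t i)))) \<in> borel_measurable borel"
        by measurable
    qed (rule char_B[OF t])
  qed simp
  then show ?thesis by blast
qed

section \<open>Planar Gaussian laws\<close>

text \<open>The Cholesky factorization \<open>L\<close> of the covariance matrix maps a standard Gaussian vector to
  the required law; a ball is the image of a square whose mass is bounded below by the density.\<close>

lemma planar_gaussian_exists:
  fixes S :: "real^2^2"
  assumes S: "transpose S = S" "\<And>v. v \<noteq> 0 \<Longrightarrow> 0 < v \<bullet> (S *v v)"
  shows "\<exists>\<nu> c. prob_space \<nu> \<and> sets \<nu> = sets borel \<and>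
    (\<forall>\<theta>. (CLINT x|\<nu>. iexp (\<theta> \<bullet> x)) = complex_of_real (exp (- (\<theta> \<bullet> (S *v \<theta>)) / 2))) \<and>
    0 < c \<and> (\<forall>r. 0 < r \<and> r \<le> 1 \<longrightarrow> c * r\<^sup>2 \<le> measure \<nu> (cball 0 r))"
proof -
  define a where "a = S $ 1 $ 1"
  define b where "b = S $ 1 $ 2"
  define d where "d = S $ 2 $ 2"
  have "transpose S $ 1 $ 2 = S $ 2 $ 1" by (simp add: transpose_def)
  then have sym: "S $ 2 $ 1 = b" unfolding S(1) b_def ..
  have form: "x \<bullet> (S *v x) = a * (x $ 1)\<^sup>2 + 2 * b * x $ 1 * x $ 2 + d * (x $ 2)\<^sup>2" for x
  proof -
    have "x \<bullet> (S *v x) = x $ 1 * (S $ 1 $ 1 * x $ 1 + S $ 1 $ 2 * x $ 2) + x $ 2 * (S $ 2 $ 1 * x $ 1 + S $ 2 $ 2 * x $ 2)"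
      unfolding inner_vec_def matrix_vector_mult_def sum_2 by simp
    also have "\<dots> = a * (x $ 1)\<^sup>2 + 2 * b * x $ 1 * x $ 2 + d * (x $ 2)\<^sup>2"
      unfolding sym a_def[symmetric] b_def[symmetric] d_def[symmetric] by (simp add: power2_eq_square algebra_simps)
    finally show ?thesis .
  qed
  have apos: "0 < a"
  proof -
    have "(vector [1, 0] :: real^2) \<noteq> 0" by (simp add: vec_eq_iff forall_2)
    from S(2)[OF this] show ?thesis unfolding form by simp
  qed
  \<comment> \<open>Positive definiteness is tested at \<open>(- b, a)\<close>, where the form takes the value \<open>a (a d - b\<^sup>2)\<close>.\<close>
  have det: "0 < a * d - b\<^sup>2"
  proof -
    have "(vector [- b, a] :: real^2) \<noteq> 0" using apos by (simp add: vec_eq_iff forall_2)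
    from S(2)[OF this] have "0 < a * (a * d - b\<^sup>2)" unfolding form
      by (simp add: power2_eq_square algebra_simps)
    then show ?thesis using apos by (simp add: zero_less_mult_iff)
  qed
  define l1 where "l1 = sqrt a"
  define l2 where "l2 = b / sqrt a"
  define l3 where "l3 = sqrt ((a * d - b\<^sup>2) / a)"
  have l: "l1\<^sup>2 = a" "l1 * l2 = b" "l2\<^sup>2 + l3\<^sup>2 = d" "0 < l1" "0 < l3"
  proof -
    have "(sqrt ((a * d - b\<^sup>2) / a))\<^sup>2 = (a * d - b\<^sup>2) / a" using apos det by (intro real_sqrt_pow2) simp
    then show "l2\<^sup>2 + l3\<^sup>2 = d"
      using apos by (simp add: l2_def l3_def power_divide diff_divide_distrib)
    show "0 < l3" unfolding l3_def using apos det by (intro real_sqrt_gt_zero divide_pos_pos)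
  qed (use apos in \<open>auto simp: l1_def l2_def\<close>)
  define N where "N = PiM (UNIV :: 2 set) (\<lambda>_. std_normal_distribution)"
  define T where "T z = (vector [l1 * z 1, l2 * z 1 + l3 * z 2] :: real^2)" for z :: "2 \<Rightarrow> real"
  have std: "prob_space std_normal_distribution" by (rule prob_space_normal_density) simp
  interpret G: product_prob_space "\<lambda>_::2. std_normal_distribution" UNIV
    by (rule product_prob_spaceI) (rule std)
  have PN: "prob_space N" unfolding N_def by (rule G.P.prob_space_axioms)
  interpret N: prob_space N by (rule PN)
  have z_meas: "(\<lambda>z. z i) \<in> borel_measurable N" for i
    unfolding N_def using measurable_component_singleton[of i UNIV "\<lambda>_. std_normal_distribution"] by simp
  have T_meas: "T \<in> borel_measurable N"
  proof -
    have "(\<lambda>z. (\<chi> i. T z $ i) :: real^2) \<in> borel_measurable N"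
    proof (rule measurable_vec_lambda)
      fix i :: 2
      show "(\<lambda>z. T z $ i) \<in> borel_measurable N"
        using exhaust_2[of i] z_meas[of 1] z_meas[of 2] by (auto simp: T_def)
    qed
    then show ?thesis by simp
  qed
  define \<nu> where "\<nu> = distr N borel T"
  have char: "(CLINT x|\<nu>. iexp (\<theta> \<bullet> x)) = complex_of_real (exp (- (\<theta> \<bullet> (S *v \<theta>)) / 2))" for \<theta>
  proof -
    define u where "u i = (if i = 1 then \<theta> $ 1 * l1 + \<theta> $ 2 * l2 else \<theta> $ 2 * l3)" for i :: 2
    have lin: "\<theta> \<bullet> T z = (\<Sum>i\<in>UNIV. u i * z i)" for z
      by (simp add: T_def u_def inner_vec_def sum_2 algebra_simps)
    have "(CLINT x|\<nu>. iexp (\<theta> \<bullet> x)) = (CLINT z|N. iexp (\<theta> \<bullet> T z))"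
      unfolding \<nu>_def by (rule integral_distr[OF T_meas]) measurable
    also have "\<dots> = (CLINT z|N. (\<Prod>i\<in>UNIV. iexp (u i * z i)))"
      unfolding lin by (simp add: exp_sum sum_distrib_left)
    also have "\<dots> = (\<Prod>i\<in>UNIV. CLINT s|std_normal_distribution. iexp (u i * s))"
      unfolding N_def
    proof (rule G.product_integral_prod)
      show "integrable std_normal_distribution (\<lambda>s. iexp (u i * s))" for i
        by (rule prob_space.integrable_iexp[OF std]) auto
    qed simp
    also have "\<dots> = (\<Prod>i\<in>UNIV. char std_normal_distribution (u i))"
      unfolding char_def ..
    also have "\<dots> = (\<Prod>i\<in>UNIV. complex_of_real (exp (- (u i)\<^sup>2 / 2)))"
      by (simp only: char_std_normal_distribution)
    also have "\<dots> = complex_of_real (exp (- (\<Sum>i\<in>UNIV. (u i)\<^sup>2) / 2))"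
      by (simp add: UNIV_2 exp_add[symmetric] field_simps flip: of_real_mult)
    also have "(\<Sum>i\<in>UNIV. (u i)\<^sup>2) = \<theta> \<bullet> (S *v \<theta>)"
    proof -
      have "(\<Sum>i\<in>UNIV. (u i)\<^sup>2) = l1\<^sup>2 * (\<theta> $ 1)\<^sup>2 + 2 * (l1 * l2) * \<theta> $ 1 * \<theta> $ 2 + (l2\<^sup>2 + l3\<^sup>2) * (\<theta> $ 2)\<^sup>2"
        by (simp add: sum_2 u_def power2_eq_square algebra_simps)
      then show ?thesis unfolding form l by simp
    qed
    finally show ?thesis .
  qed
  define A where "A = 1 + l1 + \<bar>l2\<bar> + l3"
  have A: "1 \<le> A" using l by (simp add: A_def)
  define p where "p = std_normal_density 1"
  have p: "0 < p" by (simp add: p_def normal_density_pos)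
  have mass: "2 * s * p \<le> measure std_normal_distribution {- s..s}" if s: "0 < s" "s \<le> 1" for s
  proof -
    have int: "integrable lborel (\<lambda>x. std_normal_density x * indicator {- s..s} x)"
      by (rule integrable_real_mult_indicator) auto
    have "2 * s * p = (\<integral>x. p * indicator {- s..s} x \<partial>lborel)"
      using s by simp
    also have "\<dots> \<le> (\<integral>x. std_normal_density x * indicator {- s..s} x \<partial>lborel)"
    proof (rule integral_mono[OF _ int])
      show "integrable lborel (\<lambda>x. p * indicator {- s..s} x)"
        by (intro integrable_mult_right integrable_real_indicator) (auto simp: emeasure_lborel_Icc_eq)
      fix x :: real
      show "p * indicator {- s..s} x \<le> std_normal_density x * indicator {- s..s} x"
      proof (cases "x \<in> {- s..s}")
        case True
        then have "x\<^sup>2 \<le> 1\<^sup>2" using s by (intro power2_le_iff_abs_le[THEN iffD2]) auto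
        then show ?thesis using True by (simp add: p_def std_normal_density_def divide_right_mono)
      qed simp
    qed
    also have "\<dots> = measure std_normal_distribution {- s..s}"
    proof -
      have "measure std_normal_distribution {- s..s} = (\<integral>x. indicator {- s..s} x \<partial>std_normal_distribution)" by simp
      also have "\<dots> = (\<integral>x. std_normal_density x * indicator {- s..s} x \<partial>lborel)"
        by (subst integral_density) auto
      finally show ?thesis ..
    qed
    finally show ?thesis .
  qed
  have ball: "(2 * p / A)\<^sup>2 * r\<^sup>2 \<le> measure \<nu> (cball 0 r)" if r: "0 < r" "r \<le> 1" for r
  proof -
    define s where "s = r / A"
    have s: "0 < s" "s \<le> 1" using r A by (auto simp: s_def divide_le_eq)
    have sub: "{z \<in> space N. \<forall>i\<in>UNIV. z i \<in> {- s..s}} \<subseteq> T -` cball 0 r \<inter> space N"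
    proof
      fix z assume "z \<in> {z \<in> space N. \<forall>i\<in>UNIV. z i \<in> {- s..s}}"
      then have z: "\<And>i. - s \<le> z i" "\<And>i. z i \<le> s" and zN: "z \<in> space N" by auto
      have "norm (T z) \<le> \<bar>l1 * z 1\<bar> + \<bar>l2 * z 1 + l3 * z 2\<bar>"
        using norm_le_l1_cart[of "T z"] by (simp add: T_def sum_2)
      also have "\<dots> \<le> l1 * s + (\<bar>l2\<bar> * s + l3 * s)"
      proof -
        have "\<bar>z i\<bar> \<le> s" for i using z[of i] by linarith
        then have "\<bar>l1 * z 1\<bar> \<le> l1 * s" "\<bar>l2 * z 1\<bar> \<le> \<bar>l2\<bar> * s" "\<bar>l3 * z 2\<bar> \<le> l3 * s"
          using l(4,5) by (auto simp: abs_mult intro!: mult_left_mono)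
        then show ?thesis by linarith
      qed
      also have "\<dots> \<le> A * s" using s by (simp add: A_def algebra_simps)
      also have "\<dots> = r" using A by (simp add: s_def)
      finally show "z \<in> T -` cball 0 r \<inter> space N" using zN by simp
    qed
    have "(2 * p / A)\<^sup>2 * r\<^sup>2 = (2 * s * p) * (2 * s * p)" by (simp add: s_def power2_eq_square)
    also have "\<dots> \<le> measure std_normal_distribution {- s..s} * measure std_normal_distribution {- s..s}"
      using mass[OF s] s p by (intro mult_mono) auto
    also have "\<dots> = measure N {z \<in> space N. \<forall>i\<in>UNIV. z i \<in> {- s..s}}"
    proof -
      have fin: "finite_measure std_normal_distribution" by (rule prob_space.finite_measure[OF std])
      have "emeasure N {z \<in> space N. \<forall>i\<in>UNIV. z i \<in> {- s..s}} = (\<Prod>i\<in>(UNIV::2 set). emeasure std_normal_distribution {- s..s})"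
        unfolding N_def by (rule G.emeasure_PiM_Collect) auto
      also have "\<dots> = ennreal (measure std_normal_distribution {- s..s} * measure std_normal_distribution {- s..s})"
        by (simp add: UNIV_2 finite_measure.emeasure_eq_measure[OF fin] ennreal_mult)
      finally show ?thesis by (simp add: measure_def)
    qed
    also have "\<dots> \<le> measure N (T -` cball 0 r \<inter> space N)"
      using T_meas by (intro N.finite_measure_mono sub) auto
    also have "\<dots> = measure \<nu> (cball 0 r)"
      unfolding \<nu>_def by (rule measure_distr[symmetric, OF T_meas]) simp
    finally show ?thesis .
  qed
  have "prob_space \<nu>" unfolding \<nu>_def by (rule N.prob_space_distr[OF T_meas])
  moreover have "0 < (2 * p / A)\<^sup>2" using p A by simp
  ultimately show ?thesis using char ball by (intro exI[of _ \<nu>] exI[of _ "(2 * p / A)\<^sup>2"]) (auto simp: \<nu>_def)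
qed

section \<open>Convergence in distribution from Lipschitz test functions\<close>

text \<open>The infimal convolution of \<open>f\<close> with \<open>k\<close> times the distance, which is the largest function below \<open>f\<close>
  that has Lipschitz constant \<open>k\<close>.\<close>

definition lipschitz_minorant :: "('s::metric_space \<Rightarrow> real) \<Rightarrow> nat \<Rightarrow> 's \<Rightarrow> real" where
  "lipschitz_minorant f k x = (INF y. f y + real k * dist x y)"

lemma lipschitz_minorant_bounds:
  fixes f :: "'s::metric_space \<Rightarrow> real"
  assumes B: "\<And>x. \<bar>f x\<bar> \<le> B"
  shows "lipschitz_minorant f k x \<le> f x" "\<bar>lipschitz_minorant f k x\<bar> \<le> B"
    "\<bar>lipschitz_minorant f k x - lipschitz_minorant f k y\<bar> \<le> real k * dist x y"
proof -
  have lower: "- B \<le> f y + real k * dist x y" for x y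
    using B[of y] by (smt (verit) mult_nonneg_nonneg of_nat_0_le_iff zero_le_dist)
  have bdd: "bdd_below (range (\<lambda>y. f y + real k * dist x y))" for x
    by (rule bdd_belowI2[of _ "- B"]) (rule lower)
  show le: "lipschitz_minorant f k x \<le> f x" for x
    unfolding lipschitz_minorant_def using cINF_lower[OF bdd, of x x] by simp
  have "- B \<le> lipschitz_minorant f k x"
    unfolding lipschitz_minorant_def by (rule cINF_greatest) (use lower in auto)
  then show "\<bar>lipschitz_minorant f k x\<bar> \<le> B" using le[of x] B[of x] by linarith
  have half: "lipschitz_minorant f k x - real k * dist x y \<le> lipschitz_minorant f k y" for x y
    unfolding lipschitz_minorant_def[of f k y]
  proof (rule cINF_greatest)
    fix z
    have "lipschitz_minorant f k x \<le> f z + real k * dist x z"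
      unfolding lipschitz_minorant_def by (rule cINF_lower[OF bdd]) simp
    also have "\<dots> \<le> f z + real k * (dist x y + dist y z)"
      by (intro add_left_mono mult_left_mono dist_triangle) auto
    finally show "lipschitz_minorant f k x - real k * dist x y \<le> f z + real k * dist y z"
      by (simp add: algebra_simps)
  qed simp
  show "\<bar>lipschitz_minorant f k x - lipschitz_minorant f k y\<bar> \<le> real k * dist x y"
    using half[of x y] half[of y x] by (simp add: dist_commute)
qed

text \<open>For large \<open>k\<close> the penalty \<open>k * dist x y\<close> outweighs the oscillation of \<open>f\<close> unless \<open>y\<close> is near \<open>x\<close>, where
  \<open>f\<close> is almost constant.\<close>

lemma lipschitz_minorant_tendsto:
  fixes f :: "'s::metric_space \<Rightarrow> real"
  assumes B: "\<And>x. \<bar>f x\<bar> \<le> B" and f: "continuous_on UNIV f"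
  shows "(\<lambda>k. lipschitz_minorant f k x) \<longlonglongrightarrow> f x"
proof (rule metric_LIMSEQ_I)
  fix e :: real assume e: "0 < e"
  obtain d where d: "0 < d" "\<And>y. dist y x < d \<Longrightarrow> dist (f y) (f x) < e / 2"
    using f e unfolding continuous_on_iff by (metis UNIV_I half_gt_zero)
  obtain k0 where k0: "2 * B < real k0 * d" using reals_Archimedean3[OF d(1)] by blast
  have "dist (lipschitz_minorant f k x) (f x) < e" if k: "k \<ge> k0" for k
  proof -
    have "f x - e / 2 \<le> lipschitz_minorant f k x"
      unfolding lipschitz_minorant_def
    proof (rule cINF_greatest)
      fix y
      show "f x - e / 2 \<le> f y + real k * dist x y"
      proof (cases "dist y x < d")
        case True
        then show ?thesis using d(2)[OF True]
          by (smt (verit) dist_real_def mult_nonneg_nonneg of_nat_0_le_iff zero_le_dist)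
      next
        case False
        then have "real k0 * d \<le> real k * dist x y"
          using k d(1) by (intro mult_mono) (auto simp: dist_commute)
        then show ?thesis using B[of x] B[of y] k0 e by linarith
      qed
    qed simp
    then show ?thesis using lipschitz_minorant_bounds(1)[where f = f and k = k and x = x, OF B] e by (simp add: dist_real_def)
  qed
  then show "\<exists>no. \<forall>k\<ge>no. dist (lipschitz_minorant f k x) (f x) < e" by blast
qed

text \<open>A bounded continuous function is the increasing limit of its Lipschitz minorants, which
  gives the lower bound for the limit of the expectations; the upper bound is the lower bound for
  the negated function.\<close>

lemma converges_in_distribution_if_lipschitz:
  fixes Y :: "nat \<Rightarrow> 'a \<Rightarrow> 's::metric_space"
  assumes M: "prob_space M" and P: "prob_space P"
    and Y [measurable]: "\<And>n. Y n \<in> borel_measurable M" and Z [measurable]: "Z \<in> borel_measurable P"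
    and conv: "\<And>f L B. (\<And>x. \<bar>f x\<bar> \<le> B) \<Longrightarrow> (\<And>x y. \<bar>f x - f y\<bar> \<le> L * dist x y) \<Longrightarrow>
      (\<lambda>n. \<integral>\<omega>. f (Y n \<omega>) \<partial>M) \<longlonglongrightarrow> (\<integral>\<omega>. f (Z \<omega>) \<partial>P)"
  shows "converges_in_distribution M Y P Z"
proof -
  interpret M: prob_space M by fact
  interpret P: prob_space P by fact
  have lower: "\<forall>\<^sub>F n in sequentially. (\<integral>\<omega>. f (Z \<omega>) \<partial>P) - e < (\<integral>\<omega>. f (Y n \<omega>) \<partial>M)"
    if f: "continuous_on UNIV f" and B: "\<And>x. \<bar>f x\<bar> \<le> B" and e: "0 < e" for f :: "'s \<Rightarrow> real" and B e
  proof -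
    note props = lipschitz_minorant_bounds[where f = f, OF B]
    have f_meas [measurable]: "f \<in> borel_measurable borel" by (rule borel_measurable_continuous_onI[OF f])
    have lip_cont: "continuous_on UNIV (lipschitz_minorant f k)" for k
      by (rule lipschitz_on_continuous_on[OF lipschitz_onI[of _ _ "real k"]])
        (auto simp: dist_real_def intro: props(3))
    have m_meas [measurable]: "lipschitz_minorant f k \<in> borel_measurable borel" for k
      by (rule borel_measurable_continuous_onI[OF lip_cont])
    have "(\<lambda>k. \<integral>\<omega>. lipschitz_minorant f k (Z \<omega>) \<partial>P) \<longlonglongrightarrow> (\<integral>\<omega>. f (Z \<omega>) \<partial>P)"
      by (rule integral_dominated_convergence[where w = "\<lambda>_. B"])
        (use props(2) lipschitz_minorant_tendsto[where f = f, OF B f] in auto)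
    then have "\<forall>\<^sub>F k in sequentially. (\<integral>\<omega>. f (Z \<omega>) \<partial>P) - e < (\<integral>\<omega>. lipschitz_minorant f k (Z \<omega>) \<partial>P)"
      using e by (intro order_tendstoD(1)) auto
    then obtain k where k: "(\<integral>\<omega>. f (Z \<omega>) \<partial>P) - e < (\<integral>\<omega>. lipschitz_minorant f k (Z \<omega>) \<partial>P)"
      unfolding eventually_sequentially by blast
    have "\<forall>\<^sub>F n in sequentially. (\<integral>\<omega>. f (Z \<omega>) \<partial>P) - e < (\<integral>\<omega>. lipschitz_minorant f k (Y n \<omega>) \<partial>M)"
      using order_tendstoD(1)[OF conv[OF props(2) props(3)] k] .
    then show ?thesis
    proof eventually_elim
      case (elim n)
      have "(\<integral>\<omega>. lipschitz_minorant f k (Y n \<omega>) \<partial>M) \<le> (\<integral>\<omega>. f (Y n \<omega>) \<partial>M)"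
      proof (rule integral_mono)
        show "integrable M (\<lambda>\<omega>. lipschitz_minorant f k (Y n \<omega>))"
          by (rule M.integrable_const_bound[of _ B]) (use props(2) in auto)
        show "integrable M (\<lambda>\<omega>. f (Y n \<omega>))"
          by (rule M.integrable_const_bound[of _ B]) (use B in auto)
      qed (rule props(1))
      then show ?case using elim by linarith
    qed
  qed
  have "(\<lambda>n. \<integral>\<omega>. f (Y n \<omega>) \<partial>M) \<longlonglongrightarrow> (\<integral>\<omega>. f (Z \<omega>) \<partial>P)"
    if f: "continuous_on UNIV f" "bounded (range f)" for f :: "'s \<Rightarrow> real"
  proof (rule tendstoI)
    fix e :: real assume e: "0 < e"
    obtain B where B: "\<And>x. \<bar>f x\<bar> \<le> B" using f(2) by (auto simp: bounded_iff)
    have "continuous_on UNIV (\<lambda>x. - f x)" using f(1) by (intro continuous_intros)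
    then have "\<forall>\<^sub>F n in sequentially. (\<integral>\<omega>. - f (Z \<omega>) \<partial>P) - e < (\<integral>\<omega>. - f (Y n \<omega>) \<partial>M)"
      by (rule lower[OF _ _ e]) (use B in auto)
    then show "\<forall>\<^sub>F n in sequentially. dist (\<integral>\<omega>. f (Y n \<omega>) \<partial>M) (\<integral>\<omega>. f (Z \<omega>) \<partial>P) < e"
      using lower[OF f(1) B e] by eventually_elim (simp add: dist_real_def abs_less_iff)
  qed
  then show ?thesis unfolding converges_in_distribution_def using Y Z by blast
qed

section \<open>Tightness by dyadic chaining\<close>

lemma dist_path_le_1: "dist f g \<le> (1::real)" for f g :: "'b::real_normed_vector path"
proof -
  have "dist f g \<le> (\<Sum>j. (1/2) ^ Suc j)"
    unfolding dist_path_def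
  proof (rule suminf_le[OF _ summable_dist_path sums_summable[OF sums_half_power_Suc]])
    show "(1/2) ^ Suc j * path_gap f g (real (Suc j)) \<le> (1/2::real) ^ Suc j" for j
      by (rule mult_left_le[OF path_gap_le_1]) auto
  qed
  also have "\<dots> = 1" by (rule sums_unique[symmetric, OF sums_half_power_Suc])
  finally show ?thesis .
qed

text \<open>Summing the distances of consecutive levels from \<open>m\<close> on gives a geometric series, whose sum is
  \<open>10 * (9/10)^m\<close> times the constant.\<close>

lemma (in prob_space) expectation_dist_dyadic_interp_le:
  fixes Y :: "'a \<Rightarrow> 'b::{real_normed_vector, second_countable_topology} path"
  assumes Y [measurable]: "Y \<in> borel_measurable M"
    and int: "\<And>m k. integrable M (\<lambda>\<omega>. norm (path_at (Y \<omega>) (real (Suc k) / 2 ^ m) - path_at (Y \<omega>) (real k / 2 ^ m)) ^ 4)"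
    and mom: "\<And>m k. expectation (\<lambda>\<omega>. norm (path_at (Y \<omega>) (real (Suc k) / 2 ^ m) - path_at (Y \<omega>) (real k / 2 ^ m)) ^ 4) \<le> c / 4 ^ m"
  shows "expectation (\<lambda>\<omega>. dist (dyadic_interp m (\<lambda>k. path_at (Y \<omega>) (real k / 2 ^ m))) (Y \<omega>)) \<le> 10 * (2 + 3 * c) * (9/10) ^ m"
proof -
  define I where "I j \<omega> = dyadic_interp j (\<lambda>k. path_at (Y \<omega>) (real k / 2 ^ j))" for j \<omega>
  have [measurable]: "I j \<in> borel_measurable M" for j
    unfolding I_def[abs_def] by (rule measurable_dyadic_interp) measurable
  have dint: "integrable M (\<lambda>\<omega>. dist (F \<omega>) (H \<omega>))"
    if [measurable]: "F \<in> borel_measurable M" "H \<in> borel_measurable M" for F H :: "'a \<Rightarrow> 'b path"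
    by (rule integrable_const_bound[of _ 1]) (auto simp: dist_path_le_1)
  have step: "expectation (\<lambda>\<omega>. dist (I (Suc j) \<omega>) (I j \<omega>)) \<le> (2 + 3 * c) * (9/10) ^ j" for j
    unfolding I_def
  proof (rule expectation_dist_dyadic_interp_Suc_le(2))
    show "integrable M (\<lambda>\<omega>. norm (path_at (Y \<omega>) (real (Suc k) / 2 ^ Suc j) - path_at (Y \<omega>) (real k / 2 ^ Suc j)) ^ 4)" for k
      by (rule int)
    show "expectation (\<lambda>\<omega>. norm (path_at (Y \<omega>) (real (Suc k) / 2 ^ Suc j) - path_at (Y \<omega>) (real k / 2 ^ Suc j)) ^ 4) \<le> c / 4 ^ Suc j" for k
      by (rule mom)
    show "path_at (Y \<omega>) (real k / 2 ^ j) = path_at (Y \<omega>) (real (2 * k) / 2 ^ Suc j)" for k \<omega> by simp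
  qed measurable
  have "0 \<le> 2 + 3 * c"
    using order_trans[OF integral_nonneg_AE step[of 0]] by auto
  note c = this
  have geo: "expectation (\<lambda>\<omega>. dist (I (m + n) \<omega>) (I m \<omega>)) \<le> 10 * (2 + 3 * c) * ((9/10) ^ m - (9/10) ^ (m + n))" for n
  proof (induction n)
    case (Suc n)
    have "expectation (\<lambda>\<omega>. dist (I (m + Suc n) \<omega>) (I m \<omega>))
        \<le> expectation (\<lambda>\<omega>. dist (I (Suc (m + n)) \<omega>) (I (m + n) \<omega>) + dist (I (m + n) \<omega>) (I m \<omega>))"
      by (intro integral_mono Bochner_Integration.integrable_add dint) (auto intro: dist_triangle)
    also have "\<dots> = expectation (\<lambda>\<omega>. dist (I (Suc (m + n)) \<omega>) (I (m + n) \<omega>)) + expectation (\<lambda>\<omega>. dist (I (m + n) \<omega>) (I m \<omega>))"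
      by (intro Bochner_Integration.integral_add dint) auto
    also have "\<dots> \<le> (2 + 3 * c) * (9/10) ^ (m + n) + 10 * (2 + 3 * c) * ((9/10) ^ m - (9/10) ^ (m + n))"
      by (intro add_mono step Suc)
    also have "\<dots> = 10 * (2 + 3 * c) * ((9/10) ^ m - (9/10) ^ (m + Suc n))"
      by (simp add: algebra_simps)
    finally show ?case .
  qed simp
  have bound: "expectation (\<lambda>\<omega>. dist (I m \<omega>) (Y \<omega>)) \<le> 10 * (2 + 3 * c) * (9/10) ^ m + expectation (\<lambda>\<omega>. dist (I (m + n) \<omega>) (Y \<omega>))" for n
  proof -
    have "expectation (\<lambda>\<omega>. dist (I m \<omega>) (Y \<omega>))
        \<le> expectation (\<lambda>\<omega>. dist (I (m + n) \<omega>) (I m \<omega>) + dist (I (m + n) \<omega>) (Y \<omega>))"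
      by (intro integral_mono Bochner_Integration.integrable_add dint) (auto intro: dist_triangle3)
    also have "\<dots> = expectation (\<lambda>\<omega>. dist (I (m + n) \<omega>) (I m \<omega>)) + expectation (\<lambda>\<omega>. dist (I (m + n) \<omega>) (Y \<omega>))"
      by (intro Bochner_Integration.integral_add dint) auto
    also have "expectation (\<lambda>\<omega>. dist (I (m + n) \<omega>) (I m \<omega>)) \<le> 10 * (2 + 3 * c) * (9/10) ^ m"
    proof (rule order_trans[OF geo])
      show "10 * (2 + 3 * c) * ((9/10) ^ m - (9/10) ^ (m + n)) \<le> 10 * (2 + 3 * c) * (9/10) ^ m"
        using c by (intro mult_left_mono) auto
    qed
    finally show ?thesis by simp
  qed
  have "(\<lambda>n. expectation (\<lambda>\<omega>. dist (I n \<omega>) (Y \<omega>))) \<longlonglongrightarrow> expectation (\<lambda>\<omega>. 0)"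
  proof (rule integral_dominated_convergence[where w = "\<lambda>_. 1"])
    show "AE \<omega> in M. (\<lambda>n. dist (I n \<omega>) (Y \<omega>)) \<longlonglongrightarrow> 0"
      unfolding I_def by (intro always_eventually allI tendsto_dist_iff[THEN iffD1] dyadic_interp_tendsto)
  qed (auto simp: dist_path_le_1)
  then have "(\<lambda>n. expectation (\<lambda>\<omega>. dist (I n \<omega>) (Y \<omega>))) \<longlonglongrightarrow> 0" by simp
  then have "(\<lambda>n. expectation (\<lambda>\<omega>. dist (I (n + m) \<omega>) (Y \<omega>))) \<longlonglongrightarrow> 0"
    by (rule LIMSEQ_ignore_initial_segment)
  then have "(\<lambda>n. expectation (\<lambda>\<omega>. dist (I (m + n) \<omega>) (Y \<omega>))) \<longlonglongrightarrow> 0"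
    by (simp add: add.commute)
  then have "(\<lambda>n. 10 * (2 + 3 * c) * (9/10) ^ m + expectation (\<lambda>\<omega>. dist (I (m + n) \<omega>) (Y \<omega>))) \<longlonglongrightarrow> 10 * (2 + 3 * c) * (9/10) ^ m + 0"
    by (intro tendsto_intros)
  then have "expectation (\<lambda>\<omega>. dist (I m \<omega>) (Y \<omega>)) \<le> 10 * (2 + 3 * c) * (9/10) ^ m + 0"
    by (rule LIMSEQ_le_const) (use bound in auto)
  then show ?thesis by (simp add: I_def)
qed

text \<open>The fourth moment of a sum of independent centered variables, by expanding the fourth
  power: all terms with an isolated factor vanish.\<close>

lemma (in prob_space) indep_sum_moments_le:
  fixes X :: "'i \<Rightarrow> 'a \<Rightarrow> real"
  assumes "finite I" "indep_vars (\<lambda>_. borel) X I"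
    and "\<And>i. i \<in> I \<Longrightarrow> expectation (X i) = 0"
    and "\<And>i \<omega>. i \<in> I \<Longrightarrow> \<omega> \<in> space M \<Longrightarrow> \<bar>X i \<omega>\<bar> \<le> b i"
  shows "expectation (\<lambda>\<omega>. (\<Sum>i\<in>I. X i \<omega>)) = 0"
    and "expectation (\<lambda>\<omega>. (\<Sum>i\<in>I. X i \<omega>)\<^sup>2) \<le> (\<Sum>i\<in>I. (b i)\<^sup>2)"
    and "expectation (\<lambda>\<omega>. (\<Sum>i\<in>I. X i \<omega>) ^ 4) \<le> 3 * (\<Sum>i\<in>I. (b i)\<^sup>2)\<^sup>2"
proof -
  have "expectation (\<lambda>\<omega>. (\<Sum>i\<in>I. X i \<omega>)) = 0 \<and>
    expectation (\<lambda>\<omega>. (\<Sum>i\<in>I. X i \<omega>)\<^sup>2) \<le> (\<Sum>i\<in>I. (b i)\<^sup>2) \<and>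
    expectation (\<lambda>\<omega>. (\<Sum>i\<in>I. X i \<omega>) ^ 4) \<le> 3 * (\<Sum>i\<in>I. (b i)\<^sup>2)\<^sup>2"
    using assms
  proof (induction I)
    case (insert x F)
    define A where "A \<omega> = (\<Sum>i\<in>F. X i \<omega>)" for \<omega>
    define B where "B = (\<Sum>i\<in>F. (b i)\<^sup>2)"
    have ind: "indep_var borel (X x) borel A"
      unfolding A_def[abs_def] using insert.hyps insert.prems(1) by (rule indep_vars_sum)
    have meas [measurable]: "X i \<in> borel_measurable M" if "i \<in> insert x F" for i
      using insert.prems(1) that by (auto simp: indep_vars_def)
    have A_meas [measurable]: "A \<in> borel_measurable M" using ind by (rule indep_var_rv2)
    have X_meas [measurable]: "X x \<in> borel_measurable M" using ind by (rule indep_var_rv1)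
    have A_bd: "\<bar>A \<omega>\<bar> \<le> (\<Sum>i\<in>F. b i)" if "\<omega> \<in> space M" for \<omega>
      unfolding A_def using insert.prems(3) that by (intro sum_abs[THEN order_trans] sum_mono) auto
    have X_bd: "\<bar>X x \<omega>\<bar> \<le> b x" if "\<omega> \<in> space M" for \<omega> using insert.prems(3) that by auto
    have int: "integrable M (\<lambda>\<omega>. A \<omega> ^ j * X x \<omega> ^ k)" for j k
    proof (rule integrable_const_bound[of _ "(\<Sum>i\<in>F. b i) ^ j * b x ^ k"])
      show "AE \<omega> in M. norm (A \<omega> ^ j * X x \<omega> ^ k) \<le> (\<Sum>i\<in>F. b i) ^ j * b x ^ k"
      proof (rule AE_I2)
        fix \<omega> assume \<omega>: "\<omega> \<in> space M"
        have "\<bar>A \<omega>\<bar> ^ j * \<bar>X x \<omega>\<bar> ^ k \<le> (\<Sum>i\<in>F. b i) ^ j * b x ^ k"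
          using A_bd[OF \<omega>] X_bd[OF \<omega>] by (intro mult_mono power_mono) auto
        then show "norm (A \<omega> ^ j * X x \<omega> ^ k) \<le> (\<Sum>i\<in>F. b i) ^ j * b x ^ k"
          by (simp add: abs_mult power_abs)
      qed
    qed measurable
    have intA: "integrable M (\<lambda>\<omega>. A \<omega> ^ j)" and intX: "integrable M (\<lambda>\<omega>. X x \<omega> ^ j)" for j
      using int[of j 0] int[of 0 j] by auto
    have mult: "expectation (\<lambda>\<omega>. A \<omega> ^ j * X x \<omega> ^ k) = expectation (\<lambda>\<omega>. A \<omega> ^ j) * expectation (\<lambda>\<omega>. X x \<omega> ^ k)" for j k
    proof -
      have "indep_var borel ((\<lambda>y. y ^ k) \<circ> X x) borel ((\<lambda>y. y ^ j) \<circ> A)"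
        by (rule indep_var_compose[OF ind]) auto
      then have "expectation (\<lambda>\<omega>. X x \<omega> ^ k * A \<omega> ^ j) = expectation (\<lambda>\<omega>. X x \<omega> ^ k) * expectation (\<lambda>\<omega>. A \<omega> ^ j)"
        unfolding comp_def by (rule indep_var_lebesgue_integral) (rule intX intA)+
      then show ?thesis by (simp add: mult.commute)
    qed
    have IH: "expectation A = 0" "expectation (\<lambda>\<omega>. A \<omega> ^ 2) \<le> B" "expectation (\<lambda>\<omega>. A \<omega> ^ 4) \<le> 3 * B\<^sup>2"
      using insert.IH[OF indep_vars_subset[OF insert.prems(1)]] insert.prems(2,3)
      unfolding A_def B_def by auto
    have X1: "expectation (X x) = 0" using insert.prems(2) by auto
    have X2: "expectation (\<lambda>\<omega>. X x \<omega> ^ j) \<le> b x ^ j" if "even j" for j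
    proof -
      have "expectation (\<lambda>\<omega>. X x \<omega> ^ j) \<le> expectation (\<lambda>\<omega>. b x ^ j)"
      proof (rule integral_mono_AE[OF intX])
        show "AE \<omega> in M. X x \<omega> ^ j \<le> b x ^ j"
          using X_bd that by (intro AE_I2) (metis abs_ge_zero power_even_abs power_mono)
      qed simp
      then show ?thesis by (simp add: prob_space)
    qed
    have X2_nn: "0 \<le> expectation (\<lambda>\<omega>. X x \<omega> ^ 2)" by simp
    have B0: "0 \<le> B" by (simp add: B_def sum_nonneg)
    have sum_eq: "(\<Sum>i\<in>insert x F. X i \<omega>) = A \<omega> + X x \<omega>" for \<omega>
      using insert.hyps by (simp add: A_def)
    have b_eq: "(\<Sum>i\<in>insert x F. (b i)\<^sup>2) = B + (b x)\<^sup>2" using insert.hyps by (simp add: B_def)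
    have E1: "expectation (\<lambda>\<omega>. A \<omega> + X x \<omega>) = 0"
      using intA[of 1] intX[of 1] IH(1) X1 by simp
    have "expectation (\<lambda>\<omega>. (A \<omega> + X x \<omega>)\<^sup>2) = expectation (\<lambda>\<omega>. A \<omega> ^ 2 + 2 * (A \<omega> ^ 1 * X x \<omega> ^ 1) + X x \<omega> ^ 2)"
      by (simp add: power2_sum algebra_simps)
    also have "\<dots> = expectation (\<lambda>\<omega>. A \<omega> ^ 2) + 2 * expectation (\<lambda>\<omega>. A \<omega> ^ 1 * X x \<omega> ^ 1) + expectation (\<lambda>\<omega>. X x \<omega> ^ 2)"
      using int[of 1 1] intA[of 2] intX[of 2] by simp
    also have "\<dots> \<le> B + (b x)\<^sup>2"
      unfolding mult using IH X1 X2[of 2] by simp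
    finally have E2: "expectation (\<lambda>\<omega>. (A \<omega> + X x \<omega>)\<^sup>2) \<le> B + (b x)\<^sup>2" .
    have "expectation (\<lambda>\<omega>. (A \<omega> + X x \<omega>) ^ 4) =
        expectation (\<lambda>\<omega>. A \<omega> ^ 4 + 4 * (A \<omega> ^ 3 * X x \<omega> ^ 1) + 6 * (A \<omega> ^ 2 * X x \<omega> ^ 2) + 4 * (A \<omega> ^ 1 * X x \<omega> ^ 3) + X x \<omega> ^ 4)"
      by (intro Bochner_Integration.integral_cong) (auto simp: eval_nat_numeral algebra_simps)
    also have "\<dots> = expectation (\<lambda>\<omega>. A \<omega> ^ 4) + 4 * expectation (\<lambda>\<omega>. A \<omega> ^ 3 * X x \<omega> ^ 1)
        + 6 * expectation (\<lambda>\<omega>. A \<omega> ^ 2 * X x \<omega> ^ 2) + 4 * expectation (\<lambda>\<omega>. A \<omega> ^ 1 * X x \<omega> ^ 3) + expectation (\<lambda>\<omega>. X x \<omega> ^ 4)"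
      using int[of 3 1] int[of 2 2] int[of 1 3] intA[of 4] intX[of 4] by simp
    also have "\<dots> \<le> 3 * B\<^sup>2 + 6 * (B * (b x)\<^sup>2) + b x ^ 4"
    proof -
      have "expectation (\<lambda>\<omega>. A \<omega> ^ 2) * expectation (\<lambda>\<omega>. X x \<omega> ^ 2) \<le> B * (b x)\<^sup>2"
        using IH(2) X2[of 2] X2_nn B0 by (intro mult_mono) auto
      then show ?thesis unfolding mult using IH X1 X2[of 4] by simp
    qed
    also have "\<dots> \<le> 3 * (B + (b x)\<^sup>2)\<^sup>2"
      by (simp add: power2_sum algebra_simps flip: power_mult)
    finally have E4: "expectation (\<lambda>\<omega>. (A \<omega> + X x \<omega>) ^ 4) \<le> 3 * (B + (b x)\<^sup>2)\<^sup>2" .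
    show ?case unfolding sum_eq b_eq using E1 E2 E4 by blast
  qed simp
  then show "expectation (\<lambda>\<omega>. (\<Sum>i\<in>I. X i \<omega>)) = 0"
    "expectation (\<lambda>\<omega>. (\<Sum>i\<in>I. X i \<omega>)\<^sup>2) \<le> (\<Sum>i\<in>I. (b i)\<^sup>2)"
    "expectation (\<lambda>\<omega>. (\<Sum>i\<in>I. X i \<omega>) ^ 4) \<le> 3 * (\<Sum>i\<in>I. (b i)\<^sup>2)\<^sup>2" by auto
qed

section \<open>Increments of Brownian motion\<close>

lemma brownian_motion_char:
  fixes S :: "real^'d^'d" and B :: "'a \<Rightarrow> (real^'d) path"
  assumes bm: "brownian_motion P S B" and t: "0 \<le> t 0" "mono_on {..K} t"
  shows "(CLINT \<omega>|P. iexp (\<Sum>i<K. \<theta> i \<bullet> (path_at (B \<omega>) (t (Suc i)) - path_at (B \<omega>) (t i)))) =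
    (\<Prod>i<K. complex_of_real (exp (- ((t (Suc i) - t i) * (\<theta> i \<bullet> (S *v \<theta> i))) / 2)))"
proof -
  have P: "prob_space P" and B: "B \<in> borel_measurable P"
    and pos: "\<And>v. v \<noteq> 0 \<Longrightarrow> 0 < v \<bullet> (S *v v)"
    and ind: "prob_space.indep_vars P (\<lambda>_. borel) (\<lambda>i \<omega>. path_at (B \<omega>) (t (Suc i)) - path_at (B \<omega>) (t i)) {..<K}"
    and dis: "\<And>s t v. 0 \<le> s \<Longrightarrow> s < t \<Longrightarrow> v \<noteq> 0 \<Longrightarrow> distributed P lborel (\<lambda>\<omega>. v \<bullet> (path_at (B \<omega>) t - path_at (B \<omega>) s))
      (normal_density 0 (sqrt ((t - s) * (v \<bullet> (S *v v)))))"
    using bm t unfolding brownian_motion_def by blast+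
  interpret P: prob_space P by (rule P)
  note B [measurable]
  have "(CLINT \<omega>|P. iexp (\<Sum>i<K. \<theta> i \<bullet> (path_at (B \<omega>) (t (Suc i)) - path_at (B \<omega>) (t i)))) =
      (CLINT \<omega>|P. (\<Prod>i<K. iexp (\<theta> i \<bullet> (path_at (B \<omega>) (t (Suc i)) - path_at (B \<omega>) (t i)))))"
    by (simp only: of_real_sum sum_distrib_left exp_sum[OF finite_lessThan])
  also have "\<dots> = (\<Prod>i<K. CLINT \<omega>|P. iexp (\<theta> i \<bullet> (path_at (B \<omega>) (t (Suc i)) - path_at (B \<omega>) (t i))))"
  proof (rule P.indep_vars_lebesgue_integral)
    show "P.indep_vars (\<lambda>_. borel) (\<lambda>i \<omega>. iexp (\<theta> i \<bullet> (path_at (B \<omega>) (t (Suc i)) - path_at (B \<omega>) (t i)))) {..<K}"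
      by (rule P.indep_vars_compose2[OF ind]) measurable
    show "integrable P (\<lambda>\<omega>. iexp (\<theta> i \<bullet> (path_at (B \<omega>) (t (Suc i)) - path_at (B \<omega>) (t i))))" for i
      by (rule P.integrable_iexp) auto
  qed simp
  also have "\<dots> = (\<Prod>i<K. complex_of_real (exp (- ((t (Suc i) - t i) * (\<theta> i \<bullet> (S *v \<theta> i))) / 2)))"
  proof (rule prod.cong[OF refl])
    fix i assume i: "i \<in> {..<K}"
    have le: "t i \<le> t (Suc i)" "0 \<le> t i"
      using t i order_trans[OF t(1), of "t i"] by (auto simp: mono_on_def)
    show "(CLINT \<omega>|P. iexp (\<theta> i \<bullet> (path_at (B \<omega>) (t (Suc i)) - path_at (B \<omega>) (t i)))) =
        complex_of_real (exp (- ((t (Suc i) - t i) * (\<theta> i \<bullet> (S *v \<theta> i))) / 2))"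
    proof (cases "t i = t (Suc i) \<or> \<theta> i = 0")
      case True
      then show ?thesis by (auto simp: P.prob_space)
    next
      case False
      then have lt: "t i < t (Suc i)" and \<theta>: "\<theta> i \<noteq> 0" using le by auto
      have \<sigma>: "0 < (t (Suc i) - t i) * (\<theta> i \<bullet> (S *v \<theta> i))" using lt pos[OF \<theta>] by simp
      have "\<forall>u. (CLINT \<omega>|P. iexp (u * (\<theta> i \<bullet> (path_at (B \<omega>) (t (Suc i)) - path_at (B \<omega>) (t i))))) =
          complex_of_real (exp (- (sqrt ((t (Suc i) - t i) * (\<theta> i \<bullet> (S *v \<theta> i))) * u)\<^sup>2 / 2))"
        using dis[OF le(2) lt \<theta>] by (subst (asm) P.normal_distributed_iff_char) (use \<sigma> in auto)
      from this[rule_format, of 1] show ?thesis using \<sigma> by simp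
    qed
  qed
  finally show ?thesis .
qed

section \<open>Donsker's theorem for bounded steps\<close>

lemma abs_exp_minus_le: "0 \<le> x \<Longrightarrow> \<bar>exp (- x) - (1 - x)\<bar> \<le> x\<^sup>2" for x :: real
proof -
  assume x: "0 \<le> x"
  have "exp (- x) \<le> 1 / (1 + x)"
    using x exp_ge_add_one_self[of x] by (simp add: exp_minus field_simps)
  also have "\<dots> \<le> 1 - x + x\<^sup>2"
  proof -
    have "1 \<le> (1 - x + x\<^sup>2) * (1 + x)" using x by (simp add: algebra_simps power2_eq_square power3_eq_cube)
    then show ?thesis using x by (simp add: divide_le_eq)
  qed
  finally have "exp (- x) \<le> 1 - x + x\<^sup>2" .
  moreover have "1 - x \<le> exp (- x)" using exp_ge_add_one_self[of "- x"] by simp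
  ultimately show ?thesis by simp
qed

locale centered_bounded_steps = prob_space M for M :: "'a measure" +
  fixes \<xi> :: "nat \<Rightarrow> 'a \<Rightarrow> real^'d" and K :: real
  assumes indep_steps: "indep_vars (\<lambda>_. borel) \<xi> UNIV"
    and same_law: "\<And>i. distr M borel (\<xi> i) = distr M borel (\<xi> 0)"
    and steps_bounded: "\<And>i \<omega>. \<omega> \<in> space M \<Longrightarrow> norm (\<xi> i \<omega>) \<le> K"
    and steps_centered: "expectation (\<xi> 0) = 0"
begin

definition walk :: "nat \<Rightarrow> 'a \<Rightarrow> real^'d" where
  "walk n \<omega> = (\<Sum>i<n. \<xi> i \<omega>)"

definition covariance :: "real^'d^'d" where
  "covariance = (\<chi> i j. expectation (\<lambda>\<omega>. \<xi> 0 \<omega> $ i * \<xi> 0 \<omega> $ j))"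

lemma steps_meas [measurable]: "\<xi> i \<in> borel_measurable M"
  using indep_steps by (auto simp: indep_vars_def)

lemma walk_meas [measurable]: "walk n \<in> borel_measurable M"
  unfolding walk_def[abs_def] by measurable

lemma step_bound_nonneg: "0 \<le> K"
  using steps_bounded[of _ 0] not_empty norm_ge_zero order_trans by blast

lemma expectation_step_eq:
  fixes f :: "real^'d \<Rightarrow> 'z::{banach, second_countable_topology}"
  assumes "f \<in> borel_measurable borel"
  shows "expectation (\<lambda>\<omega>. f (\<xi> i \<omega>)) = expectation (\<lambda>\<omega>. f (\<xi> 0 \<omega>))"
  using integral_distr[of "\<xi> i" M borel f] integral_distr[of "\<xi> 0" M borel f] assms same_law[of i] by simp

lemma inner_step_le: "\<omega> \<in> space M \<Longrightarrow> \<bar>v \<bullet> \<xi> i \<omega>\<bar> \<le> norm v * K"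
  by (rule order_trans[OF Cauchy_Schwarz_ineq2]) (intro mult_left_mono steps_bounded norm_ge_zero)

lemma integrable_inner_step_power: "integrable M (\<lambda>\<omega>. (v \<bullet> \<xi> i \<omega>) ^ k)"
proof (rule integrable_const_bound[of _ "(norm v * K) ^ k"])
  show "AE \<omega> in M. norm ((v \<bullet> \<xi> i \<omega>) ^ k) \<le> (norm v * K) ^ k"
    by (intro AE_I2) (simp add: power_abs inner_step_le power_mono)
qed measurable

lemma integrable_step: "integrable M (\<xi> i)"
  by (rule integrable_const_bound[of _ K]) (auto intro!: AE_I2 steps_bounded)

lemma expectation_inner_step: "expectation (\<lambda>\<omega>. v \<bullet> \<xi> i \<omega>) = 0"
proof -
  have "expectation (\<lambda>\<omega>. v \<bullet> \<xi> i \<omega>) = expectation (\<lambda>\<omega>. v \<bullet> \<xi> 0 \<omega>)"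
    by (rule expectation_step_eq) measurable
  also have "\<dots> = v \<bullet> expectation (\<xi> 0)"
    by (rule integral_inner_right) (auto intro: integrable_step)
  finally show ?thesis by (simp add: steps_centered)
qed

lemma covariance_form: "v \<bullet> (covariance *v v) = expectation (\<lambda>\<omega>. (v \<bullet> \<xi> 0 \<omega>)\<^sup>2)"
proof -
  have int: "integrable M (\<lambda>\<omega>. \<xi> 0 \<omega> $ i * \<xi> 0 \<omega> $ j)" for i j
  proof (rule integrable_const_bound[of _ "K * K"])
    show "AE \<omega> in M. norm (\<xi> 0 \<omega> $ i * \<xi> 0 \<omega> $ j) \<le> K * K"
    proof (rule AE_I2)
      fix \<omega> assume "\<omega> \<in> space M"
      then have "\<bar>\<xi> 0 \<omega> $ i\<bar> \<le> K" for i
        using component_le_norm_cart[of "\<xi> 0 \<omega>" i] steps_bounded[of \<omega> 0] by linarith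
      then show "norm (\<xi> 0 \<omega> $ i * \<xi> 0 \<omega> $ j) \<le> K * K"
        using step_bound_nonneg by (auto simp: abs_mult intro!: mult_mono)
    qed
  qed measurable
  have "expectation (\<lambda>\<omega>. (v \<bullet> \<xi> 0 \<omega>)\<^sup>2) = expectation (\<lambda>\<omega>. \<Sum>i\<in>UNIV. \<Sum>j\<in>UNIV. (v $ i * v $ j) * (\<xi> 0 \<omega> $ i * \<xi> 0 \<omega> $ j))"
    by (simp add: inner_vec_def power2_eq_square sum_product mult_ac)
  also have "\<dots> = (\<Sum>i\<in>UNIV. \<Sum>j\<in>UNIV. (v $ i * v $ j) * expectation (\<lambda>\<omega>. \<xi> 0 \<omega> $ i * \<xi> 0 \<omega> $ j))"
    using int by simp
  also have "\<dots> = v \<bullet> (covariance *v v)"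
    by (simp add: inner_vec_def matrix_vector_mult_def covariance_def sum_distrib_left mult_ac)
  finally show ?thesis ..
qed

lemma covariance_sym: "transpose covariance = covariance"
  by (simp add: covariance_def transpose_def vec_eq_iff mult.commute)

lemma covariance_form_bounds: "0 \<le> v \<bullet> (covariance *v v)" "v \<bullet> (covariance *v v) \<le> (norm v * K)\<^sup>2"
proof -
  show "0 \<le> v \<bullet> (covariance *v v)" unfolding covariance_form by simp
  have "expectation (\<lambda>\<omega>. (v \<bullet> \<xi> 0 \<omega>)\<^sup>2) \<le> expectation (\<lambda>\<omega>. (norm v * K)\<^sup>2)"
  proof (rule integral_mono_AE[OF integrable_inner_step_power])
    show "AE \<omega> in M. (v \<bullet> \<xi> 0 \<omega>)\<^sup>2 \<le> (norm v * K)\<^sup>2"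
    proof (rule AE_I2)
      fix \<omega> assume "\<omega> \<in> space M"
      then show "(v \<bullet> \<xi> 0 \<omega>)\<^sup>2 \<le> (norm v * K)\<^sup>2"
        using power_mono[OF inner_step_le[of \<omega> v 0], of 2] by simp
    qed
  qed simp
  then show "v \<bullet> (covariance *v v) \<le> (norm v * K)\<^sup>2"
    unfolding covariance_form by (simp add: prob_space)
qed

text \<open>Both characteristic functions equal \<open>1 - v \<bullet> (covariance *v v) / 2\<close> up to an error of third order for
  the step and of fourth order for the Gaussian.\<close>

lemma step_char_approx:
  "cmod ((CLINT \<omega>|M. iexp (v \<bullet> \<xi> i \<omega>)) - complex_of_real (exp (- (v \<bullet> (covariance *v v)) / 2)))
    \<le> (norm v * K) ^ 3 + (norm v * K) ^ 4"
proof -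
  let ?q = "v \<bullet> (covariance *v v)"
  let ?x = "\<lambda>\<omega>. v \<bullet> \<xi> 0 \<omega>"
  have i1: "integrable M ?x" and i2: "integrable M (\<lambda>\<omega>. (?x \<omega>)\<^sup>2)"
    using integrable_inner_step_power[of v 0 1] integrable_inner_step_power[of v 0 2] by auto
  have ie: "complex_integrable M (\<lambda>\<omega>. iexp (?x \<omega>))" by (rule integrable_iexp) auto
  let ?T = "\<lambda>\<omega>. 1 + \<i> * complex_of_real (?x \<omega>) - complex_of_real ((?x \<omega>)\<^sup>2) / 2"
  have iT: "complex_integrable M ?T"
    using i1 i2 by (intro Bochner_Integration.integrable_diff Bochner_Integration.integrable_add
        integrable_const integrable_mult_right integrable_divide_zero integrable_of_real) auto
  have ET: "(CLINT \<omega>|M. ?T \<omega>) = complex_of_real (1 - ?q / 2)"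
  proof -
    have "(CLINT \<omega>|M. ?T \<omega>) = 1 + \<i> * complex_of_real (expectation ?x) - complex_of_real (expectation (\<lambda>\<omega>. (?x \<omega>)\<^sup>2)) / 2"
      using i1 i2 by (simp add: prob_space integral_complex_of_real del: of_real_power)
    then show ?thesis by (simp add: expectation_inner_step covariance_form)
  qed
  have "cmod ((CLINT \<omega>|M. iexp (?x \<omega>)) - complex_of_real (1 - ?q / 2)) = cmod (CLINT \<omega>|M. iexp (?x \<omega>) - ?T \<omega>)"
    unfolding ET[symmetric] by (simp only: Bochner_Integration.integral_diff[OF ie iT])
  also have "\<dots> \<le> expectation (\<lambda>\<omega>. cmod (iexp (?x \<omega>) - ?T \<omega>))" by (rule integral_norm_bound)
  also have "\<dots> \<le> expectation (\<lambda>\<omega>. (norm v * K) ^ 3)"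
  proof (rule integral_mono_AE)
    show "integrable M (\<lambda>\<omega>. cmod (iexp (?x \<omega>) - ?T \<omega>))"
      by (intro integrable_norm Bochner_Integration.integrable_diff ie iT)
    show "AE \<omega> in M. cmod (iexp (?x \<omega>) - ?T \<omega>) \<le> (norm v * K) ^ 3"
    proof (rule AE_I2)
      fix \<omega> assume \<omega>: "\<omega> \<in> space M"
      have "(\<Sum>k\<le>2. (\<i> * complex_of_real (?x \<omega>)) ^ k / fact k) = ?T \<omega>"
        by (simp add: eval_nat_numeral power_mult_distrib)
      then have "cmod (iexp (?x \<omega>) - ?T \<omega>) \<le> \<bar>?x \<omega>\<bar> ^ 3 / fact 3"
        using iexp_approx1[of "?x \<omega>" 2] by (simp add: eval_nat_numeral)
      also have "\<dots> \<le> \<bar>?x \<omega>\<bar> ^ 3 / 1" by (intro divide_left_mono) auto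
      also have "\<dots> \<le> (norm v * K) ^ 3" using inner_step_le[OF \<omega>, of v 0] by (simp add: power_mono)
      finally show "cmod (iexp (?x \<omega>) - ?T \<omega>) \<le> (norm v * K) ^ 3" .
    qed
  qed simp
  finally have 1: "cmod ((CLINT \<omega>|M. iexp (?x \<omega>)) - complex_of_real (1 - ?q / 2)) \<le> (norm v * K) ^ 3"
    by (simp add: prob_space)
  have "\<bar>exp (- (?q / 2)) - (1 - ?q / 2)\<bar> \<le> (?q / 2)\<^sup>2"
    by (rule abs_exp_minus_le) (use covariance_form_bounds(1)[of v] in simp)
  also have "\<dots> \<le> ((norm v * K)\<^sup>2)\<^sup>2"
    using covariance_form_bounds[of v] by (intro power_mono) auto
  also have "\<dots> = (norm v * K) ^ 4" by (simp flip: power_mult)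
  finally have 2: "cmod (complex_of_real (1 - ?q / 2) - complex_of_real (exp (- ?q / 2))) \<le> (norm v * K) ^ 4"
    unfolding of_real_diff[symmetric] norm_of_real by (simp add: abs_minus_commute)
  have "(CLINT \<omega>|M. iexp (v \<bullet> \<xi> i \<omega>)) = (CLINT \<omega>|M. iexp (?x \<omega>))"
    by (rule expectation_step_eq) measurable
  then have "(CLINT \<omega>|M. iexp (v \<bullet> \<xi> i \<omega>)) - complex_of_real (exp (- ?q / 2)) =
      ((CLINT \<omega>|M. iexp (?x \<omega>)) - complex_of_real (1 - ?q / 2)) + (complex_of_real (1 - ?q / 2) - complex_of_real (exp (- ?q / 2)))"
    by simp
  then show ?thesis
    using norm_triangle_mono[OF 1 2] by simp
qed

definition scaled_walk :: "nat \<Rightarrow> 'a \<Rightarrow> (real^'d) path" where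
  "scaled_walk n \<omega> = diffusive_path (\<lambda>k. walk k \<omega>) n"

lemma scaled_walk_meas [measurable]: "scaled_walk n \<in> borel_measurable M"
  unfolding scaled_walk_def[abs_def] by (rule measurable_diffusive_path) measurable

lemma path_at_scaled_walk:
  assumes "0 \<le> t" "real n * t \<le> real N"
  shows "path_at (scaled_walk n \<omega>) t = (\<Sum>i<N. max 0 (min 1 (real n * t - real i)) *\<^sub>R \<xi> i \<omega>) /\<^sub>R sqrt (real n)"
  unfolding scaled_walk_def path_at_diffusive_path[OF assms(1)]
  by (subst lerp_eq_weighted_steps[of _ N]) (use assms in \<open>auto simp: walk_def\<close>)

lemma indep_linear_steps: "indep_vars (\<lambda>_. borel) (\<lambda>i \<omega>. v i \<bullet> \<xi> i \<omega>) I"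
  by (rule indep_vars_compose2[OF indep_vars_subset[OF indep_steps]]) (auto, measurable)

text \<open>The total weight of the steps made between times \<open>s\<close> and \<open>t\<close> is \<open>n (t - s)\<close>; as each weight is
  at most one, this bounds the sum of the squared weights.\<close>

lemma scaled_walk_moment:
  assumes st: "0 \<le> s" "s \<le> t"
  shows "integrable M (\<lambda>\<omega>. norm (path_at (scaled_walk n \<omega>) t - path_at (scaled_walk n \<omega>) s) ^ 4)"
    and "expectation (\<lambda>\<omega>. norm (path_at (scaled_walk n \<omega>) t - path_at (scaled_walk n \<omega>) s) ^ 4)
      \<le> 3 * real CARD('d) ^ 5 * K ^ 4 * (t - s)\<^sup>2"
proof -
  define N where "N = nat \<lceil>real n * t\<rceil>"
  have N: "real n * t \<le> real N" by (simp add: N_def real_nat_ceiling_ge)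
  have ns: "real n * s \<le> real n * t" using st by (simp add: mult_left_mono)
  have Ns: "real n * s \<le> real N" using N ns by simp
  define w where "w i = max 0 (min 1 (real n * t - real i)) - max 0 (min 1 (real n * s - real i))" for i
  have w: "0 \<le> w i" "w i \<le> 1" for i using ns by (auto simp: w_def)
  have sum_clamp: "(\<Sum>i<N. max 0 (min 1 (u - real i))) = u" if "0 \<le> u" "u \<le> real N" for u
    using lerp_eq_weighted_steps[OF that, of real] that by (simp add: lerp_def)
  have sum_w: "(\<Sum>i<N. w i) = real n * (t - s)"
    unfolding w_def sum_subtractf using st N Ns by (simp add: sum_clamp right_diff_distrib)
  define D where "D \<omega> = path_at (scaled_walk n \<omega>) t - path_at (scaled_walk n \<omega>) s" for \<omega>
  have [measurable]: "D \<in> borel_measurable M" unfolding D_def[abs_def] by measurable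
  have D: "D \<omega> = (\<Sum>i<N. w i *\<^sub>R \<xi> i \<omega>) /\<^sub>R sqrt (real n)" for \<omega>
  proof -
    have "0 \<le> t" using st by simp
    then show ?thesis
      unfolding D_def path_at_scaled_walk[OF st(1) Ns] path_at_scaled_walk[OF \<open>0 \<le> t\<close> N]
      by (simp add: w_def scaleR_diff_left sum_subtractf scaleR_diff_right)
  qed
  define b where "b i = w i * K / sqrt (real n)" for i
  have coord: "D \<omega> $ j = (\<Sum>i<N. ((w i / sqrt (real n)) *\<^sub>R axis j 1) \<bullet> \<xi> i \<omega>)" for \<omega> j
    unfolding D by (simp add: inner_axis' sum_distrib_left sum_divide_distrib divide_inverse mult_ac)
  have bd: "\<bar>((w i / sqrt (real n)) *\<^sub>R axis j 1) \<bullet> \<xi> i \<omega>\<bar> \<le> b i" if "\<omega> \<in> space M" for i j \<omega>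
    using inner_step_le[OF that, of "(w i / sqrt (real n)) *\<^sub>R axis j 1" i] w(1)[of i] by (simp add: b_def)
  have sum_b: "(\<Sum>i<N. (b i)\<^sup>2) \<le> K\<^sup>2 * (t - s)"
  proof (cases "n = 0")
    case True
    then show ?thesis using st by (simp add: b_def)
  next
    case False
    have "(\<Sum>i<N. (b i)\<^sup>2) = (\<Sum>i<N. (w i)\<^sup>2) * (K\<^sup>2 / real n)"
      by (simp add: b_def power_divide power_mult_distrib sum_distrib_right sum_divide_distrib)
    also have "\<dots> \<le> (\<Sum>i<N. w i) * (K\<^sup>2 / real n)"
      using w by (intro mult_right_mono sum_mono) (auto simp: power2_eq_square mult_left_le)
    also have "\<dots> = K\<^sup>2 * (t - s)" unfolding sum_w using False by (simp add: field_simps)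
    finally show ?thesis .
  qed
  have c4: "expectation (\<lambda>\<omega>. (D \<omega> $ j) ^ 4) \<le> 3 * K ^ 4 * (t - s)\<^sup>2" for j
  proof -
    have "expectation (\<lambda>\<omega>. (D \<omega> $ j) ^ 4) \<le> 3 * (\<Sum>i<N. (b i)\<^sup>2)\<^sup>2"
      unfolding coord by (rule indep_sum_moments_le(3)) (auto simp del: inner_scaleR_left intro: indep_linear_steps expectation_inner_step bd)
    also have "\<dots> \<le> 3 * (K\<^sup>2 * (t - s))\<^sup>2"
      using sum_b by (intro mult_left_mono power_mono) (auto intro: sum_nonneg)
    finally show ?thesis by (simp add: power_mult_distrib flip: power_mult)
  qed
  have c4_int: "integrable M (\<lambda>\<omega>. (D \<omega> $ j) ^ 4)" for j
  proof (rule integrable_const_bound[of _ "(\<Sum>i<N. b i) ^ 4"])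
    show "AE \<omega> in M. norm ((D \<omega> $ j) ^ 4) \<le> (\<Sum>i<N. b i) ^ 4"
    proof (rule AE_I2)
      fix \<omega> assume "\<omega> \<in> space M"
      then have "\<bar>D \<omega> $ j\<bar> \<le> (\<Sum>i<N. b i)"
        unfolding coord by (intro sum_abs[THEN order_trans] sum_mono bd)
      then show "norm ((D \<omega> $ j) ^ 4) \<le> (\<Sum>i<N. b i) ^ 4" using power_mono[of "\<bar>D \<omega> $ j\<bar>" _ 4] by (simp add: power_abs)
    qed
  qed measurable
  show "integrable M (\<lambda>\<omega>. norm (path_at (scaled_walk n \<omega>) t - path_at (scaled_walk n \<omega>) s) ^ 4)"
    unfolding D_def[symmetric] by (rule norm_fourth_moment_le(1)[OF _ c4_int c4]) measurable
  have "expectation (\<lambda>\<omega>. norm (D \<omega>) ^ 4) \<le> real CARD('d) ^ 4 * (\<Sum>j\<in>(UNIV::'d set). 3 * K ^ 4 * (t - s)\<^sup>2)"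
    by (rule norm_fourth_moment_le(2)[OF _ c4_int c4]) measurable
  also have "\<dots> = 3 * real CARD('d) ^ 5 * K ^ 4 * (t - s)\<^sup>2" by (simp add: eval_nat_numeral)
  finally show "expectation (\<lambda>\<omega>. norm (path_at (scaled_walk n \<omega>) t - path_at (scaled_walk n \<omega>) s) ^ 4)
      \<le> 3 * real CARD('d) ^ 5 * K ^ 4 * (t - s)\<^sup>2"
    by (simp add: D_def)
qed

lemma scaled_walk_chaining:
  "expectation (\<lambda>\<omega>. dist (dyadic_interp m (\<lambda>k. path_at (scaled_walk n \<omega>) (real k / 2 ^ m))) (scaled_walk n \<omega>))
    \<le> 10 * (2 + 3 * (3 * real CARD('d) ^ 5 * K ^ 4)) * (9/10) ^ m"
proof (rule expectation_dist_dyadic_interp_le)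
  fix m k
  have le: "0 \<le> real k / 2 ^ m" "real k / 2 ^ m \<le> real (Suc k) / 2 ^ m" by (auto simp: divide_right_mono)
  have "real (Suc k) / 2 ^ m - real k / 2 ^ m = 1 / 2 ^ m" by (simp add: diff_divide_distrib[symmetric])
  then have "(real (Suc k) / 2 ^ m - real k / 2 ^ m)\<^sup>2 = 1 / 4 ^ m"
    by (simp add: power_divide power_mult[symmetric] mult.commute[of m]) (simp add: power_mult)
  then show "expectation (\<lambda>\<omega>. norm (path_at (scaled_walk n \<omega>) (real (Suc k) / 2 ^ m) - path_at (scaled_walk n \<omega>) (real k / 2 ^ m)) ^ 4)
      \<le> 3 * real CARD('d) ^ 5 * K ^ 4 / 4 ^ m"
    using scaled_walk_moment(2)[OF le, of n] by simp
  show "integrable M (\<lambda>\<omega>. norm (path_at (scaled_walk n \<omega>) (real (Suc k) / 2 ^ m) - path_at (scaled_walk n \<omega>) (real k / 2 ^ m)) ^ 4)"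
    by (rule scaled_walk_moment(1)[OF le])
qed measurable

text \<open>A linear combination of values of the rescaled walk is a weighted sum of steps, and the same
  combination of values of Brownian motion interpolated at the times \<open>i / n\<close> is the same weighted sum of
  Gaussian steps. The two characteristic functions are products over the steps, and their factors
  differ by \<open>O (n powr (- 3/2))\<close>.\<close>

lemma scaled_walk_char_tendsto:
  assumes bm: "brownian_motion P covariance B" and fin: "finite J" and t: "\<And>j. j \<in> J \<Longrightarrow> 0 \<le> t j"
  shows "(\<lambda>n. CLINT \<omega>|M. iexp (\<Sum>j\<in>J. \<theta> j \<bullet> path_at (scaled_walk n \<omega>) (t j))) \<longlonglongrightarrow>
    (CLINT \<omega>|P. iexp (\<Sum>j\<in>J. \<theta> j \<bullet> path_at (B \<omega>) (t j)))"
proof -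
  have P: "prob_space P" and B [measurable]: "B \<in> borel_measurable P" and B0: "AE \<omega> in P. path_at (B \<omega>) 0 = 0"
    using bm unfolding brownian_motion_def by blast+
  interpret P: prob_space P by (rule P)
  obtain T where T: "\<And>j. j \<in> J \<Longrightarrow> t j \<le> real T"
  proof -
    have "t j \<le> real (nat \<lceil>\<Sum>j\<in>J. t j\<rceil>)" if j: "j \<in> J" for j
    proof -
      have "t j \<le> (\<Sum>j\<in>J. t j)" using j t fin by (intro member_le_sum) auto
      then show ?thesis using real_nat_ceiling_ge[of "\<Sum>j\<in>J. t j"] by linarith
    qed
    then show ?thesis by (rule that)
  qed
  define w where "w n i j = max 0 (min 1 (real n * t j - real i))" for n i j
  have w: "0 \<le> w n i j" "w n i j \<le> 1" for n i j by (auto simp: w_def)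
  define c where "c n i = (\<Sum>j\<in>J. w n i j *\<^sub>R \<theta> j) /\<^sub>R sqrt (real n)" for n i
  define R where "R = (\<Sum>j\<in>J. norm (\<theta> j))"
  have c_le: "norm (c n i) \<le> R / sqrt (real n)" for n i
  proof -
    have "norm (\<Sum>j\<in>J. w n i j *\<^sub>R \<theta> j) \<le> R"
      unfolding R_def by (intro sum_norm_le) (auto simp: mult_left_le_one_le w)
    then have "norm (\<Sum>j\<in>J. w n i j *\<^sub>R \<theta> j) / sqrt (real n) \<le> R / sqrt (real n)"
      by (intro divide_right_mono) auto
    then show ?thesis by (simp add: c_def divide_inverse mult.commute)
  qed
  have nt: "real n * t j \<le> real (n * T)" if "j \<in> J" for n j
    using T[OF that] by (simp add: mult_left_mono)
  have combine: "(\<Sum>j\<in>J. \<theta> j \<bullet> ((\<Sum>i<n * T. w n i j *\<^sub>R x i) /\<^sub>R sqrt (real n))) = (\<Sum>i<n * T. c n i \<bullet> x i)" for n x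
  proof -
    have "(\<Sum>j\<in>J. \<theta> j \<bullet> ((\<Sum>i<n * T. w n i j *\<^sub>R x i) /\<^sub>R sqrt (real n))) = (\<Sum>j\<in>J. \<Sum>i<n * T. (w n i j *\<^sub>R \<theta> j /\<^sub>R sqrt (real n)) \<bullet> x i)"
      by (simp add: inner_sum_right sum_distrib_left mult_ac)
    also have "\<dots> = (\<Sum>i<n * T. \<Sum>j\<in>J. (w n i j *\<^sub>R \<theta> j /\<^sub>R sqrt (real n)) \<bullet> x i)" by (rule sum.swap)
    also have "\<dots> = (\<Sum>i<n * T. c n i \<bullet> x i)"
      by (simp add: c_def inner_sum_left scaleR_sum_right)
    finally show ?thesis .
  qed
  define \<phi> where "\<phi> v = (CLINT \<omega>|M. iexp (v \<bullet> \<xi> 0 \<omega>))" for v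
  define \<psi> where "\<psi> v = complex_of_real (exp (- (v \<bullet> (covariance *v v)) / 2))" for v
  have walk_char: "(CLINT \<omega>|M. iexp (\<Sum>j\<in>J. \<theta> j \<bullet> path_at (scaled_walk n \<omega>) (t j))) = (\<Prod>i<n * T. \<phi> (c n i))" for n
  proof -
    have "(\<Sum>j\<in>J. \<theta> j \<bullet> path_at (scaled_walk n \<omega>) (t j)) = (\<Sum>i<n * T. c n i \<bullet> \<xi> i \<omega>)" for \<omega>
      unfolding combine[symmetric] w_def by (intro sum.cong refl) (simp only: path_at_scaled_walk[OF t nt])
    then have "(CLINT \<omega>|M. iexp (\<Sum>j\<in>J. \<theta> j \<bullet> path_at (scaled_walk n \<omega>) (t j))) = (CLINT \<omega>|M. (\<Prod>i<n * T. iexp (c n i \<bullet> \<xi> i \<omega>)))"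
      by (simp only: of_real_sum sum_distrib_left exp_sum[OF finite_lessThan])
    also have "\<dots> = (\<Prod>i<n * T. CLINT \<omega>|M. iexp (c n i \<bullet> \<xi> i \<omega>))"
    proof (rule indep_vars_lebesgue_integral)
      show "indep_vars (\<lambda>_. borel) (\<lambda>i \<omega>. iexp (c n i \<bullet> \<xi> i \<omega>)) {..<n * T}"
        by (rule indep_vars_compose2[OF indep_vars_subset[OF indep_steps]]) auto
      show "integrable M (\<lambda>\<omega>. iexp (c n i \<bullet> \<xi> i \<omega>))" for i
        by (rule integrable_iexp) auto
    qed simp
    also have "\<dots> = (\<Prod>i<n * T. \<phi> (c n i))"
      unfolding \<phi>_def by (intro prod.cong refl expectation_step_eq) measurable
    finally show ?thesis .
  qed
  define W where "W n \<omega> = diffusive_path (\<lambda>k. sqrt (real n) *\<^sub>R path_at (B \<omega>) (real k / real n)) n" for n \<omega>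
  have [measurable]: "W n \<in> borel_measurable P" for n
    unfolding W_def[abs_def] by (rule measurable_diffusive_path) measurable
  have bm_char: "(CLINT \<omega>|P. iexp (\<Sum>j\<in>J. \<theta> j \<bullet> path_at (W n \<omega>) (t j))) = (\<Prod>i<n * T. \<psi> (c n i))" if n: "0 < n" for n
  proof -
    define s where "s i = real i / real n" for i
    have s: "0 \<le> s 0" "mono_on {..n * T} s" by (auto simp: s_def mono_on_def divide_right_mono)
    have eq: "(\<Sum>j\<in>J. \<theta> j \<bullet> path_at (W n \<omega>) (t j)) =
        (\<Sum>i<n * T. (sqrt (real n) *\<^sub>R c n i) \<bullet> (path_at (B \<omega>) (s (Suc i)) - path_at (B \<omega>) (s i)))"
      if \<omega>: "path_at (B \<omega>) 0 = 0" for \<omega>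
    proof -
      define x where "x i = sqrt (real n) *\<^sub>R (path_at (B \<omega>) (s (Suc i)) - path_at (B \<omega>) (s i))" for i
      have "path_at (W n \<omega>) (t j) = (\<Sum>i<n * T. w n i j *\<^sub>R x i) /\<^sub>R sqrt (real n)" if "j \<in> J" for j
        unfolding W_def path_at_diffusive_path[OF t[OF that]]
        by (subst lerp_eq_weighted_steps[of _ "n * T"])
          (use t[OF that] nt[OF that] in \<open>auto simp: \<omega> w_def x_def s_def scaleR_diff_right simp del: of_nat_Suc\<close>)
      then have "(\<Sum>j\<in>J. \<theta> j \<bullet> path_at (W n \<omega>) (t j)) = (\<Sum>i<n * T. c n i \<bullet> x i)"
        unfolding combine[symmetric] by (intro sum.cong refl) simp
      then show ?thesis by (simp add: x_def)
    qed
    have "(CLINT \<omega>|P. iexp (\<Sum>j\<in>J. \<theta> j \<bullet> path_at (W n \<omega>) (t j))) =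
        (CLINT \<omega>|P. iexp (\<Sum>i<n * T. (sqrt (real n) *\<^sub>R c n i) \<bullet> (path_at (B \<omega>) (s (Suc i)) - path_at (B \<omega>) (s i))))"
    proof (rule integral_cong_AE)
      show "AE \<omega> in P. iexp (\<Sum>j\<in>J. \<theta> j \<bullet> path_at (W n \<omega>) (t j)) =
          iexp (\<Sum>i<n * T. (sqrt (real n) *\<^sub>R c n i) \<bullet> (path_at (B \<omega>) (s (Suc i)) - path_at (B \<omega>) (s i)))"
        using B0 by eventually_elim (simp only: eq)
    qed measurable
    also have "\<dots> = (\<Prod>i<n * T. complex_of_real (exp (- ((s (Suc i) - s i) *
        ((sqrt (real n) *\<^sub>R c n i) \<bullet> (covariance *v (sqrt (real n) *\<^sub>R c n i)))) / 2)))"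
      by (rule brownian_motion_char[OF bm s])
    also have "\<dots> = (\<Prod>i<n * T. \<psi> (c n i))"
      unfolding quadratic_form_scaleR \<psi>_def using n
      by (intro prod.cong refl) (simp add: s_def diff_divide_distrib[symmetric])
    finally show ?thesis .
  qed
  have norm1: "cmod (\<phi> v) \<le> 1" "cmod (\<psi> v) \<le> 1" for v
  proof -
    have "cmod (\<phi> v) \<le> expectation (\<lambda>\<omega>. cmod (iexp (v \<bullet> \<xi> 0 \<omega>)))" unfolding \<phi>_def by (rule integral_norm_bound)
    then show "cmod (\<phi> v) \<le> 1" by (simp only: norm_exp_i_times) (simp add: prob_space)
    show "cmod (\<psi> v) \<le> 1" using covariance_form_bounds(1)[of v] by (simp add: \<psi>_def)
  qed
  define a where "a = R * K"
  have a: "0 \<le> a" unfolding a_def R_def using step_bound_nonneg by (intro mult_nonneg_nonneg sum_nonneg) auto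
  have diff: "cmod ((\<Prod>i<n * T. \<phi> (c n i)) - (\<Prod>i<n * T. \<psi> (c n i))) \<le> real T * (a ^ 3 / sqrt (real n) + a ^ 4 / real n)"
    if n: "0 < n" for n
  proof -
    have "cmod ((\<Prod>i<n * T. \<phi> (c n i)) - (\<Prod>i<n * T. \<psi> (c n i))) \<le> (\<Sum>i<n * T. cmod (\<phi> (c n i) - \<psi> (c n i)))"
      by (rule norm_prod_diff) (use norm1 in auto)
    also have "\<dots> \<le> (\<Sum>i<n * T. (a / sqrt (real n)) ^ 3 + (a / sqrt (real n)) ^ 4)"
    proof (rule sum_mono)
      fix i
      have "norm (c n i) * K \<le> a / sqrt (real n)"
        using mult_right_mono[OF c_le[of n i] step_bound_nonneg] by (simp add: a_def)
      moreover have "0 \<le> norm (c n i) * K" using step_bound_nonneg by simp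
      ultimately show "cmod (\<phi> (c n i) - \<psi> (c n i)) \<le> (a / sqrt (real n)) ^ 3 + (a / sqrt (real n)) ^ 4"
        using step_char_approx[of "c n i" 0] power_mono[of "norm (c n i) * K" "a / sqrt (real n)" 3]
          power_mono[of "norm (c n i) * K" "a / sqrt (real n)" 4]
        unfolding \<phi>_def \<psi>_def by linarith
    qed
    also have "\<dots> = real (n * T) * ((a / sqrt (real n)) ^ 3 + (a / sqrt (real n)) ^ 4)" by simp
    also have "\<dots> = real T * (a ^ 3 / sqrt (real n) + a ^ 4 / real n)"
    proof -
      define r where "r = sqrt (real n)"
      have r: "0 < r" "real n = r * r" using n by (auto simp: r_def)
      have "real n * ((a / r) ^ 3 + (a / r) ^ 4) = a ^ 3 / r + a ^ 4 / real n"
        unfolding r(2) using r(1) by (simp add: field_simps eval_nat_numeral)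
      then show ?thesis by (simp add: r_def mult_ac)
    qed
    finally show ?thesis .
  qed
  have lim0: "(\<lambda>n. (\<Prod>i<n * T. \<phi> (c n i)) - (\<Prod>i<n * T. \<psi> (c n i))) \<longlonglongrightarrow> 0"
  proof (rule Lim_null_comparison)
    show "\<forall>\<^sub>F n in sequentially. cmod ((\<Prod>i<n * T. \<phi> (c n i)) - (\<Prod>i<n * T. \<psi> (c n i)))
        \<le> real T * (a ^ 3 / sqrt (real n) + a ^ 4 / real n)"
      using diff by (intro eventually_sequentiallyI[of 1]) auto
    have "(\<lambda>n. real T * (a ^ 3 / sqrt (real n) + a ^ 4 / real n)) \<longlonglongrightarrow> real T * (0 + 0)"
    proof (intro tendsto_mult tendsto_add tendsto_const)
      show "(\<lambda>n. a ^ 3 / sqrt (real n)) \<longlonglongrightarrow> 0"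
        by (rule real_tendsto_divide_at_top[OF tendsto_const filterlim_compose[OF sqrt_at_top filterlim_real_sequentially]])
      show "(\<lambda>n. a ^ 4 / real n) \<longlonglongrightarrow> 0"
        by (rule real_tendsto_divide_at_top[OF tendsto_const filterlim_real_sequentially])
    qed
    then show "(\<lambda>n. real T * (a ^ 3 / sqrt (real n) + a ^ 4 / real n)) \<longlonglongrightarrow> 0" by simp
  qed
  have W_lim: "(\<lambda>n. path_at (W n \<omega>) u) \<longlonglongrightarrow> path_at (B \<omega>) u" if u: "0 \<le> u" for u \<omega>
  proof (rule metric_LIMSEQ_I)
    fix e :: real assume e: "0 < e"
    have "continuous (at u within {0..}) (path_at (B \<omega>))"
      using continuous_on_path_at[of "B \<omega>"] u by (auto simp: continuous_on_eq_continuous_within)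
    then obtain d where d: "0 < d" "\<And>y. y \<in> {0..} \<Longrightarrow> dist y u < d \<Longrightarrow> dist (path_at (B \<omega>) y) (path_at (B \<omega>) u) < e / 2"
      using e unfolding continuous_within_eps_delta by (metis half_gt_zero)
    obtain n0 where n0: "1 / d < real n0" using reals_Archimedean2 by blast
    have "dist (path_at (W n \<omega>) u) (path_at (B \<omega>) u) < e" if n: "n \<ge> max n0 1" for n
    proof -
      have n': "0 < real n" "1 / d < real n" using n n0 by auto
      then have nd: "1 / real n < d" using d(1) by (simp add: field_simps)
      define k where "k = nat \<lfloor>real n * u\<rfloor>"
      have k: "real k \<le> real n * u" "real n * u < real k + 1"
        unfolding k_def using u by (auto simp: le_floor_iff)
      have near: "dist (path_at (B \<omega>) (real i / real n)) (path_at (B \<omega>) u) < e / 2" if i: "i = k \<or> i = k + 1" for i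
      proof (rule d(2))
        have "real i / real n - u = (real i - real n * u) / real n" using n' by (simp add: field_simps)
        then have "\<bar>real i / real n - u\<bar> = \<bar>real i - real n * u\<bar> / real n" by simp
        also have "\<dots> \<le> 1 / real n" using i k by (intro divide_right_mono) auto
        finally show "dist (real i / real n) u < d" using nd by (simp add: dist_real_def)
      qed simp
      have "path_at (W n \<omega>) u = lerp (\<lambda>k. path_at (B \<omega>) (real k / real n)) (real n * u)"
        unfolding W_def path_at_diffusive_path[OF u] lerp_scaleR using n' by simp
      moreover have "lerp (\<lambda>k. path_at (B \<omega>) (real k / real n)) (real n * u) \<in> cball (path_at (B \<omega>) u) (e / 2)"
        using near[of k] near[of "k + 1"] u
        by (intro lerp_in_convex) (auto simp: k_def[symmetric] dist_commute less_imp_le)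
      ultimately show ?thesis using e by (simp add: dist_commute)
    qed
    then show "\<exists>no. \<forall>n\<ge>no. dist (path_at (W n \<omega>) u) (path_at (B \<omega>) u) < e" by blast
  qed
  have "(\<lambda>n. CLINT \<omega>|P. iexp (\<Sum>j\<in>J. \<theta> j \<bullet> path_at (W n \<omega>) (t j))) \<longlonglongrightarrow>
      (CLINT \<omega>|P. iexp (\<Sum>j\<in>J. \<theta> j \<bullet> path_at (B \<omega>) (t j)))"
  proof (rule integral_dominated_convergence[where w = "\<lambda>_. 1"])
    show "AE \<omega> in P. (\<lambda>n. iexp (\<Sum>j\<in>J. \<theta> j \<bullet> path_at (W n \<omega>) (t j))) \<longlonglongrightarrow> iexp (\<Sum>j\<in>J. \<theta> j \<bullet> path_at (B \<omega>) (t j))"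
      by (intro always_eventually allI tendsto_intros W_lim t)
    show "AE \<omega> in P. norm (iexp (\<Sum>j\<in>J. \<theta> j \<bullet> path_at (W n \<omega>) (t j))) \<le> 1" for n
      by (simp only: norm_exp_i_times) simp
  qed (auto intro: P.integrable_const)
  then have "(\<lambda>n. \<Prod>i<n * T. \<psi> (c n i)) \<longlonglongrightarrow> (CLINT \<omega>|P. iexp (\<Sum>j\<in>J. \<theta> j \<bullet> path_at (B \<omega>) (t j)))"
    by (rule Lim_transform_eventually) (use bm_char in \<open>auto intro!: eventually_sequentiallyI[of 1]\<close>)
  from tendsto_add[OF lim0 this] show ?thesis unfolding walk_char by simp
qed

text \<open>A Lipschitz function of the dyadic interpolation depends on finitely many values of the path,
  whose joint characteristic functions converge. The interpolation error is small uniformly in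
  \<open>n\<close> by chaining.\<close>

theorem donsker:
  assumes bm: "brownian_motion P covariance B"
  shows "converges_in_distribution M scaled_walk P B"
proof -
  have P: "prob_space P" and B [measurable]: "B \<in> borel_measurable P"
    using bm unfolding brownian_motion_def by blast+
  interpret P: prob_space P by (rule P)
  show ?thesis
  proof (rule converges_in_distribution_if_lipschitz[OF prob_space_axioms P])
    fix f :: "(real^'d) path \<Rightarrow> real" and L b
    assume f: "\<And>x. \<bar>f x\<bar> \<le> b" "\<And>x y. \<bar>f x - f y\<bar> \<le> L * dist x y"
    have f': "\<bar>f x - f y\<bar> \<le> \<bar>L\<bar> * dist x y" for x y
      by (rule order_trans[OF f(2)]) (intro mult_right_mono, auto)
    have cont: "continuous_on UNIV f"
      by (rule lipschitz_on_continuous_on[OF lipschitz_onI[of _ _ "\<bar>L\<bar>"]]) (auto simp: dist_real_def f')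
    have f_meas [measurable]: "f \<in> borel_measurable borel" by (rule borel_measurable_continuous_onI[OF cont])
    define I where "I m Y = dyadic_interp m (\<lambda>k. path_at Y (real k / 2 ^ m))" for m and Y :: "(real^'d) path"
    have I_meas: "(\<lambda>\<omega>. I m (Y \<omega>)) \<in> borel_measurable N"
      if [measurable]: "Y \<in> borel_measurable N" for N :: "'z measure" and m Y
      unfolding I_def by (rule measurable_dyadic_interp) measurable
    have [measurable]: "(\<lambda>\<omega>. I m (scaled_walk n \<omega>)) \<in> borel_measurable M" "(\<lambda>\<omega>. I m (B \<omega>)) \<in> borel_measurable P" for m n
      by (auto intro!: I_meas)
    have level: "(\<lambda>n. expectation (\<lambda>\<omega>. f (I m (scaled_walk n \<omega>)))) \<longlonglongrightarrow> P.expectation (\<lambda>\<omega>. f (I m (B \<omega>)))" for m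
    proof -
      define J where "J = {..Suc m * 2 ^ m}"
      define g where "g x = f (dyadic_interp m (\<lambda>k. if k \<in> J then x k else 0))" for x
      have gI: "g (\<lambda>k. path_at Y (real k / 2 ^ m)) = f (I m Y)" for Y
        unfolding g_def I_def dyadic_interp_def J_def by (intro arg_cong[of _ _ f] arg_cong2[of _ _ _ _ diffusive_path]) auto
      have "(\<lambda>n. expectation (\<lambda>\<omega>. g (\<lambda>k. path_at (scaled_walk n \<omega>) (real k / 2 ^ m)))) \<longlonglongrightarrow>
          P.expectation (\<lambda>\<omega>. g (\<lambda>k. path_at (B \<omega>) (real k / 2 ^ m)))"
      proof (rule vector_char_tendsto_imp_expectation_tendsto[where J = J and C = "\<bar>L\<bar>" and B = b, OF _ prob_space_axioms P])
        show "finite J" by (simp add: J_def)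
        show "(\<lambda>n. CLINT \<omega>|M. iexp (\<Sum>j\<in>J. \<theta> j \<bullet> path_at (scaled_walk n \<omega>) (real j / 2 ^ m))) \<longlonglongrightarrow>
            (CLINT \<omega>|P. iexp (\<Sum>j\<in>J. \<theta> j \<bullet> path_at (B \<omega>) (real j / 2 ^ m)))" for \<theta>
          by (rule scaled_walk_char_tendsto[OF bm]) (auto simp: J_def)
        show "g \<in> borel_measurable (PiM J (\<lambda>_. borel))"
          unfolding g_def[abs_def]
        proof (rule measurable_compose[OF _ f_meas])
          have "(\<lambda>x. if k \<in> J then x k else 0) \<in> borel_measurable (PiM J (\<lambda>_. borel :: (real^'d) measure))" for k
            by (cases "k \<in> J") auto
          then show "(\<lambda>x. dyadic_interp m (\<lambda>k. if k \<in> J then x k else 0 :: real^'d)) \<in> borel_measurable (PiM J (\<lambda>_. borel))"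
            by (rule measurable_dyadic_interp[where v = "\<lambda>x k. if k \<in> J then x k else 0"])
        qed
        show "\<bar>g y\<bar> \<le> b" for y unfolding g_def by (rule f(1))
        show "\<bar>g x - g y\<bar> \<le> \<bar>L\<bar> * (\<Sum>j\<in>J. norm (x j - y j))" for x y
        proof -
          let ?e = "\<lambda>z k. if k \<in> J then z k else (0 :: real^'d)"
          have "norm (path_at (dyadic_interp m (?e x)) u - path_at (dyadic_interp m (?e y)) u) \<le> (\<Sum>j\<in>J. norm (x j - y j))"
            if u: "0 \<le> u" for u
          proof -
            have "norm (?e x k - ?e y k) \<le> (\<Sum>j\<in>J. norm (x j - y j))" for k
              by (auto simp: J_def intro!: member_le_sum sum_nonneg)
            then have "norm (lerp (\<lambda>k. ?e x (min k (Suc m * 2 ^ m)) - ?e y (min k (Suc m * 2 ^ m))) (2 ^ m * u)) \<le> (\<Sum>j\<in>J. norm (x j - y j))"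
              using u by (intro norm_lerp_le[where N = "nat \<lceil>2 ^ m * u\<rceil>"]) (simp_all only: real_nat_ceiling_ge, simp)
            then show ?thesis using u by (simp only: path_at_dyadic_interp lerp_diff)
          qed
          then have "dist (dyadic_interp m (?e x)) (dyadic_interp m (?e y)) \<le> (\<Sum>j\<in>J. norm (x j - y j)) + (1/2) ^ T" for T
            by (intro dist_path_le) auto
          moreover have "(\<lambda>T. (\<Sum>j\<in>J. norm (x j - y j)) + (1/2) ^ T) \<longlonglongrightarrow> (\<Sum>j\<in>J. norm (x j - y j)) + 0"
            by (intro tendsto_intros LIMSEQ_power_zero) auto
          ultimately have "dist (dyadic_interp m (?e x)) (dyadic_interp m (?e y)) \<le> (\<Sum>j\<in>J. norm (x j - y j)) + 0"
            by (intro LIMSEQ_le_const) auto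
          then show ?thesis
            unfolding g_def by (intro order_trans[OF f'] mult_left_mono) auto
        qed
      qed auto
      then show ?thesis unfolding gI .
    qed
    define c where "c = 10 * (2 + 3 * (3 * real CARD('d) ^ 5 * K ^ 4))"
    have int: "integrable M (\<lambda>\<omega>. f (F \<omega>))" if [measurable]: "F \<in> borel_measurable M" for F
      by (rule integrable_const_bound[of _ b]) (use f(1) in auto)
    have close: "\<bar>expectation (\<lambda>\<omega>. f (I m (scaled_walk n \<omega>))) - expectation (\<lambda>\<omega>. f (scaled_walk n \<omega>))\<bar> \<le> \<bar>L\<bar> * (c * (9/10) ^ m)" for m n
    proof -
      have id: "integrable M (\<lambda>\<omega>. dist (I m (scaled_walk n \<omega>)) (scaled_walk n \<omega>))"
        by (rule integrable_const_bound[of _ 1]) (auto simp: dist_path_le_1)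
      have "\<bar>expectation (\<lambda>\<omega>. f (I m (scaled_walk n \<omega>))) - expectation (\<lambda>\<omega>. f (scaled_walk n \<omega>))\<bar>
          = \<bar>expectation (\<lambda>\<omega>. f (I m (scaled_walk n \<omega>)) - f (scaled_walk n \<omega>))\<bar>"
        by (subst Bochner_Integration.integral_diff) (auto intro!: int)
      also have "\<dots> \<le> expectation (\<lambda>\<omega>. \<bar>f (I m (scaled_walk n \<omega>)) - f (scaled_walk n \<omega>)\<bar>)" by (rule integral_abs_bound)
      also have "\<dots> \<le> expectation (\<lambda>\<omega>. \<bar>L\<bar> * dist (I m (scaled_walk n \<omega>)) (scaled_walk n \<omega>))"
        by (intro integral_mono integrable_abs Bochner_Integration.integrable_diff int integrable_mult_right id f') auto
      also have "\<dots> = \<bar>L\<bar> * expectation (\<lambda>\<omega>. dist (I m (scaled_walk n \<omega>)) (scaled_walk n \<omega>))" by simp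
      also have "\<dots> \<le> \<bar>L\<bar> * (c * (9/10) ^ m)"
        unfolding c_def I_def by (intro mult_left_mono scaled_walk_chaining) auto
      finally show ?thesis .
    qed
    show "(\<lambda>n. expectation (\<lambda>\<omega>. f (scaled_walk n \<omega>))) \<longlonglongrightarrow> P.expectation (\<lambda>\<omega>. f (B \<omega>))"
    proof (rule tendstoI)
      fix e :: real assume e: "0 < e"
      have "(\<lambda>m. P.expectation (\<lambda>\<omega>. f (I m (B \<omega>)))) \<longlonglongrightarrow> P.expectation (\<lambda>\<omega>. f (B \<omega>))"
      proof (rule integral_dominated_convergence[where w = "\<lambda>_. b"])
        show "AE \<omega> in P. (\<lambda>m. f (I m (B \<omega>))) \<longlonglongrightarrow> f (B \<omega>)"
          unfolding I_def
          by (intro always_eventually allI continuous_on_tendsto_compose[OF cont dyadic_interp_tendsto]) auto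
      qed (use f(1) in auto)
      then have 1: "\<forall>\<^sub>F m in sequentially. dist (P.expectation (\<lambda>\<omega>. f (I m (B \<omega>)))) (P.expectation (\<lambda>\<omega>. f (B \<omega>))) < e / 3"
        using e by (intro tendstoD) auto
      have "(\<lambda>m. \<bar>L\<bar> * (c * (9/10) ^ m)) \<longlonglongrightarrow> \<bar>L\<bar> * (c * 0)"
        by (intro tendsto_intros LIMSEQ_power_zero) auto
      then have "\<forall>\<^sub>F m in sequentially. \<bar>L\<bar> * (c * (9/10) ^ m) < e / 3"
        using e by (intro order_tendstoD(2)) auto
      with 1 have "\<forall>\<^sub>F m in sequentially. dist (P.expectation (\<lambda>\<omega>. f (I m (B \<omega>)))) (P.expectation (\<lambda>\<omega>. f (B \<omega>))) < e / 3 \<and>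
          \<bar>L\<bar> * (c * (9/10) ^ m) < e / 3" by (rule eventually_conj)
      then obtain m where m: "dist (P.expectation (\<lambda>\<omega>. f (I m (B \<omega>)))) (P.expectation (\<lambda>\<omega>. f (B \<omega>))) < e / 3"
          "\<bar>L\<bar> * (c * (9/10) ^ m) < e / 3"
        unfolding eventually_sequentially by blast
      have "\<forall>\<^sub>F n in sequentially. dist (expectation (\<lambda>\<omega>. f (I m (scaled_walk n \<omega>)))) (P.expectation (\<lambda>\<omega>. f (I m (B \<omega>)))) < e / 3"
        using level[of m] e by (intro tendstoD) auto
      then show "\<forall>\<^sub>F n in sequentially. dist (expectation (\<lambda>\<omega>. f (scaled_walk n \<omega>))) (P.expectation (\<lambda>\<omega>. f (B \<omega>))) < e"
      proof eventually_elim
        case (elim n)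
        then show ?case using m close[of m n] unfolding dist_real_def by linarith
      qed
    qed
  qed measurable
qed

end

section \<open>Recurrence of planar walks\<close>

lemma (in prob_space) indep_vars_inj_reindex:
  assumes X: "indep_vars (\<lambda>_. N) X I" and \<tau>: "inj_on \<tau> J" "\<tau> ` J \<subseteq> I"
  shows "indep_vars (\<lambda>_. N) (\<lambda>i. X (\<tau> i)) J"
proof -
  let ?F = "\<lambda>k. {X k -` S \<inter> space M | S. S \<in> sets N}"
  have rv: "random_variable N (X k)" if "k \<in> I" for k using X that by (auto simp: indep_vars_def)
  have ind: "indep_sets ?F I" using X by (simp add: indep_vars_def2)
  have "indep_sets (\<lambda>j. ?F (\<tau> j)) J"
  proof (rule indep_setsI)
    show "?F (\<tau> j) \<subseteq> events" if "j \<in> J" for j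
      using rv[of "\<tau> j"] that \<tau>(2) by (auto dest: measurable_sets)
    fix A J' assume J': "J' \<noteq> {}" "J' \<subseteq> J" "finite J'" and A: "\<forall>j\<in>J'. A j \<in> ?F (\<tau> j)"
    have inj: "inj_on \<tau> J'" using \<tau>(1) J'(2) by (rule inj_on_subset)
    define A' where "A' k = A (inv_into J' \<tau> k)" for k
    have A': "A' (\<tau> j) = A j" if "j \<in> J'" for j using that inj by (simp add: A'_def)
    have "prob (\<Inter>j\<in>J'. A j) = prob (\<Inter>k\<in>\<tau> ` J'. A' k)"
      by (intro arg_cong[of _ _ prob]) (simp add: A')
    also have "\<dots> = (\<Prod>k\<in>\<tau> ` J'. prob (A' k))"
      by (rule indep_setsD[OF ind]) (use J' \<tau>(2) A A' in auto)
    also have "\<dots> = (\<Prod>j\<in>J'. prob (A j))"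
      by (simp add: prod.reindex[OF inj] A')
    finally show "prob (\<Inter>j\<in>J'. A j) = (\<Prod>j\<in>J'. prob (A j))" .
  qed
  then show ?thesis unfolding indep_vars_def2 using rv \<tau>(2) by auto
qed

context centered_bounded_steps
begin

text \<open>The joint law of \<open>N\<close> distinct steps is a product of \<open>N\<close> copies of one law, whichever steps are
  taken and in whatever order; this covers shifts and reversals of time.\<close>

lemma steps_law_reindex:
  assumes inj: "inj_on \<sigma> {..<N}" and A: "A \<in> sets (PiM {..<N} (\<lambda>_. borel))"
  shows "prob {\<omega> \<in> space M. (\<lambda>i\<in>{..<N}. \<xi> (\<sigma> i) \<omega>) \<in> A} = prob {\<omega> \<in> space M. (\<lambda>i\<in>{..<N}. \<xi> i \<omega>) \<in> A}"
proof (cases "N = 0")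
  case True
  then show ?thesis by (simp add: restrict_def)
next
  case False
  have law: "distr M (PiM {..<N} (\<lambda>_. borel)) (\<lambda>\<omega>. \<lambda>i\<in>{..<N}. \<xi> (\<tau> i) \<omega>) = PiM {..<N} (\<lambda>_. distr M borel (\<xi> 0))"
    if \<tau>: "inj_on \<tau> {..<N}" for \<tau>
  proof -
    have ne: "{..<N} \<noteq> {}" using False by (auto intro!: exI[of _ "0::nat"])
    have "indep_vars (\<lambda>_. borel) (\<lambda>i. \<xi> (\<tau> i)) {..<N}"
      by (rule indep_vars_inj_reindex[OF indep_steps \<tau>]) simp
    moreover have "indep_vars (\<lambda>_. borel) (\<lambda>i. \<xi> (\<tau> i)) {..<N} \<longleftrightarrow>
        distr M (PiM {..<N} (\<lambda>_. borel)) (\<lambda>\<omega>. \<lambda>i\<in>{..<N}. \<xi> (\<tau> i) \<omega>) = PiM {..<N} (\<lambda>i. distr M borel (\<xi> (\<tau> i)))"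
      by (rule indep_vars_iff_distr_eq_PiM[OF ne steps_meas])
    ultimately have "distr M (PiM {..<N} (\<lambda>_. borel)) (\<lambda>\<omega>. \<lambda>i\<in>{..<N}. \<xi> (\<tau> i) \<omega>) = PiM {..<N} (\<lambda>i. distr M borel (\<xi> (\<tau> i)))"
      by (rule iffD1[rotated])
    moreover have "(\<lambda>i. distr M borel (\<xi> (\<tau> i))) = (\<lambda>_. distr M borel (\<xi> 0))"
      by (rule ext) (rule same_law)
    ultimately show ?thesis by (simp only:)
  qed
  have "prob {\<omega> \<in> space M. (\<lambda>i\<in>{..<N}. \<xi> (\<tau> i) \<omega>) \<in> A} = measure (PiM {..<N} (\<lambda>_. distr M borel (\<xi> 0))) A"
    if \<tau>: "inj_on \<tau> {..<N}" for \<tau>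
  proof -
    have m: "(\<lambda>\<omega>. \<lambda>i\<in>{..<N}. \<xi> (\<tau> i) \<omega>) \<in> measurable M (PiM {..<N} (\<lambda>_. borel))" by measurable
    have "{\<omega> \<in> space M. (\<lambda>i\<in>{..<N}. \<xi> (\<tau> i) \<omega>) \<in> A} = (\<lambda>\<omega>. \<lambda>i\<in>{..<N}. \<xi> (\<tau> i) \<omega>) -` A \<inter> space M" by auto
    then show ?thesis unfolding law[OF \<tau>, symmetric] measure_distr[OF m A] by simp
  qed
  from this[OF inj] this[of "\<lambda>i. i"] show ?thesis by (simp add: inj_on_def)
qed

definition non_returning :: "nat \<Rightarrow> (nat \<Rightarrow> real^'d) set" where
  "non_returning N = {x \<in> space (PiM {..<N} (\<lambda>_. borel)). \<forall>j\<in>{1..N}. (\<Sum>i<j. x i) \<noteq> 0}"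

definition no_return_prob :: "nat \<Rightarrow> real" where
  "no_return_prob N = prob {\<omega> \<in> space M. \<forall>j\<in>{1..N}. walk j \<omega> \<noteq> 0}"

lemma sets_non_returning [measurable]: "non_returning N \<in> sets (PiM {..<N} (\<lambda>_. borel))"
proof -
  have [measurable]: "(\<lambda>x. \<Sum>i<j. x i) \<in> borel_measurable (PiM {..<N} (\<lambda>_. borel :: (real^'d) measure))" if "j \<in> {1..N}" for j
    using that by (intro borel_measurable_sum measurable_component_singleton) auto
  show ?thesis unfolding non_returning_def
    by (intro sets.sets_Collect_finite_All) (auto simp del: sum_eq_0_iff)
qed

lemma mem_non_returning_iff:
  "(\<lambda>i\<in>{..<N}. x i) \<in> non_returning N \<longleftrightarrow> (\<forall>j\<in>{1..N}. (\<Sum>i<j. x i) \<noteq> 0)"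
proof -
  have "(\<Sum>i<j. (\<lambda>i\<in>{..<N}. x i) i) = (\<Sum>i<j. x i)" if "j \<in> {1..N}" for j
    using that by (intro sum.cong) auto
  then show ?thesis by (auto simp: non_returning_def space_PiM)
qed

lemma no_return_prob_reindex:
  assumes "inj_on \<sigma> {..<N}"
  shows "prob {\<omega> \<in> space M. \<forall>j\<in>{1..N}. (\<Sum>i<j. \<xi> (\<sigma> i) \<omega>) \<noteq> 0} = no_return_prob N"
  using steps_law_reindex[OF assms sets_non_returning]
  by (simp add: mem_non_returning_iff no_return_prob_def walk_def)

lemma no_return_prob_antimono: "N \<le> N' \<Longrightarrow> no_return_prob N' \<le> no_return_prob N"
  unfolding no_return_prob_def by (intro finite_measure_mono) (auto, measurable)

text \<open>The position at time \<open>n\<close> and the walk after time \<open>n\<close> depend on disjoint sets of steps.\<close>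

lemma prob_ball_and_no_return:
  "prob {\<omega> \<in> space M. norm (walk n \<omega>) \<le> R \<and> (\<forall>j\<in>{1..N}. walk (n + j) \<omega> \<noteq> walk n \<omega>)}
    = prob {\<omega> \<in> space M. norm (walk n \<omega>) \<le> R} * no_return_prob N"
proof -
  let ?P = "\<lambda>I. PiM I (\<lambda>_. borel :: (real^'d) measure)"
  define A where "A = {x \<in> space (?P {..<n}). norm (\<Sum>i<n. x i) \<le> R}"
  define B where "B = {x \<in> space (?P {n..<n + N}). \<forall>j\<in>{1..N}. (\<Sum>i<j. x (n + i)) \<noteq> 0}"
  have A: "A \<in> sets (?P {..<n})" unfolding A_def by measurable
  have B: "B \<in> sets (?P {n..<n + N})"
  proof -
    have [measurable]: "(\<lambda>x. \<Sum>i<j. x (n + i)) \<in> borel_measurable (?P {n..<n + N})" if "j \<in> {1..N}" for j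
      using that by (intro borel_measurable_sum measurable_component_singleton) auto
    show ?thesis unfolding B_def
      by (intro sets.sets_Collect_finite_All) (auto simp del: sum_eq_0_iff)
  qed
  let ?f = "\<lambda>\<omega>. restrict (\<lambda>i. \<xi> i \<omega>) {..<n}" and ?g = "\<lambda>\<omega>. restrict (\<lambda>i. \<xi> i \<omega>) {n..<n + N}"
  have ind: "indep_var (?P {..<n}) ?f (?P {n..<n + N}) ?g"
    by (rule indep_var_restrict[OF indep_steps]) auto
  have fA: "?f \<omega> \<in> A \<longleftrightarrow> norm (walk n \<omega>) \<le> R" for \<omega>
    by (simp add: A_def walk_def space_PiM)
  have gB: "?g \<omega> \<in> B \<longleftrightarrow> (\<forall>j\<in>{1..N}. (\<Sum>i<j. \<xi> (n + i) \<omega>) \<noteq> 0)" for \<omega>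
  proof -
    have "(\<Sum>i<j. ?g \<omega> (n + i)) = (\<Sum>i<j. \<xi> (n + i) \<omega>)" if "j \<in> {1..N}" for j
      using that by (intro sum.cong) auto
    then show ?thesis by (auto simp: B_def space_PiM)
  qed
  have incr: "walk (n + j) \<omega> = walk n \<omega> + (\<Sum>i<j. \<xi> (n + i) \<omega>)" for j \<omega>
    by (induction j) (auto simp: walk_def)
  have "prob {\<omega> \<in> space M. norm (walk n \<omega>) \<le> R \<and> (\<forall>j\<in>{1..N}. walk (n + j) \<omega> \<noteq> walk n \<omega>)}
      = prob ((\<lambda>\<omega>. (?f \<omega>, ?g \<omega>)) -` (A \<times> B) \<inter> space M)"
    by (intro arg_cong[of _ _ prob]) (auto simp: fA gB incr)
  also have "\<dots> = prob (?f -` A \<inter> space M) * prob (?g -` B \<inter> space M)"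
    by (rule indep_varD[OF ind A B])
  also have "?f -` A \<inter> space M = {\<omega> \<in> space M. norm (walk n \<omega>) \<le> R}" by (auto simp: fA)
  also have "prob (?g -` B \<inter> space M) = no_return_prob N"
    unfolding no_return_prob_reindex[of "\<lambda>i. n + i" N, symmetric, OF inj_on_add]
    by (intro arg_cong[of _ _ prob]) (auto simp: gB)
  finally show ?thesis .
qed

end

lemma card_lattice_ball:
  "finite {x :: real^2. (\<forall>j. x $ j \<in> \<int>) \<and> norm x \<le> real R}"
  "card {x :: real^2. (\<forall>j. x $ j \<in> \<int>) \<and> norm x \<le> real R} \<le> (2 * R + 1)\<^sup>2"
proof -
  let ?L = "{x :: real^2. (\<forall>j. x $ j \<in> \<int>) \<and> norm x \<le> real R}"
  let ?f = "\<lambda>x :: real^2. (\<lfloor>x $ 1\<rfloor>, \<lfloor>x $ 2\<rfloor>)"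
  have inj: "inj_on ?f ?L"
  proof (rule inj_onI)
    fix x y assume x: "x \<in> ?L" and y: "y \<in> ?L" and e: "?f x = ?f y"
    have fl: "z \<in> ?L \<Longrightarrow> real_of_int \<lfloor>z $ j\<rfloor> = z $ j" for z j by (auto elim!: Ints_cases)
    have "x $ 1 = y $ 1" "x $ 2 = y $ 2"
      using e fl[OF x] fl[OF y] by (metis prod.inject)+
    then show "x = y" by (simp add: vec_eq_iff forall_2)
  qed
  have sub: "?f ` ?L \<subseteq> {- int R..int R} \<times> {- int R..int R}"
  proof
    fix p assume "p \<in> ?f ` ?L"
    then obtain x where x: "x \<in> ?L" "p = ?f x" by auto
    have "\<lfloor>x $ j\<rfloor> \<in> {- int R..int R}" for j
    proof -
      have "\<bar>x $ j\<bar> \<le> real R" using component_le_norm_cart[of x j] x(1) by simp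
      then have "- real R \<le> x $ j" "x $ j \<le> real R" by linarith+
      then show ?thesis by (auto simp: le_floor_iff floor_le_iff)
    qed
    then show "p \<in> {- int R..int R} \<times> {- int R..int R}" using x(2) by simp
  qed
  have fin: "finite ({- int R..int R} \<times> {- int R..int R})" by simp
  have "card ?L = card (?f ` ?L)" by (rule card_image[OF inj, symmetric])
  also have "\<dots> \<le> card ({- int R..int R} \<times> {- int R..int R})" by (rule card_mono[OF fin sub])
  also have "\<dots> = (2 * R + 1)\<^sup>2" by (simp add: card_cartesian_product power2_eq_square nat_add_distrib nat_mult_distrib)
  finally show "card ?L \<le> (2 * R + 1)\<^sup>2" .
  show "finite ?L" using finite_imageD[OF finite_subset[OF sub fin] inj] .
qed

locale planar_lattice_steps = centered_bounded_steps M \<xi> K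
  for M :: "'a measure" and \<xi> :: "nat \<Rightarrow> 'a \<Rightarrow> real^2" and K :: real +
  assumes integral_steps: "\<And>i \<omega> j. \<omega> \<in> space M \<Longrightarrow> \<xi> i \<omega> $ j \<in> \<int>"
    and nondegenerate: "\<And>v. v \<noteq> 0 \<Longrightarrow> 0 < v \<bullet> (covariance *v v)"
begin

lemma integral_walk: "\<omega> \<in> space M \<Longrightarrow> walk n \<omega> $ j \<in> \<int>"
  by (auto simp: walk_def intro!: Ints_sum integral_steps)

text \<open>Each lattice point of a ball has at most one visit before time \<open>N\<close> that is not followed by a
  further visit during the next \<open>N\<close> steps.\<close>

lemma visits_times_no_return_le:
  "(\<Sum>n<N. prob {\<omega> \<in> space M. norm (walk n \<omega>) \<le> real R}) * no_return_prob N \<le> (2 * real R + 1)\<^sup>2"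
proof -
  define A where "A n = {\<omega> \<in> space M. norm (walk n \<omega>) \<le> real R \<and> (\<forall>j\<in>{1..N}. walk (n + j) \<omega> \<noteq> walk n \<omega>)}" for n
  have A_meas [measurable]: "A n \<in> events" for n unfolding A_def by measurable
  have ind_int: "integrable M (indicator (A n) :: 'a \<Rightarrow> real)" for n
    by (rule integrable_const_bound[of _ 1]) (auto simp: indicator_def)
  have count: "(\<Sum>n<N. indicator (A n) \<omega>) \<le> (2 * real R + 1)\<^sup>2" if \<omega>: "\<omega> \<in> space M" for \<omega>
  proof -
    \<comment> \<open>Two such times with the same position would be less than \<open>N\<close> apart.\<close>
    let ?T = "{n \<in> {..<N}. \<omega> \<in> A n}"
    have "inj_on (\<lambda>n. walk n \<omega>) ?T"
    proof (rule linorder_inj_onI)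
      fix m n assume mn: "m < n" "m \<in> ?T" "n \<in> ?T"
      then have "n - m \<in> {1..N}" by auto
      then have "walk (m + (n - m)) \<omega> \<noteq> walk m \<omega>" using mn(2) unfolding A_def by blast
      then show "walk m \<omega> \<noteq> walk n \<omega>" using mn(1) by auto
    qed auto
    then have "card ?T = card ((\<lambda>n. walk n \<omega>) ` ?T)" by (rule card_image[symmetric])
    also have "\<dots> \<le> card {x :: real^2. (\<forall>j. x $ j \<in> \<int>) \<and> norm x \<le> real R}"
      by (rule card_mono[OF card_lattice_ball(1)]) (auto simp: A_def integral_walk)
    also have "\<dots> \<le> (2 * R + 1)\<^sup>2" by (rule card_lattice_ball(2))
    finally have "real (card ?T) \<le> real ((2 * R + 1)\<^sup>2)" by (rule of_nat_mono)
    moreover have "(\<Sum>n<N. indicator (A n) \<omega>) = real (card ?T)"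
      by (simp add: indicator_def sum.If_cases Int_def)
    ultimately show ?thesis by (simp add: add.commute)
  qed
  have "(\<Sum>n<N. prob {\<omega> \<in> space M. norm (walk n \<omega>) \<le> real R}) * no_return_prob N = (\<Sum>n<N. prob (A n))"
    unfolding A_def prob_ball_and_no_return sum_distrib_right ..
  also have "\<dots> = expectation (\<lambda>\<omega>. \<Sum>n<N. indicator (A n) \<omega>)"
    using ind_int by (subst Bochner_Integration.integral_sum) auto
  also have "\<dots> \<le> expectation (\<lambda>\<omega>. (2 * real R + 1)\<^sup>2)"
    by (rule integral_mono_AE) (use count ind_int in \<open>auto intro!: AE_I2\<close>)
  finally show ?thesis by (simp add: prob_space)
qed

text \<open>By the central limit theorem the walk is within distance \<open>r sqrt n\<close> of the origin with
  probability at least of order \<open>r\<^sup>2\<close>: the limiting Gaussian law has this property.\<close>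

lemma small_ball_prob:
  "\<exists>c>0. \<forall>r. 0 < r \<and> r \<le> 1 \<longrightarrow>
    (\<forall>\<^sub>F n in sequentially. c * r\<^sup>2 \<le> prob {\<omega> \<in> space M. norm (walk n \<omega>) \<le> r * sqrt (real n)})"
proof -
  obtain \<nu> c where \<nu>: "prob_space \<nu>" "sets \<nu> = sets borel"
    "\<And>\<theta>. (CLINT x|\<nu>. iexp (\<theta> \<bullet> x)) = complex_of_real (exp (- (\<theta> \<bullet> (covariance *v \<theta>)) / 2))"
    and c: "0 < c" "\<And>r. 0 < r \<Longrightarrow> r \<le> 1 \<Longrightarrow> c * r\<^sup>2 \<le> measure \<nu> (cball 0 r)"
    using planar_gaussian_exists[OF covariance_sym nondegenerate] by blast
  obtain P :: "(real^2) path measure" and B where bm: "brownian_motion P covariance B"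
    using brownian_motion_exists[OF covariance_sym nondegenerate \<nu>] by blast
  have P: "prob_space P" and B [measurable]: "B \<in> borel_measurable P" and B0: "AE \<omega> in P. path_at (B \<omega>) 0 = 0"
    using bm unfolding brownian_motion_def by blast+
  interpret \<nu>: prob_space \<nu> by (rule \<nu>(1))
  note \<nu>(2)[measurable_cong]
  have char1: "(CLINT \<omega>|P. iexp (\<theta> \<bullet> path_at (B \<omega>) 1)) = (CLINT x|\<nu>. iexp (\<theta> \<bullet> x))" for \<theta>
  proof -
    have "(CLINT \<omega>|P. iexp (\<theta> \<bullet> path_at (B \<omega>) 1)) = (CLINT \<omega>|P. iexp (\<Sum>i<1. \<theta> \<bullet> (path_at (B \<omega>) (real (Suc i)) - path_at (B \<omega>) (real i))))"
    proof (rule integral_cong_AE)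
      show "AE \<omega> in P. iexp (\<theta> \<bullet> path_at (B \<omega>) 1) = iexp (\<Sum>i<1. \<theta> \<bullet> (path_at (B \<omega>) (real (Suc i)) - path_at (B \<omega>) (real i)))"
        using B0 by eventually_elim simp
    qed measurable
    also have "\<dots> = (CLINT x|\<nu>. iexp (\<theta> \<bullet> x))"
      by (subst brownian_motion_char[OF bm]) (auto simp: mono_on_def \<nu>(3))
    finally show ?thesis .
  qed
  have walk_1: "path_at (scaled_walk n \<omega>) 1 = walk n \<omega> /\<^sub>R sqrt (real n)" for n \<omega>
    by (simp add: scaled_walk_def path_at_diffusive_path)
  have main: "\<forall>\<^sub>F n in sequentially. c / 8 * r\<^sup>2 \<le> prob {\<omega> \<in> space M. norm (walk n \<omega>) \<le> r * sqrt (real n)}"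
    if r: "0 < r" "r \<le> 1" for r
  proof -
    \<comment> \<open>\<open>h\<close> lies between the indicators of the balls of radius \<open>r / 2\<close> and \<open>r\<close>.\<close>
    define h where "h x = max 0 (min 1 (2 - 2 / r * norm x))" for x :: "real^2"
    have h01: "0 \<le> h x" "h x \<le> 1" for x by (auto simp: h_def)
    have h_meas [measurable]: "h \<in> borel_measurable borel" unfolding h_def[abs_def] by measurable
    have h_lip: "\<bar>h x - h y\<bar> \<le> 2 / r * norm (x - y)" for x y
    proof -
      have "\<bar>h x - h y\<bar> \<le> \<bar>2 / r * norm x - 2 / r * norm y\<bar>" unfolding h_def by linarith
      also have "\<dots> = 2 / r * \<bar>norm x - norm y\<bar>" using r by (simp only: right_diff_distrib[symmetric] abs_mult) simp
      also have "\<dots> \<le> 2 / r * norm (x - y)" using r by (intro mult_left_mono norm_triangle_ineq3) auto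
      finally show ?thesis .
    qed
    have "(\<lambda>n. expectation (\<lambda>\<omega>. h (path_at (scaled_walk n \<omega>) 1))) \<longlonglongrightarrow> \<nu>.expectation h"
    proof (rule vector_char_tendsto_imp_expectation_tendsto[where J = "{0::nat}" and g = "\<lambda>x. h (x 0)"
          and Y = "\<lambda>n \<omega> _. path_at (scaled_walk n \<omega>) 1" and Z = "\<lambda>x _. x" and B = 1 and C = "2 / r",
          OF _ prob_space_axioms \<nu>(1)])
      show "(\<lambda>n. CLINT \<omega>|M. iexp (\<Sum>j\<in>{0::nat}. \<theta> j \<bullet> path_at (scaled_walk n \<omega>) 1)) \<longlonglongrightarrow> (CLINT \<omega>|\<nu>. iexp (\<Sum>j\<in>{0}. \<theta> j \<bullet> \<omega>))" for \<theta>
        using scaled_walk_char_tendsto[OF bm, of "{0::nat}" "\<lambda>_. 1" \<theta>] by (simp add: char1)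
      show "(\<lambda>x. h (x 0)) \<in> borel_measurable (PiM {0::nat} (\<lambda>_. borel))" by measurable
      show "\<bar>h (y 0)\<bar> \<le> 1" for y :: "nat \<Rightarrow> real^2" using h01[of "y 0"] by simp
      show "\<bar>h (x 0) - h (y 0)\<bar> \<le> 2 / r * (\<Sum>j\<in>{0::nat}. norm (x j - y j))" for x y using h_lip by simp
    qed auto
    moreover have "c / 8 * r\<^sup>2 < \<nu>.expectation h"
    proof -
      have "c / 8 * r\<^sup>2 < c * (r / 2)\<^sup>2" using c(1) r by (simp add: power_divide)
      also have "\<dots> \<le> measure \<nu> (cball 0 (r / 2))" by (rule c(2)) (use r in auto)
      also have "\<dots> = \<nu>.expectation (indicator (cball 0 (r / 2)))" by simp
      also have "\<dots> \<le> \<nu>.expectation h"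
      proof (rule integral_mono)
        show "integrable \<nu> (indicator (cball 0 (r / 2)) :: real^2 \<Rightarrow> real)"
          by (intro integrable_real_indicator) (auto simp: \<nu>(2) \<nu>.emeasure_eq_measure)
        show "integrable \<nu> h" by (rule \<nu>.integrable_const_bound[of _ 1]) (use h01 in auto)
        show "indicator (cball 0 (r / 2)) x \<le> h x" for x :: "real^2"
          using r h01[of x] by (auto simp: indicator_def h_def field_simps)
      qed
      finally show ?thesis .
    qed
    ultimately have "\<forall>\<^sub>F n in sequentially. c / 8 * r\<^sup>2 < expectation (\<lambda>\<omega>. h (path_at (scaled_walk n \<omega>) 1))"
      by (rule order_tendstoD(1))
    then show ?thesis using eventually_gt_at_top[of 0]
    proof eventually_elim
      case (elim n)
      have "expectation (\<lambda>\<omega>. h (path_at (scaled_walk n \<omega>) 1)) \<le> expectation (indicator {\<omega> \<in> space M. norm (walk n \<omega>) \<le> r * sqrt (real n)})"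
      proof (rule integral_mono)
        show "integrable M (\<lambda>\<omega>. h (path_at (scaled_walk n \<omega>) 1))"
          by (rule integrable_const_bound[of _ 1]) (use h01 in auto)
        show "integrable M (indicator {\<omega> \<in> space M. norm (walk n \<omega>) \<le> r * sqrt (real n)} :: 'a \<Rightarrow> real)"
          by (rule integrable_const_bound[of _ 1]) (auto simp: indicator_def)
        fix \<omega> assume \<omega>: "\<omega> \<in> space M"
        show "h (path_at (scaled_walk n \<omega>) 1) \<le> indicator {\<omega> \<in> space M. norm (walk n \<omega>) \<le> r * sqrt (real n)} \<omega>"
        proof (cases "norm (walk n \<omega>) \<le> r * sqrt (real n)")
          case True
          then show ?thesis using h01 \<omega> by simp
        next
          case False
          then have "r < norm (walk n \<omega> /\<^sub>R sqrt (real n))"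
            using elim(2) by (simp add: field_simps)
          then have "2 \<le> 2 / r * norm (walk n \<omega> /\<^sub>R sqrt (real n))"
          proof -
            have "2 / r * r \<le> 2 / r * norm (walk n \<omega> /\<^sub>R sqrt (real n))"
              using r \<open>r < norm (walk n \<omega> /\<^sub>R sqrt (real n))\<close> by (intro mult_left_mono) auto
            then show ?thesis using r by simp
          qed
          then have "h (path_at (scaled_walk n \<omega>) 1) = 0" by (simp only: h_def walk_1)
          then show ?thesis by simp
        qed
      qed
      then show ?case using elim(1) by simp
    qed
  qed
  show ?thesis using c(1) main by (intro exI[of _ "c / 8"]) auto
qed

text \<open>Recurrence: summing the small ball estimates over blocks of length \<open>R\<^sup>2\<close>, the expected number of
  visits to a ball of radius \<open>R\<close> before time \<open>J R\<^sup>2\<close> exceeds \<open>R\<^sup>2\<close> by a factor of order \<open>log J\<close>.\<close>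

theorem no_return_prob_tendsto: "no_return_prob \<longlonglongrightarrow> 0"
proof -
  obtain c where c: "0 < c" "\<And>r. 0 < r \<Longrightarrow> r \<le> 1 \<Longrightarrow>
    (\<forall>\<^sub>F n in sequentially. c * r\<^sup>2 \<le> prob {\<omega> \<in> space M. norm (walk n \<omega>) \<le> r * sqrt (real n)})"
    using small_ball_prob by blast
  have small: "\<exists>N. no_return_prob N < e" if e: "0 < e" for e
  proof -
    have "\<exists>J. 9 / (c * e) + 1 < (\<Sum>j<J. 1 / real (Suc j))"
    proof (rule ccontr)
      assume "\<not> ?thesis"
      then have "summable (\<lambda>j. 1 / real (Suc j))"
        by (intro summableI_nonneg_bounded[of _ "9 / (c * e) + 1"]) (auto simp: not_less)
      then show False using not_summable_harmonic[where 'a = real]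
        by (simp only: inverse_eq_divide summable_Suc_iff[of "\<lambda>n. 1 / real n"] simp_thms)
    qed
    then obtain J where J: "9 / (c * e) + 1 < (\<Sum>j<J. 1 / real (Suc j))" by blast
    have "\<forall>\<^sub>F n in sequentially. \<forall>j\<in>{..<J}. c * (1 / sqrt (real (Suc j)))\<^sup>2 \<le>
        prob {\<omega> \<in> space M. norm (walk n \<omega>) \<le> 1 / sqrt (real (Suc j)) * sqrt (real n)}"
      by (intro eventually_ball_finite ballI c(2)) auto
    then obtain n0 where n0: "\<And>n j. n \<ge> n0 \<Longrightarrow> j < J \<Longrightarrow> c * (1 / sqrt (real (Suc j)))\<^sup>2 \<le>
        prob {\<omega> \<in> space M. norm (walk n \<omega>) \<le> 1 / sqrt (real (Suc j)) * sqrt (real n)}"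
      unfolding eventually_sequentially by blast
    define R where "R = max n0 1"
    define k where "k = R\<^sup>2"
    have R: "1 \<le> R" "n0 \<le> k"
    proof -
      show "1 \<le> R" by (simp add: R_def)
      then have "R \<le> k" unfolding k_def power2_eq_square by simp
      then show "n0 \<le> k" by (simp add: R_def)
    qed
    define p where "p n = prob {\<omega> \<in> space M. norm (walk n \<omega>) \<le> real R}" for n
    \<comment> \<open>In the block of times before \<open>(j + 1) R\<^sup>2\<close> the radius \<open>R\<close> is at least \<open>sqrt n\<close> times
      \<open>1 / sqrt (j + 1)\<close>. The block \<open>j = 0\<close> is left out, as the estimate holds for \<open>n \<ge> n0\<close> only.\<close>
    have block: "c / real (Suc j) \<le> p n" if j: "j < J" "1 \<le> j" and n: "n \<in> {j * k..<j * k + k}" for j n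
    proof -
      have "1 * k \<le> j * k" using j(2) by (rule mult_le_mono1)
      moreover have "j * k \<le> n" using n by simp
      ultimately have "n0 \<le> n" using R(2) by linarith
      then have "c * (1 / sqrt (real (Suc j)))\<^sup>2 \<le> prob {\<omega> \<in> space M. norm (walk n \<omega>) \<le> 1 / sqrt (real (Suc j)) * sqrt (real n)}"
        using j(1) by (rule n0)
      also have "\<dots> \<le> p n"
        unfolding p_def
      proof (rule finite_measure_mono)
        have "n \<le> Suc j * k" using n by simp
        then have "real n \<le> real (Suc j) * (real R)\<^sup>2" by (metis k_def of_nat_mono of_nat_mult of_nat_power)
        then have "sqrt (real n) \<le> sqrt (real (Suc j) * (real R)\<^sup>2)" by (rule real_sqrt_le_mono)
        also have "\<dots> = sqrt (real (Suc j)) * real R" by (simp add: real_sqrt_mult)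
        finally have "1 / sqrt (real (Suc j)) * sqrt (real n) \<le> real R" by (simp add: field_simps)
        then show "{\<omega> \<in> space M. norm (walk n \<omega>) \<le> 1 / sqrt (real (Suc j)) * sqrt (real n)} \<subseteq> {\<omega> \<in> space M. norm (walk n \<omega>) \<le> real R}"
          by auto
      qed measurable
      also have "c * (1 / sqrt (real (Suc j)))\<^sup>2 = c / real (Suc j)" by (simp add: power_divide)
      finally show ?thesis .
    qed
    have "real k * (9 / e) < real k * (c * ((\<Sum>j<J. 1 / real (Suc j)) - 1))"
    proof -
      have "9 / e = c * (9 / (c * e))" using c(1) e by simp
      also have "\<dots> < c * ((\<Sum>j<J. 1 / real (Suc j)) - 1)" using J c(1) by (intro mult_strict_left_mono) auto
      finally show ?thesis using R(1) by (intro mult_strict_left_mono) (auto simp: k_def)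
    qed
    also have "\<dots> \<le> (\<Sum>j<J. \<Sum>n\<in>{j * k..<j * k + k}. p n)"
    proof -
      have "(\<Sum>j<J. 1 / real (Suc j)) - 1 \<le> (\<Sum>j<J. if j = 0 then 0 else 1 / real (Suc j))"
      proof (cases J)
        case (Suc J')
        then show ?thesis by (simp add: sum.lessThan_Suc_shift del: sum.lessThan_Suc of_nat_Suc)
      qed simp
      then have "real k * (c * ((\<Sum>j<J. 1 / real (Suc j)) - 1)) \<le> real k * (c * (\<Sum>j<J. if j = 0 then 0 else 1 / real (Suc j)))"
        using c(1) by (intro mult_left_mono) auto
      also have "\<dots> = (\<Sum>j<J. \<Sum>n\<in>{j * k..<j * k + k}. if j = 0 then 0 else c / real (Suc j))"
        by (simp add: sum_distrib_left del: of_nat_Suc) (intro sum.cong, auto)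
      also have "\<dots> \<le> (\<Sum>j<J. \<Sum>n\<in>{j * k..<j * k + k}. p n)"
        using block by (intro sum_mono) (auto simp: p_def)
      finally show ?thesis .
    qed
    also have "\<dots> = (\<Sum>n<J * k. p n)" by (rule sum.nat_group)
    finally have big: "real k * (9 / e) < (\<Sum>n<J * k. p n)" .
    have "no_return_prob (J * k) < e"
    proof (rule ccontr)
      assume "\<not> ?thesis"
      then have ge: "e \<le> no_return_prob (J * k)" by simp
      have "real k * 9 = real k * (9 / e) * e" using e by simp
      also have "\<dots> < (\<Sum>n<J * k. p n) * e" using big e by (rule mult_strict_right_mono)
      also have "\<dots> \<le> (\<Sum>n<J * k. p n) * no_return_prob (J * k)"
        using ge by (intro mult_left_mono) (auto simp: p_def intro: sum_nonneg)
      also have "\<dots> \<le> (2 * real R + 1)\<^sup>2" unfolding p_def by (rule visits_times_no_return_le)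
      also have "\<dots> \<le> (3 * real R)\<^sup>2" using R(1) by (intro power_mono) auto
      also have "\<dots> = real k * 9" by (simp add: k_def power_mult_distrib)
      finally show False by simp
    qed
    then show ?thesis by blast
  qed
  show ?thesis
  proof (rule LIMSEQ_I)
    fix e :: real assume "0 < e"
    then obtain N where "no_return_prob N < e" using small by blast
    then have "norm (no_return_prob n - 0) < e" if "n \<ge> N" for n
      using no_return_prob_antimono[OF that] by (simp add: no_return_prob_def)
    then show "\<exists>no. \<forall>n\<ge>no. norm (no_return_prob n - 0) < e" by blast
  qed
qed

end

section \<open>Comparison of the excited walk with the random walk\<close>

lemma converges_in_distribution_perturb:
  fixes Y Y' :: "nat \<Rightarrow> 'a \<Rightarrow> 'b::{real_normed_vector, second_countable_topology} path"
  assumes M: "prob_space M" and P: "prob_space P" and conv: "converges_in_distribution M Y P Z"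
    and Y' [measurable]: "\<And>n. Y' n \<in> borel_measurable M"
    and close: "(\<lambda>n. \<integral>\<omega>. dist (Y' n \<omega>) (Y n \<omega>) \<partial>M) \<longlonglongrightarrow> 0"
  shows "converges_in_distribution M Y' P Z"
proof (rule converges_in_distribution_if_lipschitz[OF M P Y'])
  interpret M: prob_space M by fact
  have Y [measurable]: "Y n \<in> borel_measurable M" for n using conv by (simp add: converges_in_distribution_def)
  show "Z \<in> borel_measurable P" using conv by (simp add: converges_in_distribution_def)
  fix f :: "'b path \<Rightarrow> real" and L B
  assume B: "\<And>x. \<bar>f x\<bar> \<le> B" and lip: "\<And>x y. \<bar>f x - f y\<bar> \<le> L * dist x y"
  have lip': "\<bar>f x - f y\<bar> \<le> \<bar>L\<bar> * dist x y" for x y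
    by (rule order_trans[OF lip]) (intro mult_right_mono, auto)
  have cont: "continuous_on UNIV f"
    by (rule lipschitz_on_continuous_on[OF lipschitz_onI[of _ _ "\<bar>L\<bar>"]]) (auto simp: dist_real_def lip')
  have [measurable]: "f \<in> borel_measurable borel" by (rule borel_measurable_continuous_onI[OF cont])
  have int: "integrable M (\<lambda>\<omega>. f (V \<omega>))" if [measurable]: "V \<in> borel_measurable M" for V
    by (rule M.integrable_const_bound[of _ B]) (use B in auto)
  have bd: "bounded (range f)" using B by (auto simp: bounded_iff)
  have "(\<lambda>n. M.expectation (\<lambda>\<omega>. f (Y' n \<omega>)) - M.expectation (\<lambda>\<omega>. f (Y n \<omega>))) \<longlonglongrightarrow> 0"
  proof (rule Lim_null_comparison[OF always_eventually])
    show "\<forall>n. norm (M.expectation (\<lambda>\<omega>. f (Y' n \<omega>)) - M.expectation (\<lambda>\<omega>. f (Y n \<omega>)))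
        \<le> \<bar>L\<bar> * M.expectation (\<lambda>\<omega>. dist (Y' n \<omega>) (Y n \<omega>))"
    proof
      fix n
      have id: "integrable M (\<lambda>\<omega>. dist (Y' n \<omega>) (Y n \<omega>))"
        by (rule M.integrable_const_bound[of _ 1]) (auto simp: dist_path_le_1)
      have "norm (M.expectation (\<lambda>\<omega>. f (Y' n \<omega>)) - M.expectation (\<lambda>\<omega>. f (Y n \<omega>))) = \<bar>M.expectation (\<lambda>\<omega>. f (Y' n \<omega>) - f (Y n \<omega>))\<bar>"
        by (subst Bochner_Integration.integral_diff) (auto intro!: int)
      also have "\<dots> \<le> M.expectation (\<lambda>\<omega>. \<bar>f (Y' n \<omega>) - f (Y n \<omega>)\<bar>)" by (rule integral_abs_bound)
      also have "\<dots> \<le> M.expectation (\<lambda>\<omega>. \<bar>L\<bar> * dist (Y' n \<omega>) (Y n \<omega>))"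
        by (intro integral_mono integrable_abs Bochner_Integration.integrable_diff int integrable_mult_right id lip') auto
      also have "\<dots> = \<bar>L\<bar> * M.expectation (\<lambda>\<omega>. dist (Y' n \<omega>) (Y n \<omega>))" by simp
      finally show "norm (M.expectation (\<lambda>\<omega>. f (Y' n \<omega>)) - M.expectation (\<lambda>\<omega>. f (Y n \<omega>)))
        \<le> \<bar>L\<bar> * M.expectation (\<lambda>\<omega>. dist (Y' n \<omega>) (Y n \<omega>))" .
    qed
    show "(\<lambda>n. \<bar>L\<bar> * M.expectation (\<lambda>\<omega>. dist (Y' n \<omega>) (Y n \<omega>))) \<longlonglongrightarrow> 0"
      using tendsto_mult_left[OF close, of "\<bar>L\<bar>"] by simp
  qed
  moreover have "(\<lambda>n. M.expectation (\<lambda>\<omega>. f (Y n \<omega>))) \<longlonglongrightarrow> (\<integral>\<omega>. f (Z \<omega>) \<partial>P)"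
    using conv cont bd unfolding converges_in_distribution_def by blast
  ultimately have "(\<lambda>n. (M.expectation (\<lambda>\<omega>. f (Y' n \<omega>)) - M.expectation (\<lambda>\<omega>. f (Y n \<omega>))) + M.expectation (\<lambda>\<omega>. f (Y n \<omega>)))
      \<longlonglongrightarrow> 0 + (\<integral>\<omega>. f (Z \<omega>) \<partial>P)" by (rule tendsto_add)
  then show "(\<lambda>n. M.expectation (\<lambda>\<omega>. f (Y' n \<omega>))) \<longlonglongrightarrow> (\<integral>\<omega>. f (Z \<omega>) \<partial>P)" by simp
qed

lemma sum_inverse_sqrt_le: "(\<Sum>i=1..N. 1 / sqrt (real i)) \<le> 2 * sqrt (real N)"
proof (induction N)
  case (Suc N)
  have pos: "0 < sqrt (real (Suc N)) + sqrt (real N)" by (simp add: add_pos_nonneg)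
  have "(sqrt (real (Suc N)) - sqrt (real N)) * (sqrt (real (Suc N)) + sqrt (real N)) = 1"
    by (simp add: algebra_simps)
  then have "sqrt (real (Suc N)) - sqrt (real N) = 1 / (sqrt (real (Suc N)) + sqrt (real N))"
    using pos by (simp add: field_simps)
  also have "\<dots> \<ge> 1 / (2 * sqrt (real (Suc N)))"
    using pos by (intro divide_left_mono) auto
  finally have "1 / sqrt (real (Suc N)) \<le> 2 * sqrt (real (Suc N)) - 2 * sqrt (real N)" by (simp add: field_simps)
  then show ?case using Suc by (simp del: of_nat_Suc)
qed simp

text \<open>A null sequence stays negligible when averaged with the weights \<open>1 / sqrt i\<close>, whose sum up to
  \<open>N\<close> is of order \<open>sqrt N\<close>.\<close>

lemma null_weighted_average:
  fixes a :: "nat \<Rightarrow> real"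
  assumes a: "a \<longlonglongrightarrow> 0" "\<And>i. 0 \<le> a i" "\<And>i. a i \<le> 1"
  shows "(\<lambda>n. (\<Sum>i=1..Suc (n * T). a (i - 1) / sqrt (real i)) / sqrt (real n)) \<longlonglongrightarrow> 0"
proof (rule LIMSEQ_I)
  fix e :: real assume e: "0 < e"
  define d where "d = e / (4 * sqrt (real (Suc T)))"
  have d: "0 < d" using e by (simp add: d_def)
  obtain m where m: "\<And>i. i \<ge> m \<Longrightarrow> a i < d"
    using order_tendstoD(2)[OF a(1) d] unfolding eventually_sequentially by blast
  have bound: "(\<Sum>i=1..N. a (i - 1) / sqrt (real i)) \<le> real m + d * (2 * sqrt (real N))" for N
  proof -
    have "(\<Sum>i=1..N. a (i - 1) / sqrt (real i)) \<le> (\<Sum>i=1..N. (if i \<le> m then 1 else 0) + d * (1 / sqrt (real i)))"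
    proof (rule sum_mono)
      fix i assume i: "i \<in> {1..N}"
      show "a (i - 1) / sqrt (real i) \<le> (if i \<le> m then 1 else 0) + d * (1 / sqrt (real i))"
      proof (cases "i \<le> m")
        case True
        have "a (i - 1) / sqrt (real i) \<le> 1 / 1" using i a(2,3) by (intro frac_le) auto
        moreover have "0 \<le> d * (1 / sqrt (real i))" using d by simp
        ultimately show ?thesis using True by simp
      next
        case False
        then have "m \<le> i - 1" by simp
        then have "a (i - 1) \<le> d" using m by (intro less_imp_le)
        then have "a (i - 1) / sqrt (real i) \<le> d / sqrt (real i)" by (intro divide_right_mono) auto
        then show ?thesis using False by simp
      qed
    qed
    also have "\<dots> = (\<Sum>i=1..N. if i \<le> m then 1 else 0) + d * (\<Sum>i=1..N. 1 / sqrt (real i))"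
      by (simp add: sum.distrib sum_distrib_left)
    also have "(\<Sum>i=1..N. if i \<le> m then 1 else 0 :: real) \<le> real m"
    proof -
      have "(\<Sum>i=1..N. if i \<le> m then 1 else 0 :: real) = real (card ({1..N} \<inter> {i. i \<le> m}))"
        by (simp add: sum.If_cases)
      also have "\<dots> \<le> real (card {1..m})" by (intro of_nat_mono card_mono) auto
      finally show ?thesis by simp
    qed
    also have "d * (\<Sum>i=1..N. 1 / sqrt (real i)) \<le> d * (2 * sqrt (real N))"
      using d by (intro mult_left_mono sum_inverse_sqrt_le) auto
    finally show ?thesis by simp
  qed
  have "(\<lambda>n. real m / sqrt (real n)) \<longlonglongrightarrow> 0"
    by (rule real_tendsto_divide_at_top[OF tendsto_const filterlim_compose[OF sqrt_at_top filterlim_real_sequentially]])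
  then have "\<forall>\<^sub>F n in sequentially. real m / sqrt (real n) < e / 2"
    using e by (intro order_tendstoD(2)) auto
  then obtain n0 where n0: "\<And>n. n \<ge> n0 \<Longrightarrow> real m / sqrt (real n) < e / 2"
    unfolding eventually_sequentially by blast
  have "norm ((\<Sum>i=1..Suc (n * T). a (i - 1) / sqrt (real i)) / sqrt (real n) - 0) < e" if n: "n \<ge> max n0 1" for n
  proof -
    have n1: "1 \<le> n" using n by simp
    have "Suc (n * T) \<le> n * Suc T" using n1 by simp
    then have "sqrt (real (Suc (n * T))) \<le> sqrt (real (n * Suc T))" by (intro real_sqrt_le_mono of_nat_mono)
    also have "\<dots> = sqrt (real n) * sqrt (real (Suc T))" unfolding of_nat_mult real_sqrt_mult ..
    finally have s: "sqrt (real (Suc (n * T))) \<le> sqrt (real n) * sqrt (real (Suc T))" .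
    have "(\<Sum>i=1..Suc (n * T). a (i - 1) / sqrt (real i)) / sqrt (real n)
        \<le> (real m + d * (2 * (sqrt (real n) * sqrt (real (Suc T))))) / sqrt (real n)"
      using d s by (intro divide_right_mono order_trans[OF bound] add_left_mono mult_left_mono) auto
    also have "\<dots> = real m / sqrt (real n) + d * (2 * sqrt (real (Suc T)))"
      using n1 by (simp add: add_divide_distrib del: of_nat_Suc)
    also have "d * (2 * sqrt (real (Suc T))) = e / 2" by (simp add: d_def del: of_nat_Suc)
    also have "real m / sqrt (real n) + e / 2 < e"
    proof -
      have "n0 \<le> n" using n by simp
      from n0[OF this] show ?thesis by linarith
    qed
    finally have "(\<Sum>i=1..Suc (n * T). a (i - 1) / sqrt (real i)) / sqrt (real n) < e" .
    moreover have "0 \<le> (\<Sum>i=1..Suc (n * T). a (i - 1) / sqrt (real i)) / sqrt (real n)"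
      using a(2) by (intro divide_nonneg_nonneg sum_nonneg) auto
    ultimately show ?thesis by (simp only: real_norm_def diff_0_right abs_of_nonneg)
  qed
  then show "\<exists>no. \<forall>n\<ge>no. norm ((\<Sum>i=1..Suc (n * T). a (i - 1) / sqrt (real i)) / sqrt (real n) - 0) < e" by blast
qed

context excited_random_walk
begin

definition excited :: "nat \<Rightarrow> 'a set" where
  "excited i = {\<omega> \<in> space M. \<omega> \<notin> revisit M X (i - 1) \<and> U i \<omega> \<le> p i}"

definition fresh_prob :: "nat \<Rightarrow> real" where
  "fresh_prob n = prob (space M - revisit M X n)"

lemma X_decomp:
  assumes "\<omega> \<in> space M"
  shows "X n \<omega> = (\<Sum>i=1..n. \<xi> i \<omega> + indicator (excited i) \<omega> *\<^sub>R (\<gamma> i \<omega> - \<xi> i \<omega>))"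
  unfolding X_eq[OF assms]
  by (intro sum.cong refl) (use assms in \<open>auto simp: excited_def indicator_def\<close>)

text \<open>The space \<open>N\<close> stands for a coarser \<open>\<sigma>\<close>-algebra, such as the one generated by the steps and by the
  variables \<open>U i\<close> with \<open>i \<le> n\<close>.\<close>

lemma X_measurable_wrt:
  assumes sp: "space N = space M"
    and \<xi>: "\<And>i. 1 \<le> i \<Longrightarrow> \<xi> i \<in> borel_measurable N" and \<gamma>: "\<And>i. 1 \<le> i \<Longrightarrow> \<gamma> i \<in> borel_measurable N"
    and U: "\<And>i. 1 \<le> i \<Longrightarrow> i \<le> n \<Longrightarrow> U i \<in> borel_measurable N"
    and m: "m \<le> n"
  shows "X m \<in> borel_measurable N"
  using m
proof (induction m rule: less_induct)
  case (less m)
  have ex: "excited i \<in> sets N" if i: "i \<in> {1..m}" for i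
  proof -
    have Xk: "X k \<in> borel_measurable N" if "k \<le> i - 1" for k
      using less that i by auto
    have Ui: "U i \<in> borel_measurable N" using U i less.prems by auto
    have "excited i = {\<omega> \<in> space N. \<not> (\<exists>k<i - 1. X k \<omega> = X (i - 1) \<omega>) \<and> U i \<omega> \<le> p i}"
      unfolding excited_def revisit_def sp by auto
    also have "\<dots> \<in> sets N"
    proof -
      have "{\<omega> \<in> space N. X k \<omega> = X (i - 1) \<omega>} \<in> sets N" if "k < i - 1" for k
        using Xk[of k] Xk[of "i - 1"] that by simp
      then have "{\<omega> \<in> space N. \<exists>k\<in>{..<i - 1}. X k \<omega> = X (i - 1) \<omega>} \<in> sets N"
        by (intro sets.sets_Collect_finite_Ex) auto
      moreover have "{\<omega> \<in> space N. U i \<omega> \<le> p i} \<in> sets N" using Ui by measurable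
      ultimately have "{\<omega> \<in> space N. U i \<omega> \<le> p i} - {\<omega> \<in> space N. \<exists>k\<in>{..<i - 1}. X k \<omega> = X (i - 1) \<omega>} \<in> sets N"
        by (rule sets.Diff[rotated])
      moreover have "{\<omega> \<in> space N. U i \<omega> \<le> p i} - {\<omega> \<in> space N. \<exists>k\<in>{..<i - 1}. X k \<omega> = X (i - 1) \<omega>}
          = {\<omega> \<in> space N. \<not> (\<exists>k<i - 1. X k \<omega> = X (i - 1) \<omega>) \<and> U i \<omega> \<le> p i}" by auto
      ultimately show ?thesis by (simp only:)
    qed
    finally show ?thesis .
  qed
  have "(\<lambda>\<omega>. \<Sum>i=1..m. \<xi> i \<omega> + indicator (excited i) \<omega> *\<^sub>R (\<gamma> i \<omega> - \<xi> i \<omega>)) \<in> borel_measurable N"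
    using ex \<xi> \<gamma> by (intro borel_measurable_sum borel_measurable_add borel_measurable_scaleR
        borel_measurable_diff borel_measurable_indicator) auto
  then show ?case
    by (subst measurable_cong[of N "X m" _, OF X_decomp]) (simp_all add: sp)
qed

lemma steps_random_variables:
  "1 \<le> i \<Longrightarrow> \<xi> i \<in> borel_measurable M" "1 \<le> i \<Longrightarrow> \<gamma> i \<in> borel_measurable M" "1 \<le> i \<Longrightarrow> U i \<in> borel_measurable M"
  using \<xi>_iid \<gamma>_iid U_iid by (auto simp: iid_from_1_def indep_vars_def)

lemma X_meas [measurable]: "X n \<in> borel_measurable M"
  by (rule X_measurable_wrt[of M n]) (auto intro: steps_random_variables)

lemma revisit_meas [measurable]: "revisit M X n \<in> events"
  unfolding revisit_def by measurable

lemma excited_meas [measurable]: "1 \<le> i \<Longrightarrow> excited i \<in> events"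
proof -
  assume "1 \<le> i"
  then have [measurable]: "U i \<in> borel_measurable M" by (rule steps_random_variables)
  have "excited i = {\<omega> \<in> space M. U i \<omega> \<le> p i} - revisit M X (i - 1)" by (auto simp: excited_def)
  then show ?thesis by simp
qed

lemma prob_U_le: "1 \<le> i \<Longrightarrow> prob {\<omega> \<in> space M. U i \<omega> \<le> p i} = p i"
proof -
  assume i: "1 \<le> i"
  have [measurable]: "U i \<in> borel_measurable M" by (rule steps_random_variables[OF i])
  have pi: "0 < p i" "p i \<le> 1" using p_range[of i] i by auto
  have "prob {\<omega> \<in> space M. U i \<omega> \<le> p i} = prob (U i -` {..p i} \<inter> space M)"
    by (intro arg_cong[of _ _ prob]) auto
  also have "\<dots> = measure (distr M lborel (U i)) {..p i}" by (subst measure_distr) auto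
  also have "\<dots> = measure (uniform_measure lborel {0..1}) {..p i}" using U_uniform[of i] i by simp
  also have "\<dots> = measure lborel ({0..1} \<inter> {..p i})" by (simp add: measure_uniform_measure)
  also have "{0..1} \<inter> {..p i} = {0..p i}" using pi by auto
  finally show ?thesis using pi by simp
qed

text \<open>Whether a site is new at time \<open>i - 1\<close> depends on the steps and on the variables \<open>U j\<close> with
  \<open>j < i\<close> only. The events describing these form a \<open>\<pi>\<close>-system generating a \<open>\<sigma>\<close>-algebra independent
  of \<open>U i\<close>.\<close>

lemma prob_excited:
  assumes i: "1 \<le> i"
  shows "prob (excited i) = fresh_prob (i - 1) * p i"
proof -
  let ?b = "\<lambda>_. borel :: real measure" and ?v = "\<lambda>_. borel :: (real^'d) measure"
  let ?Q = "PiM {1..} ?v \<Otimes>\<^sub>M PiM {1..} ?v"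
  let ?past = "\<lambda>\<omega>. restrict (\<lambda>j. U j \<omega>) {1..<i}" and ?now = "\<lambda>\<omega>. restrict (\<lambda>j. U j \<omega>) {i}"
  let ?all = "\<lambda>\<omega>. \<lambda>j\<in>{1..}. U j \<omega>" and ?steps = "\<lambda>\<omega>. (\<lambda>j\<in>{1..}. \<xi> j \<omega>, \<lambda>j\<in>{1..}. \<gamma> j \<omega>)"
  have U: "U j \<in> borel_measurable M" if "1 \<le> j" for j using that by (rule steps_random_variables)
  have indU: "indep_vars ?b U {1..}" using U_iid by (simp add: iid_from_1_def)
  have past_now: "indep_var (PiM {i} ?b) ?now (PiM {1..<i} ?b) ?past"
    by (rule indep_var_restrict[OF indU]) (use i in auto)
  have past_rv: "?past \<in> measurable M (PiM {1..<i} ?b)" and now_rv: "?now \<in> measurable M (PiM {i} ?b)"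
    using past_now by (auto dest: indep_var_rv1 indep_var_rv2)
  have steps_rv: "?steps \<in> measurable M ?Q"
    and ind_all: "indep_set {?all -` A \<inter> space M | A. A \<in> sets (PiM {1..} ?b)} {?steps -` A \<inter> space M | A. A \<in> sets ?Q}"
    using U_indep unfolding indep_rvs_def by auto
  define \<U> where "\<U> = {U i -` S \<inter> space M | S. S \<in> sets borel}"
  define \<G> where "\<G> = {(?past -` S \<inter> space M) \<inter> (?steps -` T \<inter> space M) | S T. S \<in> sets (PiM {1..<i} ?b) \<and> T \<in> sets ?Q}"
  have ind: "indep_set \<U> \<G>"
    unfolding indep_sets2_eq
  proof (intro conjI ballI)
    show "\<U> \<subseteq> events" unfolding \<U>_def using U[OF i] by (auto dest: measurable_sets)
    show "\<G> \<subseteq> events" unfolding \<G>_def using past_rv steps_rv by (auto dest: measurable_sets)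
    fix u g assume "u \<in> \<U>" "g \<in> \<G>"
    then obtain S0 S T where S0: "S0 \<in> sets borel" "u = U i -` S0 \<inter> space M"
      and ST: "S \<in> sets (PiM {1..<i} ?b)" "T \<in> sets ?Q" "g = (?past -` S \<inter> space M) \<inter> (?steps -` T \<inter> space M)"
      unfolding \<U>_def \<G>_def by auto
    define a where "a = ?past -` S \<inter> space M"
    define b where "b = ?steps -` T \<inter> space M"
    define S1 where "S1 = {x \<in> space (PiM {i} ?b). x i \<in> S0}"
    have S1: "S1 \<in> sets (PiM {i} ?b)" unfolding S1_def using S0(1) by measurable
    have u_now: "u = ?now -` S1 \<inter> space M" unfolding S0(2) S1_def by (auto simp: space_PiM)
    have ua: "prob (u \<inter> a) = prob u * prob a"
    proof -
      have "u \<inter> a = (\<lambda>\<omega>. (?now \<omega>, ?past \<omega>)) -` (S1 \<times> S) \<inter> space M" unfolding u_now a_def by auto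
      then show ?thesis using indep_varD[OF past_now S1 ST(1)] unfolding u_now a_def by simp
    qed
    have all_b: "prob (w \<inter> b) = prob w * prob b" if "\<exists>A\<in>sets (PiM {1..} ?b). w = ?all -` A \<inter> space M" for w
      using ind_all that ST(2) unfolding indep_sets2_eq b_def by blast
    have "\<exists>A\<in>sets (PiM {1..} ?b). u \<inter> a = ?all -` A \<inter> space M"
    proof
      let ?A = "{x \<in> space (PiM {1..} ?b). x i \<in> S0} \<inter> {x \<in> space (PiM {1..} ?b). restrict x {1..<i} \<in> S}"
      have r: "(\<lambda>x. restrict x {1..<i}) \<in> measurable (PiM {1..} ?b) (PiM {1..<i} ?b)"
        by (rule measurable_restrict_subset) auto
      have c: "(\<lambda>x. x i) \<in> measurable (PiM {1..} ?b) borel" by (rule measurable_component_singleton) (use i in simp)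
      show "?A \<in> sets (PiM {1..} ?b)"
        using measurable_sets[OF r ST(1)] measurable_sets[OF c S0(1)]
        by (intro sets.Int) (auto simp: vimage_def Int_def conj_commute)
      have "restrict (?all \<omega>) {1..<i} = ?past \<omega>" for \<omega> by (auto simp: restrict_def fun_eq_iff)
      then show "u \<inter> a = ?all -` ?A \<inter> space M"
        unfolding S0(2) a_def using i by (auto simp: space_PiM)
    qed
    moreover have "\<exists>A\<in>sets (PiM {1..} ?b). a = ?all -` A \<inter> space M"
    proof
      let ?A = "{x \<in> space (PiM {1..} ?b). restrict x {1..<i} \<in> S}"
      have r: "(\<lambda>x. restrict x {1..<i}) \<in> measurable (PiM {1..} ?b) (PiM {1..<i} ?b)"
        by (rule measurable_restrict_subset) auto
      show "?A \<in> sets (PiM {1..} ?b)"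
        using measurable_sets[OF r ST(1)] by (auto simp: vimage_def Int_def conj_commute)
      have "restrict (?all \<omega>) {1..<i} = ?past \<omega>" for \<omega> by (auto simp: restrict_def fun_eq_iff)
      then show "a = ?all -` ?A \<inter> space M"
        unfolding a_def by (auto simp: space_PiM)
    qed
    ultimately have "prob ((u \<inter> a) \<inter> b) = prob u * (prob a * prob b)" "prob (a \<inter> b) = prob a * prob b"
      using all_b ua by (auto simp: mult.assoc)
    then show "prob (u \<inter> g) = prob u * prob g"
      unfolding ST(3) a_def[symmetric] b_def[symmetric] by (simp add: Int_assoc)
  qed
  have "Int_stable \<U>"
    unfolding Int_stable_def \<U>_def
  proof clarsimp
    fix S S' :: "real set" assume "S \<in> sets borel" "S' \<in> sets borel"
    then show "\<exists>S''. U i -` S \<inter> space M \<inter> (U i -` S' \<inter> space M) = U i -` S'' \<inter> space M \<and> S'' \<in> sets borel"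
      by (intro exI[of _ "S \<inter> S'"]) auto
  qed
  moreover have "Int_stable \<G>"
    unfolding Int_stable_def
  proof (intro ballI)
    fix g g' assume "g \<in> \<G>" "g' \<in> \<G>"
    then obtain S T S' T' where *: "S \<in> sets (PiM {1..<i} ?b)" "T \<in> sets ?Q" "g = (?past -` S \<inter> space M) \<inter> (?steps -` T \<inter> space M)"
      "S' \<in> sets (PiM {1..<i} ?b)" "T' \<in> sets ?Q" "g' = (?past -` S' \<inter> space M) \<inter> (?steps -` T' \<inter> space M)"
      unfolding \<G>_def by auto
    then have "g \<inter> g' = (?past -` (S \<inter> S') \<inter> space M) \<inter> (?steps -` (T \<inter> T') \<inter> space M)" by auto
    then show "g \<inter> g' \<in> \<G>" unfolding \<G>_def using sets.Int[OF *(1,4)] sets.Int[OF *(2,5)] by blast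
  qed
  ultimately have ind': "indep_set (sigma_sets (space M) \<U>) (sigma_sets (space M) \<G>)"
    using ind by (intro indep_set_sigma_sets)
  define N where "N = sigma (space M) \<G>"
  have \<G>_sub: "\<G> \<subseteq> Pow (space M)" by (auto simp: \<G>_def)
  have N: "space N = space M" "sets N = sigma_sets (space M) \<G>"
    unfolding N_def using \<G>_sub by (auto simp: space_measure_of_conv sets_measure_of)
  have past_sets: "?past -` S \<inter> space M \<in> sets N" if "S \<in> sets (PiM {1..<i} ?b)" for S
  proof -
    have "?past -` S \<inter> space M = (?past -` S \<inter> space M) \<inter> (?steps -` space ?Q \<inter> space M)"
      using measurable_space[OF steps_rv] by auto
    then have "?past -` S \<inter> space M \<in> \<G>" unfolding \<G>_def using that sets.top by blast
    then show ?thesis unfolding N by (rule sigma_sets.Basic)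
  qed
  have steps_sets: "?steps -` T \<inter> space M \<in> sets N" if "T \<in> sets ?Q" for T
  proof -
    have "?steps -` T \<inter> space M = (?past -` space (PiM {1..<i} ?b) \<inter> space M) \<inter> (?steps -` T \<inter> space M)"
      using measurable_space[OF past_rv] by auto
    then have "?steps -` T \<inter> space M \<in> \<G>" unfolding \<G>_def using that sets.top by blast
    then show ?thesis unfolding N by (rule sigma_sets.Basic)
  qed
  have past_N: "?past \<in> measurable N (PiM {1..<i} ?b)"
    using measurable_space[OF past_rv] past_sets by (intro measurableI) (auto simp: N(1))
  have steps_N: "?steps \<in> measurable N ?Q"
    using measurable_space[OF steps_rv] steps_sets by (intro measurableI) (auto simp: N(1))
  have X_N: "X k \<in> borel_measurable N" if k: "k \<le> i - 1" for k
  proof (rule X_measurable_wrt[OF N(1) _ _ _ k])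
    fix j :: nat assume j: "1 \<le> j"
    have c: "(\<lambda>x. fst x j) \<in> borel_measurable ?Q" "(\<lambda>x. snd x j) \<in> borel_measurable ?Q"
      by (rule measurable_compose[OF measurable_fst measurable_component_singleton]
          measurable_compose[OF measurable_snd measurable_component_singleton]; use j in simp)+
    show "\<xi> j \<in> borel_measurable N" "\<gamma> j \<in> borel_measurable N"
      using measurable_compose[OF steps_N c(1)] measurable_compose[OF steps_N c(2)] j by simp_all
    assume "j \<le> i - 1"
    then have ji: "j < i" using i by simp
    have "(\<lambda>x. x j) \<in> measurable (PiM {1..<i} ?b) borel" using i j ji by (intro measurable_component_singleton) auto
    then show "U j \<in> borel_measurable N"
      using measurable_compose[OF past_N, of "\<lambda>x. x j" borel] i j ji by simp
  qed
  have "revisit M X (i - 1) \<in> sets N"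
  proof -
    have "{\<omega> \<in> space N. \<exists>k\<in>{..<i - 1}. X k \<omega> = X (i - 1) \<omega>} \<in> sets N"
      using X_N by (intro sets.sets_Collect_finite_Ex) auto
    moreover have "{\<omega> \<in> space N. \<exists>k\<in>{..<i - 1}. X k \<omega> = X (i - 1) \<omega>} = revisit M X (i - 1)"
      by (auto simp: revisit_def N(1))
    ultimately show ?thesis by simp
  qed
  then have "space M - revisit M X (i - 1) \<in> sets N" 
    using sets.compl_sets[of "revisit M X (i - 1)" N] by (simp only: N(1))
  moreover have "{\<omega> \<in> space M. U i \<omega> \<le> p i} \<in> sigma_sets (space M) \<U>"
  proof (rule sigma_sets.Basic)
    have "{\<omega> \<in> space M. U i \<omega> \<le> p i} = U i -` {..p i} \<inter> space M" by auto
    then show "{\<omega> \<in> space M. U i \<omega> \<le> p i} \<in> \<U>"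
      unfolding \<U>_def by (intro CollectI exI[of _ "{..p i}"] conjI) (assumption, simp)
  qed
  ultimately have "prob ({\<omega> \<in> space M. U i \<omega> \<le> p i} \<inter> (space M - revisit M X (i - 1))) =
      prob {\<omega> \<in> space M. U i \<omega> \<le> p i} * prob (space M - revisit M X (i - 1))"
    unfolding N(2) by (intro indep_setD[OF ind'])
  moreover have "{\<omega> \<in> space M. U i \<omega> \<le> p i} \<inter> (space M - revisit M X (i - 1)) = excited i"
    by (auto simp: excited_def)
  ultimately show ?thesis by (simp add: prob_U_le[OF i] fresh_prob_def mult.commute)
qed


lemma shifted_steps_centered_bounded:
  assumes K: "\<And>i \<omega>. 1 \<le> i \<Longrightarrow> \<omega> \<in> space M \<Longrightarrow> norm (\<xi> i \<omega>) \<le> K"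
  shows "centered_bounded_steps M (\<lambda>i. \<xi> (Suc i)) K"
proof
  have "indep_vars (\<lambda>_. borel) \<xi> {1..}" using \<xi>_iid by (simp add: iid_from_1_def)
  then show "indep_vars (\<lambda>_. borel) (\<lambda>i. \<xi> (Suc i)) UNIV"
    by (rule indep_vars_inj_reindex) auto
  have "\<forall>i\<ge>1. distr M borel (\<xi> i) = distr M borel (\<xi> 1)"
    using \<xi>_iid unfolding iid_from_1_def by (rule conjunct2)
  then show "distr M borel (\<xi> (Suc i)) = distr M borel (\<xi> (Suc 0))" for i
    by (metis One_nat_def le_add1 plus_1_eq_Suc)
  show "expectation (\<xi> (Suc 0)) = 0" using \<xi>_mean[of 1] by simp
qed (use K in auto)

text \<open>A site that is new at time \<open>m\<close> was not visited during the last \<open>L\<close> steps. If none of these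
  steps was excited, they are steps of the random walk, which read backwards do not return
  to the origin.\<close>

lemma fresh_prob_le:
  assumes cb: "centered_bounded_steps M (\<lambda>i. \<xi> (Suc i)) K" and L: "L \<le> m"
  shows "fresh_prob m \<le> centered_bounded_steps.no_return_prob M (\<lambda>i. \<xi> (Suc i)) L + (\<Sum>j<L. p (m - j))"
proof -
  interpret S: centered_bounded_steps M "\<lambda>i. \<xi> (Suc i)" K by (rule cb)
  define N where "N = {\<omega> \<in> space M. \<forall>j\<in>{1..L}. (\<Sum>i<j. \<xi> (Suc (m - 1 - i)) \<omega>) \<noteq> 0}"
  define V where "V j = {\<omega> \<in> space M. U (m - j) \<omega> \<le> p (m - j)}" for j
  have V_meas: "V j \<in> events" if "j < L" for j
  proof -
    have [measurable]: "U (m - j) \<in> borel_measurable M" using that L by (intro steps_random_variables) simp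
    show ?thesis unfolding V_def by measurable
  qed
  have N_meas: "N \<in> events"
  proof -
    have [measurable]: "(\<lambda>\<omega>. \<Sum>i<j. \<xi> (Suc (m - 1 - i)) \<omega>) \<in> borel_measurable M" for j
      by (intro borel_measurable_sum S.steps_meas)
    show ?thesis unfolding N_def
      by (intro sets.sets_Collect_finite_All) (auto simp del: sum_eq_0_iff One_nat_def)
  qed
  have "inj_on (\<lambda>i. m - 1 - i) {..<L}" using L by (auto simp: inj_on_def)
  from S.no_return_prob_reindex[OF this] have prob_N: "prob N = S.no_return_prob L" by (simp add: N_def)
  have "space M - revisit M X m \<subseteq> N \<union> (\<Union>j<L. V j)"
  proof
    fix \<omega> assume \<omega>: "\<omega> \<in> space M - revisit M X m"
    show "\<omega> \<in> N \<union> (\<Union>j<L. V j)"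
    proof (cases "\<exists>j<L. \<omega> \<in> V j")
      case False
      have step: "X (m - i) \<omega> = X (m - Suc i) \<omega> + \<xi> (Suc (m - 1 - i)) \<omega>" if i: "i < L" for i
      proof -
        have mi: "m - i = Suc (m - Suc i)" "Suc (m - 1 - i) = m - i" using i L by auto
        have "\<omega> \<notin> excited (m - i)" using False i \<omega> by (auto simp: V_def excited_def)
        then have "\<omega> \<notin> excited (Suc (m - Suc i))" using mi(1) by simp
        then show ?thesis using \<omega> unfolding mi(2) unfolding mi(1) by (simp add: X_decomp)
      qed
      have sum: "X m \<omega> = X (m - j) \<omega> + (\<Sum>i<j. \<xi> (Suc (m - 1 - i)) \<omega>)" if "j \<le> L" for j
        using that
      proof (induction j)
        case (Suc j)
        then show ?case using step[of j] by (simp add: add.assoc add.commute)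
      qed simp
      have "(\<Sum>i<j. \<xi> (Suc (m - 1 - i)) \<omega>) \<noteq> 0" if j: "j \<in> {1..L}" for j
      proof
        assume "(\<Sum>i<j. \<xi> (Suc (m - 1 - i)) \<omega>) = 0"
        then have "X (m - j) \<omega> = X m \<omega>" using sum[of j] j by simp
        moreover have "m - j < m" using j L by auto
        ultimately show False using \<omega> by (auto simp: revisit_def)
      qed
      then show ?thesis using \<omega> by (simp add: N_def)
    qed auto
  qed
  then have "fresh_prob m \<le> prob (N \<union> (\<Union>j<L. V j))"
    unfolding fresh_prob_def using N_meas V_meas by (intro finite_measure_mono) auto
  also have "\<dots> \<le> prob N + prob (\<Union>j<L. V j)"
    by (intro measure_Un_le N_meas sets.finite_UN V_meas) auto
  also have "prob (\<Union>j<L. V j) \<le> (\<Sum>j<L. prob (V j))"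
    by (intro finite_measure_subadditive_finite) (use V_meas in auto)
  also have "(\<Sum>j<L. prob (V j)) = (\<Sum>j<L. p (m - j))"
    unfolding V_def by (intro sum.cong refl prob_U_le) (use L in auto)
  finally show ?thesis by (simp add: prob_N)
qed

text \<open>The excited walk leaves the random walk only at excited steps, by at most \<open>2 K\<close> each time.\<close>

lemma expectation_dist_random_walk_le:
  assumes K: "\<And>i \<omega>. 1 \<le> i \<Longrightarrow> \<omega> \<in> space M \<Longrightarrow> norm (\<xi> i \<omega>) \<le> K"
    "\<And>i \<omega>. 1 \<le> i \<Longrightarrow> \<omega> \<in> space M \<Longrightarrow> norm (\<gamma> i \<omega>) \<le> K"
  shows "expectation (\<lambda>\<omega>. dist (diffusive_path (\<lambda>k. X k \<omega>) n) (diffusive_path (\<lambda>k. \<Sum>i<k. \<xi> (Suc i) \<omega>) n))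
    \<le> 2 * K * (\<Sum>i=1..Suc (n * T). fresh_prob (i - 1) * p i) / sqrt (real n) + (1/2) ^ T"
proof -
  let ?d = "\<lambda>\<omega>. dist (diffusive_path (\<lambda>k. X k \<omega>) n) (diffusive_path (\<lambda>k. \<Sum>i<k. \<xi> (Suc i) \<omega>) n)"
  let ?N = "Suc (n * T)"
  have [measurable]: "\<xi> (Suc i) \<in> borel_measurable M" for i by (rule steps_random_variables) simp
  have d_meas: "?d \<in> borel_measurable M"
    by (intro borel_measurable_dist_path measurable_diffusive_path) measurable
  have d_int: "integrable M ?d"
    by (rule integrable_const_bound[of _ 1]) (use d_meas in \<open>auto simp: dist_path_le_1\<close>)
  obtain \<omega>0 where "\<omega>0 \<in> space M" using not_empty by blast
  then have K0: "0 \<le> K" by (intro order_trans[OF norm_ge_zero K(1)[of 1 \<omega>0]]) simp_all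
  have ind_int: "integrable M (indicator (excited i) :: 'a \<Rightarrow> real)" if "i \<in> {1..?N}" for i
    using that by (intro integrable_real_indicator) (auto simp: emeasure_eq_measure)
  define A where "A \<omega> = (\<Sum>i=1..?N. indicator (excited i) \<omega> :: real)" for \<omega>
  have A_int: "integrable M A" unfolding A_def[abs_def] by (intro Bochner_Integration.integrable_sum ind_int)
  have d_le: "?d \<omega> \<le> 2 * K * A \<omega> / sqrt (real n) + (1/2) ^ T" if \<omega>: "\<omega> \<in> space M" for \<omega>
  proof (rule dist_diffusive_path_le)
    fix k assume k: "k \<le> ?N"
    have "(\<Sum>i<k. \<xi> (Suc i) \<omega>) = (\<Sum>i=1..k. \<xi> i \<omega>)"
      by (simp add: sum.atLeast1_atMost_eq)
    then have "X k \<omega> - (\<Sum>i<k. \<xi> (Suc i) \<omega>) = (\<Sum>i=1..k. indicator (excited i) \<omega> *\<^sub>R (\<gamma> i \<omega> - \<xi> i \<omega>))"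
      by (simp add: X_decomp[OF \<omega>] sum.distrib)
    also have "norm \<dots> \<le> (\<Sum>i=1..k. indicator (excited i) \<omega> * (2 * K))"
    proof (rule sum_norm_le)
      fix i assume i: "i \<in> {1..k}"
      have "norm (\<gamma> i \<omega> - \<xi> i \<omega>) \<le> 2 * K"
        using norm_triangle_ineq4[of "\<gamma> i \<omega>" "\<xi> i \<omega>"] K(1)[of i \<omega>] K(2)[of i \<omega>] i \<omega> by simp
      then show "norm (indicator (excited i) \<omega> *\<^sub>R (\<gamma> i \<omega> - \<xi> i \<omega>)) \<le> indicator (excited i) \<omega> * (2 * K)"
        by (simp add: indicator_def)
    qed
    also have "\<dots> = 2 * K * (\<Sum>i=1..k. indicator (excited i) \<omega>)"
      by (simp add: sum_distrib_left mult.commute)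
    also have "\<dots> \<le> 2 * K * A \<omega>"
      unfolding A_def using k K0 by (intro mult_left_mono sum_mono2) auto
    finally show "norm (X k \<omega> - (\<Sum>i<k. \<xi> (Suc i) \<omega>)) \<le> 2 * K * A \<omega>" .
  qed
  have "expectation ?d \<le> expectation (\<lambda>\<omega>. 2 * K * A \<omega> / sqrt (real n) + (1/2) ^ T)"
    by (rule integral_mono_AE[OF d_int]) (use A_int d_le in \<open>auto intro!: AE_I2\<close>)
  also have "\<dots> = 2 * K * expectation A / sqrt (real n) + (1/2) ^ T"
    using A_int by (simp add: prob_space)
  also have "expectation A = (\<Sum>i=1..?N. prob (excited i))"
    unfolding A_def[abs_def] by (subst Bochner_Integration.integral_sum[OF ind_int]) (auto intro!: sum.cong)
  also have "\<dots> = (\<Sum>i=1..?N. fresh_prob (i - 1) * p i)"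
    by (intro sum.cong refl prob_excited) simp
  finally show ?thesis .
qed

end

theorem corollary2p2:
  fixes M :: "'a measure" and F :: "nat \<Rightarrow> 'a measure"
    and \<xi> \<gamma> :: "nat \<Rightarrow> 'a \<Rightarrow> real^2" and U :: "nat \<Rightarrow> 'a \<Rightarrow> real"
    and l :: "real^2" and X :: "nat \<Rightarrow> 'a \<Rightarrow> real^2" and C :: real
  assumes "C > 0"
    and "excited_random_walk M F \<xi> \<gamma> U (\<lambda>n. min (C * real n powr (- 1/2)) 1) l X"
  shows "\<exists>(P :: (real^2) path measure) S B.
           brownian_motion P S B \<and>
           converges_in_distribution M (\<lambda>n \<omega>. diffusive_path (\<lambda>k. X k \<omega>) n) P B"
proof -
  define p where "p n = min (C * real n powr (- 1/2)) 1" for n :: nat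
  interpret W: excited_random_walk M F \<xi> \<gamma> U p l X
    using assms(2) by (simp add: p_def[abs_def])
  obtain K where K: "\<And>i \<omega>. 1 \<le> i \<Longrightarrow> \<omega> \<in> space M \<Longrightarrow> norm (\<xi> i \<omega>) \<le> K"
    "\<And>i \<omega>. 1 \<le> i \<Longrightarrow> \<omega> \<in> space M \<Longrightarrow> norm (\<gamma> i \<omega>) \<le> K"
    using W.bounded_steps by blast
  have cb: "centered_bounded_steps M (\<lambda>i. \<xi> (Suc i)) K"
    by (rule W.shifted_steps_centered_bounded[OF K(1)])
  interpret S: centered_bounded_steps M "\<lambda>i. \<xi> (Suc i)" K by (rule cb)
  have nondeg: "0 < v \<bullet> (S.covariance *v v)" if v: "v \<noteq> 0" for v
  proof (rule ccontr)
    assume "\<not> ?thesis"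
    then have "W.expectation (\<lambda>\<omega>. (v \<bullet> \<xi> (Suc 0) \<omega>)\<^sup>2) = 0"
      using S.covariance_form_bounds(1)[of v] unfolding S.covariance_form by linarith
    then have "AE \<omega> in M. (v \<bullet> \<xi> (Suc 0) \<omega>)\<^sup>2 = 0"
      by (subst (asm) integral_nonneg_eq_0_iff_AE) (use S.integrable_inner_step_power[of v 0 2] in auto)
    then have "AE \<omega> in M. \<xi> 1 \<omega> \<bullet> (v /\<^sub>R norm v) = 0"
      by eventually_elim (simp add: inner_commute)
    moreover have [measurable]: "\<xi> 1 \<in> borel_measurable M" by (rule W.steps_random_variables) simp
    ultimately have "W.prob {\<omega> \<in> space M. \<xi> 1 \<omega> \<bullet> (v /\<^sub>R norm v) = 0} = 1"
      by (subst W.prob_Collect_eq_1) auto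
    then show False using W.\<xi>_nondegenerate[of 1 "v /\<^sub>R norm v"] v by simp
  qed
  interpret S: planar_lattice_steps M "\<lambda>i. \<xi> (Suc i)" K
    by unfold_locales (use W.lattice nondeg in auto)
  obtain \<nu> :: "(real^2) measure" where \<nu>: "prob_space \<nu>" "sets \<nu> = sets borel"
    "\<And>\<theta>. (CLINT x|\<nu>. iexp (\<theta> \<bullet> x)) = complex_of_real (exp (- (\<theta> \<bullet> (S.covariance *v \<theta>)) / 2))"
    using planar_gaussian_exists[OF S.covariance_sym nondeg] by blast
  obtain P :: "(real^2) path measure" and B where bm: "brownian_motion P S.covariance B"
    using brownian_motion_exists[OF S.covariance_sym nondeg \<nu>] by blast
  have P: "prob_space P" using bm unfolding brownian_motion_def by blast
  have p_le: "p i \<le> C / sqrt (real i)" if "1 \<le> i" for i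
  proof -
    have "real i powr (- 1/2) = 1 / sqrt (real i)"
      using powr_minus_divide[of "real i" "1/2"] powr_half_sqrt[of "real i"] by simp
    moreover have "p i \<le> C * real i powr (- 1/2)" unfolding p_def by (rule min.cobounded1)
    ultimately show ?thesis by simp
  qed
  have p_nonneg: "0 \<le> p i" for i using assms(1) by (simp add: p_def)
  have "p \<longlonglongrightarrow> 0"
  proof (rule tendsto_sandwich[OF _ _ tendsto_const])
    show "\<forall>\<^sub>F i in sequentially. 0 \<le> p i" by (simp add: p_nonneg)
    show "\<forall>\<^sub>F i in sequentially. p i \<le> C / sqrt (real i)"
      using p_le by (intro eventually_sequentiallyI[of 1])
    show "(\<lambda>i. C / sqrt (real i)) \<longlonglongrightarrow> 0"
      by (rule real_tendsto_divide_at_top[OF tendsto_const filterlim_compose[OF sqrt_at_top filterlim_real_sequentially]])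
  qed
  have fresh: "W.fresh_prob \<longlonglongrightarrow> 0"
  proof (rule LIMSEQ_I)
    fix e :: real assume e: "0 < e"
    obtain L where L: "S.no_return_prob L < e / 2"
      using order_tendstoD(2)[OF S.no_return_prob_tendsto, of "e / 2"] e unfolding eventually_sequentially by auto
    have "(\<lambda>m. \<Sum>j<L. p (m - j)) \<longlonglongrightarrow> (\<Sum>j<L. 0)"
      using \<open>p \<longlonglongrightarrow> 0\<close> by (intro tendsto_sum seq_offset_neg)
    then have "\<forall>\<^sub>F m in sequentially. (\<Sum>j<L. p (m - j)) < e / 2"
      using e by (intro order_tendstoD(2)) auto
    then have "\<forall>\<^sub>F m in sequentially. norm (W.fresh_prob m - 0) < e"
      using eventually_ge_at_top[of L]
    proof eventually_elim
      case (elim m)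
      have "0 \<le> W.fresh_prob m" by (simp add: W.fresh_prob_def)
      then show ?case using W.fresh_prob_le[OF cb elim(2)] L elim(1) by simp
    qed
    then show "\<exists>no. \<forall>n\<ge>no. norm (W.fresh_prob n - 0) < e" unfolding eventually_sequentially .
  qed
  have K0: "0 \<le> K" by (rule S.step_bound_nonneg)
  let ?d = "\<lambda>n. W.expectation (\<lambda>\<omega>. dist (diffusive_path (\<lambda>k. X k \<omega>) n) (S.scaled_walk n \<omega>))"
  have "?d \<longlonglongrightarrow> 0"
  proof (rule LIMSEQ_I)
    fix e :: real assume e: "0 < e"
    obtain T where T: "(1/2::real) ^ T < e / 2" using real_arch_pow_inv[of "e/2" "1/2"] e by auto
    define s where "s n = (\<Sum>i=1..Suc (n * T). W.fresh_prob (i - 1) / sqrt (real i)) / sqrt (real n)" for n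
    have "s \<longlonglongrightarrow> 0"
      unfolding s_def[abs_def] by (rule null_weighted_average[OF fresh]) (auto simp: W.fresh_prob_def)
    then have "(\<lambda>n. 2 * K * C * s n) \<longlonglongrightarrow> 2 * K * C * 0" by (rule tendsto_mult_left)
    then have "\<forall>\<^sub>F n in sequentially. 2 * K * C * s n < e / 2"
      using e by (intro order_tendstoD(2)) auto
    then have "\<forall>\<^sub>F n in sequentially. norm (?d n - 0) < e"
    proof eventually_elim
      case (elim n)
      have "(\<Sum>i=1..Suc (n * T). W.fresh_prob (i - 1) * p i) \<le> (\<Sum>i=1..Suc (n * T). C * (W.fresh_prob (i - 1) / sqrt (real i)))"
      proof (rule sum_mono)
        fix i assume "i \<in> {1..Suc (n * T)}"
        then have "W.fresh_prob (i - 1) * p i \<le> W.fresh_prob (i - 1) * (C / sqrt (real i))"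
          using p_le[of i] by (intro mult_left_mono) (auto simp: W.fresh_prob_def)
        then show "W.fresh_prob (i - 1) * p i \<le> C * (W.fresh_prob (i - 1) / sqrt (real i))" by (simp add: mult.commute)
      qed
      also have "\<dots> = C * (\<Sum>i=1..Suc (n * T). W.fresh_prob (i - 1) / sqrt (real i))" by (simp only: sum_distrib_left)
      finally have "2 * K * (\<Sum>i=1..Suc (n * T). W.fresh_prob (i - 1) * p i) / sqrt (real n)
          \<le> 2 * K * (C * (\<Sum>i=1..Suc (n * T). W.fresh_prob (i - 1) / sqrt (real i))) / sqrt (real n)"
        using K0 by (intro divide_right_mono mult_left_mono) auto
      also have "\<dots> = 2 * K * C * s n" by (simp add: s_def)
      finally have "?d n \<le> 2 * K * C * s n + (1/2) ^ T"
        using W.expectation_dist_random_walk_le[OF K, of n T]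
        unfolding S.scaled_walk_def S.walk_def by linarith
      moreover have "0 \<le> ?d n" by (rule integral_nonneg_AE) simp
      ultimately show ?case using elim T by simp
    qed
    then show "\<exists>no. \<forall>n\<ge>no. norm (?d n - 0) < e" unfolding eventually_sequentially .
  qed
  then have "converges_in_distribution M (\<lambda>n \<omega>. diffusive_path (\<lambda>k. X k \<omega>) n) P B"
    by (intro converges_in_distribution_perturb[OF W.prob_space_axioms P S.donsker[OF bm]] measurable_diffusive_path W.X_meas)
  then show ?thesis using bm by blast
qed

end
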